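(* Let $p^\star\colon[n_1]\times\cdots\times[n_d]\to\mathbb{R}$ be a Markov density whose transition kernels $p^\star(x_2|x_1),\dots,p^\star(x_d|x_{d-1})$ are independent of $d$, and such that the rank of the $k$-th unfolding matrix of $p^\star$ is $r_k$ for each $k=1,\dots,d-1$. Let $G_1^\star,\dots,G_d^\star$ be the cores of $p^\star$ obtained by applying the Markov-sketched TT-RS algorithm (described in the context) to $p^\star$ with target ranks $r_1,\dots,r_{d-1}$, and let $A_1^\star,\dots,A_{d-1}^\star$ be the resulting coefficient matrices. Let $\hat p$ be the empirical density of $N$ i.i.d. samples from $p^\star$, and let $\hat G_1,\dots,\hat G_d$ be the results of applying the same algorithm (same target ranks) to $\hat p$. Set - $n=\max_{1\le k\le d}n_k$ and $r=\max_{1\le k\le d-1}r_k$, - $c_P=\min\{\sigma_{r_1}(p^\star(x_1;x_2)),\ \min_{2\le k\le d-1}\sigma_{r_k}(p^\star(x_{k-1},x_k;x_{k+1}))\}$, - $c_G=\min_{1\le k\le d}|||G_k^\star|||$, - $c_A=\max\{1,\ \max_{1\le k\le d-1}\|(A_k^\star)^\dagger\|\}$. Given $\delta\in(0,1)$ and $\eta\in(0,1)$, suppose $$N\ge16\,c_A^2\Big(1+\frac1{c_G}\Big)^2\Big(1+\frac1{c_P}\Big)^2\frac{n^5r\log(2n^3d/\eta)}{\delta^2}.$$ Then, with probability at least $1-\eta$, $$\frac{\mathrm{dist}(\hat G_k,G_k^\star)}{|||G_k^\star|||}\le\delta\qquad\text{for all }k=1,\dots,d.$$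
   Context: Notation: $d\ge2$; $[n]=\{1,\dots,n\}$; $x_{i:j}=(x_i,\dots,x_j)$. A semicolon in the arguments of a function means that it is viewed as a matrix whose rows are indexed by the variables before the semicolon and whose columns are indexed by those after it. The $k$-th unfolding matrix of $p$ is $p(x_{1:k};x_{k+1:d})$. Writing a function $p$ with only some of its variables, such as $p(x_{k-1},x_k,x_{k+1})$, means its marginal in these variables (sum over all the others). A Markov density is a probability density (nonnegative, summing to 1) with $p(x_1,\dots,x_d)=p(x_1)p(x_2|x_1)\cdots p(x_d|x_{d-1})$; the conditionals $p(x_{k+1}|x_k)$ are its transition kernels. The hypothesis that they are independent of $d$ refers to $p^\star$ as depending on the dimension $d$. The empirical density of samples $y^{(1)},\dots,y^{(N)}$ is $\hat p(x)=\frac1N\#\{i:y^{(i)}=x\}$. $A^\dagger$ is the pseudoinverse, $\|A\|$ the spectral norm, $\sigma_r(A)$ the $r$-th largest singular value of a matrix $A$; $O(r)$ is the orthogonal group. Cores of $p$ are functions $G_1\colon[n_1]\times[r_1]\to\mathbb{R}$, $G_k\colon[r_{k-1}]\times[n_k]\times[r_k]\to\mathbb{R}$, $G_d\colon[r_{d-1}]\times[n_d]\to\mathbb{R}$ with $p(x_1,\dots,x_d)=\sum_{\alpha_1,\dots,\alpha_{d-1}}G_1(x_1,\alpha_1)G_2(\alpha_1,x_2,\alpha_2)\cdots G_d(\alpha_{d-1},x_d)$. Markov-sketched TT-RS. This is the algorithm TT-RS with sketch functions given by identity matrices, $T_{k+1}(x_{k+1:d},\gamma_k)=\mathbf 1[x_{k+1}=\gamma_k]$,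 $s_1(\beta_1,x_1)=\mathbf 1[\beta_1=x_1]$, $s_k(\beta_k,x_k,\beta_{k-1})=\mathbf 1[\beta_k=x_k]$; for an input $p\colon[n_1]\times\cdots\times[n_d]\to\mathbb{R}$ and target ranks $r_1,\dots,r_{d-1}$ it reads: (1) Form the marginals $\tilde\Phi_1=p(x_1,x_2)$; $\tilde\Phi_k=p(x_{k-1},x_k,x_{k+1})$ for $2\le k\le d-1$; $\tilde\Phi_d=p(x_{d-1},x_d)$. (2) $B_1\colon[n_1]\times[r_1]\to\mathbb{R}$ has as columns of $B_1(x_1;\alpha_1)$ the first $r_1$ left singular vectors of $p(x_1;x_2)$; for $2\le k\le d-1$, $B_k\colon[n_{k-1}]\times[n_k]\times[r_k]\to\mathbb{R}$ has as columns of $B_k(x_{k-1},x_k;\alpha_k)$ the first $r_k$ left singular vectors of $p(x_{k-1},x_k;x_{k+1})$; $B_d=p(x_{d-1},x_d)$. (3) The coefficient matrices are $A_1=B_1$ and $A_k(x_k,\alpha_k)=\sum_{x_{k-1}=1}^{n_{k-1}}B_k(x_{k-1},x_k,\alpha_k)$ for $2\le k\le d-1$. (4) Return the least-squares solutions $G_1,\dots,G_d$ of $G_1=B_1$; $\sum_{\alpha_{k-1}}A_{k-1}(x_{k-1};\alpha_{k-1})G_k(\alpha_{k-1};x_k,\alpha_k)=B_k(x_{k-1};x_k,\alpha_k)$, $2\le k\le d-1$; $\sum_{\alpha_{d-1}}A_{d-1}(x_{d-1};\alpha_{d-1})G_d(\alpha_{d-1};x_d)=B_d(x_{d-1};x_d)$.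 Norm and distance. For a 3-tensor $G\in\mathbb{R}^{a\times n\times b}$, $|||G|||=\max_{i\in[n]}\|G(\cdot,i,\cdot)\|$ (spectral norm of the $a\times b$ slice). For the first and last cores, $|||G_1|||=\max_{x_1}\|G_1(x_1,\cdot)\|$ and $|||G_d|||=\max_{x_d}\|G_d(\cdot,x_d)\|$ (Euclidean norms). For $\hat G,G\in\mathbb{R}^{a\times n\times b}$, $\mathrm{dist}(\hat G,G)=\min_{R_1\in O(a),R_2\in O(b)}|||\hat G-R_1\circ G\circ R_2|||$, where $R_1\circ G\circ R_2$ has slices $R_1G(\cdot,i,\cdot)R_2$. For first and last cores, $\mathrm{dist}(\hat G_1,G_1)=\min_{R\in O(r_1)}|||\hat G_1-G_1R|||$ and $\mathrm{dist}(\hat G_d,G_d)=\min_{R\in O(r_{d-1})}|||\hat G_d-RG_d|||$. *)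

theory Defs
  imports "HOL-Probability.Probability" "Jordan_Normal_Form.DL_Rank"
begin

definition euclid_norm :: "real vec \<Rightarrow> real" where
  "euclid_norm v = sqrt (scalar_prod v v)"

definition spectral_norm :: "real mat \<Rightarrow> real" where
  "spectral_norm A =
     Sup {euclid_norm (A *\<^sub>v v) |v. v \<in> carrier_vec (dim_col A) \<and> euclid_norm v \<le> 1}"

definition orthogonal_group :: "nat \<Rightarrow> real mat set" where
  "orthogonal_group m =
     {R \<in> carrier_mat m m. transpose_mat R * R = 1\<^sub>m m \<and> R * transpose_mat R = 1\<^sub>m m}"

definition is_svd :: "real mat \<Rightarrow> real mat \<Rightarrow> real mat \<Rightarrow> real mat \<Rightarrow> bool" where
  "is_svd M U S V \<longleftrightarrow>
     U \<in> orthogonal_group (dim_row M) \<and>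
     V \<in> orthogonal_group (dim_col M) \<and>
     S \<in> carrier_mat (dim_row M) (dim_col M) \<and>
     (\<forall>i<dim_row M. \<forall>j<dim_col M. i \<noteq> j \<longrightarrow> S $$ (i, j) = 0) \<and>
     (\<forall>i<min (dim_row M) (dim_col M). 0 \<le> S $$ (i, i)) \<and>
     (\<forall>j<min (dim_row M) (dim_col M). \<forall>i<j. S $$ (j, j) \<le> S $$ (i, i)) \<and>
     M = U * S * transpose_mat V"

text \<open>
  The \<open>s\<close>-th largest singular value, \<open>1 \<le> s \<le> min (dim_row M) (dim_col M)\<close>. Its value does
  not depend on the decomposition that is chosen.
\<close>
definition singular_value :: "real mat \<Rightarrow> nat \<Rightarrow> real" where
  "singular_value M s = (SOME c. \<exists>U S V. is_svd M U S V \<and> c = S $$ (s - 1, s - 1))"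

text \<open>
  Singular vectors are not unique, so this is a relation: the columns of \<open>B\<close> are the first \<open>s\<close>
  left singular vectors in some singular value decomposition of \<open>M\<close>.
\<close>
definition first_left_singular_vectors :: "real mat \<Rightarrow> nat \<Rightarrow> real mat \<Rightarrow> bool" where
  "first_left_singular_vectors M s B \<longleftrightarrow>
     s \<le> dim_row M \<and>
     (\<exists>U S V. is_svd M U S V \<and> B = Matrix.mat (dim_row M) s (\<lambda>(i, j). U $$ (i, j)))"

definition is_pseudoinverse :: "real mat \<Rightarrow> real mat \<Rightarrow> bool" where
  "is_pseudoinverse A X \<longleftrightarrow>
     X \<in> carrier_mat (dim_col A) (dim_row A) \<and>
     A * X * A = A \<and> X * A * X = X \<and>
     transpose_mat (A * X) = A * X \<and> transpose_mat (X * A) = X * A"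

definition pseudoinverse :: "real mat \<Rightarrow> real mat" where
  "pseudoinverse A = (THE X. is_pseudoinverse A X)"

definition frobenius_sq :: "real mat \<Rightarrow> real" where
  "frobenius_sq A = (\<Sum>i<dim_row A. \<Sum>j<dim_col A. (A $$ (i, j))\<^sup>2)"

text \<open>
  \<open>X\<close> is a least-squares solution of \<open>A X = B\<close>; if \<open>A\<close> does not have full column rank there are
  several, and all of them are admitted.
\<close>
definition least_squares :: "real mat \<Rightarrow> real mat \<Rightarrow> real mat \<Rightarrow> bool" where
  "least_squares A B X \<longleftrightarrow>
     X \<in> carrier_mat (dim_col A) (dim_col B) \<and>
     (\<forall>Z \<in> carrier_mat (dim_col A) (dim_col B).
        frobenius_sq (A * X - B) \<le> frobenius_sq (A * Z - B))"

text \<open>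
  The variables are \<open>x 1, \<dots>, x d\<close>. The \<open>n k\<close> states of \<open>x k\<close> are numbered from 0, so that they
  can serve directly as matrix indices.
\<close>
definition grid :: "(nat \<Rightarrow> nat) \<Rightarrow> nat \<Rightarrow> (nat \<Rightarrow> nat) set" where
  "grid n d = (\<Pi>\<^sub>E k\<in>{1..d}. {..<n k})"

text \<open>Marginals in \<open>x k\<close>, in \<open>(x k, x (k+1))\<close> and in \<open>(x (k-1), x k, x (k+1))\<close>.\<close>

definition marg1 :: "(nat \<Rightarrow> nat) \<Rightarrow> nat \<Rightarrow> ((nat \<Rightarrow> nat) \<Rightarrow> real) \<Rightarrow> nat \<Rightarrow> nat \<Rightarrow> real" where
  "marg1 n d p k a = (\<Sum>x\<in>{x \<in> grid n d. x k = a}. p x)"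

definition marg2 ::
  "(nat \<Rightarrow> nat) \<Rightarrow> nat \<Rightarrow> ((nat \<Rightarrow> nat) \<Rightarrow> real) \<Rightarrow> nat \<Rightarrow> nat \<Rightarrow> nat \<Rightarrow> real" where
  "marg2 n d p k a b = (\<Sum>x\<in>{x \<in> grid n d. x k = a \<and> x (k + 1) = b}. p x)"

definition marg3 ::
  "(nat \<Rightarrow> nat) \<Rightarrow> nat \<Rightarrow> ((nat \<Rightarrow> nat) \<Rightarrow> real) \<Rightarrow> nat \<Rightarrow> nat \<Rightarrow> nat \<Rightarrow> nat \<Rightarrow> real" where
  "marg3 n d p k a b c =
     (\<Sum>x\<in>{x \<in> grid n d. x (k - 1) = a \<and> x k = b \<and> x (k + 1) = c}. p x)"

text \<open>
  The conditional \<open>p(x (k+1) = b | x k = a)\<close>. Where the marginal at \<open>a\<close> vanishes it is undefined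
  in the mathematics and 0 here; this does not affect the factorisation in
  \<open>markov_density\<close>, both sides of which are 0 on such points.
\<close>
definition transition ::
  "(nat \<Rightarrow> nat) \<Rightarrow> nat \<Rightarrow> ((nat \<Rightarrow> nat) \<Rightarrow> real) \<Rightarrow> nat \<Rightarrow> nat \<Rightarrow> nat \<Rightarrow> real" where
  "transition n d p k a b = marg2 n d p k a b / marg1 n d p k a"

definition markov_density :: "(nat \<Rightarrow> nat) \<Rightarrow> nat \<Rightarrow> ((nat \<Rightarrow> nat) \<Rightarrow> real) \<Rightarrow> bool" where
  "markov_density n d p \<longleftrightarrow>
     (\<forall>x\<in>grid n d. 0 \<le> p x) \<and>
     (\<Sum>x\<in>grid n d. p x) = 1 \<and>
     (\<forall>x\<in>grid n d.
        p x = marg1 n d p 1 (x 1) * (\<Prod>k\<in>{1..<d}. transition n d p k (x k) (x (k + 1))))"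

text \<open>
  Multi-indices \<open>(x a, \<dots>, x m)\<close> are flattened in row-major (lexicographic) order;
  \<open>digit n m l i\<close> recovers \<open>x l\<close> from the flat index \<open>i\<close>.
\<close>
definition digit :: "(nat \<Rightarrow> nat) \<Rightarrow> nat \<Rightarrow> nat \<Rightarrow> nat \<Rightarrow> nat" where
  "digit n m l i = (i div (\<Prod>j\<in>{l<..m}. n j)) mod n l"

text \<open>The unfolding matrix with rows \<open>(x 1, \<dots>, x k)\<close> and columns \<open>(x (k+1), \<dots>, x d)\<close>.\<close>
definition unfolding_matrix :: "(nat \<Rightarrow> nat) \<Rightarrow> nat \<Rightarrow> ((nat \<Rightarrow> nat) \<Rightarrow> real) \<Rightarrow> nat \<Rightarrow> real mat" where
  "unfolding_matrix n d p k =
     Matrix.mat (\<Prod>l\<in>{1..k}. n l) (\<Prod>l\<in>{k<..d}. n l)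
       (\<lambda>(i, j). p (\<lambda>l\<in>{1..d}. if l \<le> k then digit n k l i else digit n d l j))"

definition empirical :: "nat \<Rightarrow> (nat \<Rightarrow> 'a) \<Rightarrow> 'a \<Rightarrow> real" where
  "empirical N y x = real (card {i \<in> {1..N}. y i = x}) / real N"

text \<open>
  The sketched marginals as matrices: \<open>p(x 1; x 2)\<close>, \<open>p(x (k-1), x k; x (k+1))\<close> and
  \<open>p(x (d-1); x d)\<close>. For \<open>1 < k < d\<close> the row of \<open>(a, b)\<close> is \<open>a * n k + b\<close>.
\<close>
definition sketch :: "(nat \<Rightarrow> nat) \<Rightarrow> nat \<Rightarrow> ((nat \<Rightarrow> nat) \<Rightarrow> real) \<Rightarrow> nat \<Rightarrow> real mat" where
  "sketch n d p k =
     (if k = 1 then Matrix.mat (n 1) (n 2) (\<lambda>(a, b). marg2 n d p 1 a b)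
      else if k = d then Matrix.mat (n (d - 1)) (n d) (\<lambda>(a, b). marg2 n d p (d - 1) a b)
      else Matrix.mat (n (k - 1) * n k) (n (k + 1))
             (\<lambda>(i, c). marg3 n d p k (i div n k) (i mod n k) c))"

text \<open>The slice \<open>B k (_, x, _)\<close> of the middle \<open>B k\<close>, whose rows are indexed by pairs.\<close>
definition slice :: "(nat \<Rightarrow> nat) \<Rightarrow> nat \<Rightarrow> real mat \<Rightarrow> nat \<Rightarrow> real mat" where
  "slice n k B x = Matrix.mat (n (k - 1)) (dim_col B) (\<lambda>(a, \<alpha>). B $$ (a * n k + x, \<alpha>))"

definition coefficient_matrix :: "(nat \<Rightarrow> nat) \<Rightarrow> nat \<Rightarrow> real mat \<Rightarrow> real mat" where
  "coefficient_matrix n k B =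
     (if k = 1 then B
      else Matrix.mat (n k) (dim_col B) (\<lambda>(x, \<alpha>). \<Sum>a<n (k - 1). B $$ (a * n k + x, \<alpha>)))"

text \<open>
  \<open>tt_rs n d r p A G\<close>: on input \<open>p\<close> with target ranks \<open>r\<close> the algorithm can return the cores \<open>G\<close>,
  with coefficient matrices \<open>A\<close>. It is a relation because of the choice of singular vectors (and
  of least-squares solutions). A core is stored by its slices: \<open>G k x\<close> is the matrix
  \<open>G k (_, x, _)\<close>, with \<open>G 1 x\<close> a single row and \<open>G d x\<close> a single column. The squared residual of
  each linear system is the sum of those of its slices, so it is minimised slice by slice.
\<close>
definition tt_rs ::
  "(nat \<Rightarrow> nat) \<Rightarrow> nat \<Rightarrow> (nat \<Rightarrow> nat) \<Rightarrow> ((nat \<Rightarrow> nat) \<Rightarrow> real) \<Rightarrow>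
   (nat \<Rightarrow> real mat) \<Rightarrow> (nat \<Rightarrow> nat \<Rightarrow> real mat) \<Rightarrow> bool" where
  "tt_rs n d r p A G \<longleftrightarrow>
     (\<exists>B.
       (\<forall>k\<in>{1..d-1}. first_left_singular_vectors (sketch n d p k) (r k) (B k)) \<and>
       B d = sketch n d p d \<and>
       (\<forall>k\<in>{1..d-1}. A k = coefficient_matrix n k (B k)) \<and>
       (\<forall>x<n 1. G 1 x = Matrix.mat 1 (r 1) (\<lambda>(_, \<alpha>). B 1 $$ (x, \<alpha>))) \<and>
       (\<forall>k\<in>{2..d-1}. \<forall>x<n k. least_squares (A (k - 1)) (slice n k (B k) x) (G k x)) \<and>
       (\<forall>x<n d. least_squares (A (d - 1))
          (Matrix.mat (n (d - 1)) 1 (\<lambda>(a, _). B d $$ (a, x))) (G d x)))"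

definition slice_norm :: "nat \<Rightarrow> nat \<Rightarrow> real mat \<Rightarrow> real" where
  "slice_norm d k A =
     (if k = 1 then euclid_norm (Matrix.row A 0)
      else if k = d then euclid_norm (Matrix.col A 0)
      else spectral_norm A)"

definition core_norm :: "(nat \<Rightarrow> nat) \<Rightarrow> nat \<Rightarrow> nat \<Rightarrow> (nat \<Rightarrow> real mat) \<Rightarrow> real" where
  "core_norm n d k G = Max ((\<lambda>x. slice_norm d k (G x)) ` {..<n k})"

text \<open>The rotations acting on bond \<open>k\<close>; at the outer ends of the first and last core there are none.\<close>
definition rotations :: "nat \<Rightarrow> (nat \<Rightarrow> nat) \<Rightarrow> nat \<Rightarrow> real mat set" where
  "rotations d r k = (if k = 0 \<or> k = d then {1\<^sub>m 1} else orthogonal_group (r k))"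

text \<open>The infimum is a minimum since the orthogonal groups are compact.\<close>
definition core_dist ::
  "(nat \<Rightarrow> nat) \<Rightarrow> nat \<Rightarrow> (nat \<Rightarrow> nat) \<Rightarrow> nat \<Rightarrow> (nat \<Rightarrow> real mat) \<Rightarrow> (nat \<Rightarrow> real mat) \<Rightarrow> real"
where
  "core_dist n d r k H G =
     Inf {core_norm n d k (\<lambda>x. H x - R * G x * R') |R R'.
            R \<in> rotations d r (k - 1) \<and> R' \<in> rotations d r k}"

definition c_P :: "(nat \<Rightarrow> nat) \<Rightarrow> nat \<Rightarrow> (nat \<Rightarrow> nat) \<Rightarrow> ((nat \<Rightarrow> nat) \<Rightarrow> real) \<Rightarrow> real" where
  "c_P n d r p = Min ((\<lambda>k. singular_value (sketch n d p k) (r k)) ` {1..d-1})"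

definition c_G :: "(nat \<Rightarrow> nat) \<Rightarrow> nat \<Rightarrow> (nat \<Rightarrow> nat \<Rightarrow> real mat) \<Rightarrow> real" where
  "c_G n d G = Min ((\<lambda>k. core_norm n d k (G k)) ` {1..d})"

definition c_A :: "nat \<Rightarrow> (nat \<Rightarrow> real mat) \<Rightarrow> real" where
  "c_A d A = Max (insert 1 ((\<lambda>k. spectral_norm (pseudoinverse (A k))) ` {1..d-1}))"

end

theory Submission
  imports Defs
begin

text \<open>
  The algorithm reads its input only through the sketched marginals \<open>p(x 1; x 2)\<close>,
  \<open>p(x (k-1), x k; x (k+1))\<close> and \<open>p(x (d-1); x d)\<close>. The theorem therefore splits into a
  deterministic statement, that near a Markov density the cores change little, up to rotations of the
  bonds, when these matrices change little, and a probabilistic one, that the empirical sketches are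
  close to the exact ones. Below \<open>n\<close> is the largest number of states of a variable.

  \<^bold>\<open>Exact input.\<close> Given \<open>x k\<close>, past and future of a Markov density are independent
  (\<open>markov_conditional_independence\<close>). Hence the unfolding at bond \<open>k\<close>, the pair marginal
  \<open>p(x k; x (k+1))\<close> and the sketch at \<open>k\<close> factor through one another, so all have rank \<open>r k\<close>;
  exactly \<open>r k\<close> singular values of the sketch are positive and \<open>c_P > 0\<close>. Moreover
  \<open>p(x (k-1), x k, x (k+1)) = p(x (k-1), x k) / p(x k) * p(x k, x (k+1))\<close>. This shows that summing
  over \<open>x (k-1)\<close> is injective on the column space of the sketch, so that the coefficient matrices
  have full column rank (\<open>coefficient_matrix_injective\<close>), and that the linear systems for the cores
  are solved exactly (\<open>exact_core_equations\<close>).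

  \<^bold>\<open>Perturbed input.\<close> Let all sketches be perturbed by at most \<open>\<epsilon>\<close> in Frobenius norm. The leading
  singular vectors then span a space at distance at most \<open>2 * \<epsilon> / c_P\<close> from the exact one
  (\<open>left_singular_subspace_perturbation\<close>), and so they are close to the exact vectors up to a rotation of
  the bond (\<open>orthonormal_basis_alignment\<close>). Marginalising over \<open>x (k-1)\<close> costs a factor \<open>sqrt n\<close> by
  Cauchy-Schwarz. Finally, a least-squares solution with both coefficient matrix and right-hand
  side perturbed by \<open>\<gamma>\<close> moves by at most \<open>\<gamma> * (1 + g) / (1 / c_A - \<gamma>)\<close>, where \<open>g\<close> bounds the
  exact solution (\<open>least_squares_perturbation\<close>). The rotations at the two bonds of a core are the
  ones that the distance allows. Altogether
  \<open>\<epsilon> \<le> \<delta> / (4 * sqrt 2 * c_A * (1 + 1 / c_G) * (1 + 1 / c_P) * n)\<close> suffices (\<open>tt_rs_stability\<close>).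

  \<^bold>\<open>Sampling.\<close> An entry of a sketch is the probability of an event, and the sketches have at most
  \<open>d * n ^ 3\<close> entries. By Hoeffding's inequality and a union bound all empirical entries are within
  \<open>t = sqrt (L / (2 * N))\<close> of the exact ones with probability at least \<open>1 - \<eta>\<close>, where
  \<open>L = ln (2 * n ^ 3 * d / \<eta>)\<close>. Then \<open>\<epsilon> = t * sqrt (n ^ 3)\<close>, and the lower bound on \<open>N\<close> is what makes
  this small enough.
\<close>

unbundle no inner_syntax
no_notation vec_nth (infixl "$" 90)
declare minus_carrier_mat [simp]

section \<open>The Frobenius inner product and norms\<close>

definition finner :: "real mat \<Rightarrow> real mat \<Rightarrow> real" where
  "finner A B = (\<Sum>i<dim_row A. \<Sum>j<dim_col A. A $$ (i, j) * B $$ (i, j))"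

definition fnorm :: "real mat \<Rightarrow> real" where
  "fnorm A = sqrt (frobenius_sq A)"

lemma finner_self: "finner A A = frobenius_sq A"
  by (simp add: finner_def frobenius_sq_def power2_eq_square)

lemma finner_commute: "A \<in> carrier_mat m n \<Longrightarrow> B \<in> carrier_mat m n \<Longrightarrow> finner A B = finner B A"
  by (simp add: finner_def mult.commute)

lemma finner_diff_left:
  "A \<in> carrier_mat m n \<Longrightarrow> B \<in> carrier_mat m n \<Longrightarrow> C \<in> carrier_mat m n \<Longrightarrow> finner (A - B) C = finner A C - finner B C"
  by (simp add: finner_def sum_subtractf left_diff_distrib)

lemma finner_diff_right:
  "A \<in> carrier_mat m n \<Longrightarrow> B \<in> carrier_mat m n \<Longrightarrow> C \<in> carrier_mat m n \<Longrightarrow> finner C (A - B) = finner C A - finner C B"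
  by (simp add: finner_def sum_subtractf right_diff_distrib)

lemma finner_transpose: "A \<in> carrier_mat m n \<Longrightarrow> B \<in> carrier_mat m n \<Longrightarrow> finner A\<^sup>T B\<^sup>T = finner A B"
  unfolding finner_def by (subst sum.swap) simp

text \<open>
  Left multiplication by a matrix and by its transpose are adjoint for the Frobenius inner product.
\<close>
lemma finner_mult_left:
  assumes "A \<in> carrier_mat m k" "B \<in> carrier_mat k n" "C \<in> carrier_mat m n"
  shows "finner (A * B) C = finner B (A\<^sup>T * C)"
proof -
  have "finner (A * B) C = (\<Sum>i<m. \<Sum>j<n. \<Sum>l<k. A $$ (i, l) * B $$ (l, j) * C $$ (i, j))"
    using assms by (simp add: finner_def scalar_prod_def sum_distrib_right atLeast0LessThan)
  also have "\<dots> = (\<Sum>i<m. \<Sum>l<k. \<Sum>j<n. A $$ (i, l) * B $$ (l, j) * C $$ (i, j))"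
    by (intro sum.cong refl sum.swap)
  also have "\<dots> = (\<Sum>l<k. \<Sum>i<m. \<Sum>j<n. A $$ (i, l) * B $$ (l, j) * C $$ (i, j))"
    by (rule sum.swap)
  also have "\<dots> = (\<Sum>l<k. \<Sum>j<n. \<Sum>i<m. A $$ (i, l) * B $$ (l, j) * C $$ (i, j))"
    by (intro sum.cong refl sum.swap)
  also have "\<dots> = finner B (A\<^sup>T * C)"
    using assms by (simp add: finner_def scalar_prod_def sum_distrib_left atLeast0LessThan mult_ac)
  finally show ?thesis .
qed

lemma frobenius_sq_nonneg: "0 \<le> frobenius_sq A"
  by (simp add: frobenius_sq_def sum_nonneg)

lemma fnorm_nonneg: "0 \<le> fnorm A"
  by (simp add: fnorm_def frobenius_sq_nonneg)

lemma fnorm_sq: "(fnorm A)\<^sup>2 = frobenius_sq A"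
  by (simp add: fnorm_def frobenius_sq_nonneg)

lemma fnorm_eq_L2_set:
  "A \<in> carrier_mat m n \<Longrightarrow> fnorm A = L2_set (\<lambda>(i, j). A $$ (i, j)) ({..<m} \<times> {..<n})"
  by (simp add: fnorm_def frobenius_sq_def L2_set_def sum.cartesian_product case_prod_beta)

lemma fnorm_triangle:
  assumes "A \<in> carrier_mat m n" "B \<in> carrier_mat m n"
  shows "fnorm (A + B) \<le> fnorm A + fnorm B"
proof -
  have "fnorm (A + B) = L2_set (\<lambda>x. (case x of (i, j) \<Rightarrow> A $$ (i, j)) + (case x of (i, j) \<Rightarrow> B $$ (i, j))) ({..<m} \<times> {..<n})"
    using assms by (subst fnorm_eq_L2_set[of _ m n]) (auto intro!: L2_set_cong)
  also have "\<dots> \<le> fnorm A + fnorm B"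
    using assms by (simp add: fnorm_eq_L2_set[of _ m n] L2_set_triangle_ineq)
  finally show ?thesis .
qed

lemma fnorm_uminus: "fnorm (- A) = fnorm A"
  by (simp add: fnorm_def frobenius_sq_def)

lemma fnorm_minus_commute:
  assumes "A \<in> carrier_mat m n" "B \<in> carrier_mat m n"
  shows "fnorm (A - B) = fnorm (B - A)"
  using assms by (simp add: fnorm_def frobenius_sq_def power2_commute)

lemma fnorm_triangle_diff:
  assumes "A \<in> carrier_mat m n" "B \<in> carrier_mat m n"
  shows "fnorm (A - B) \<le> fnorm A + fnorm B"
  using fnorm_triangle[of A m n "-B"] assms by (simp add: fnorm_uminus add_uminus_minus_mat)

lemma fnorm_triangle_via:
  assumes "A \<in> carrier_mat m n" "B \<in> carrier_mat m n" "C \<in> carrier_mat m n"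
  shows "fnorm (A - C) \<le> fnorm (A - B) + fnorm (B - C)"
proof -
  have "A - C = (A - B) + (B - C)" using assms by (intro eq_matI) auto
  moreover have "A - B \<in> carrier_mat m n" "B - C \<in> carrier_mat m n" using assms by auto
  ultimately show ?thesis using fnorm_triangle by metis
qed

lemma finner_le:
  assumes "A \<in> carrier_mat m n" "B \<in> carrier_mat m n"
  shows "finner A B \<le> fnorm A * fnorm B"
proof -
  have "finner A B = (\<Sum>x\<in>{..<m} \<times> {..<n}. (case x of (i, j) \<Rightarrow> A $$ (i, j)) * (case x of (i, j) \<Rightarrow> B $$ (i, j)))"
    using assms by (simp add: finner_def sum.cartesian_product case_prod_beta)
  also have "\<dots> \<le> (\<Sum>x\<in>{..<m} \<times> {..<n}. \<bar>case x of (i, j) \<Rightarrow> A $$ (i, j)\<bar> * \<bar>case x of (i, j) \<Rightarrow> B $$ (i, j)\<bar>)"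
    by (intro sum_mono) (metis abs_ge_self abs_mult)
  also have "\<dots> \<le> fnorm A * fnorm B"
    using assms by (simp add: fnorm_eq_L2_set[of _ m n] L2_set_mult_ineq)
  finally show ?thesis .
qed

lemma fnorm_transpose: "fnorm A\<^sup>T = fnorm A"
  unfolding fnorm_def frobenius_sq_def by (subst sum.swap) simp

lemma frobenius_sq_diff:
  assumes "A \<in> carrier_mat m n" "B \<in> carrier_mat m n"
  shows "frobenius_sq (A - B) = frobenius_sq A - 2 * finner A B + frobenius_sq B"
proof -
  have "A - B \<in> carrier_mat m n" using assms by auto
  hence "finner (A - B) (A - B) = finner A A - finner A B - (finner B A - finner B B)"
    using assms by (metis finner_diff_left finner_diff_right)
  thus ?thesis using finner_commute[OF assms] by (simp add: finner_self)
qed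

lemma euclid_norm_eq_L2_set: "euclid_norm v = L2_set (\<lambda>i. v $ i) {..<dim_vec v}"
  by (simp add: euclid_norm_def L2_set_def scalar_prod_def power2_eq_square atLeast0LessThan)

lemma euclid_norm_nonneg: "0 \<le> euclid_norm v"
  by (simp add: euclid_norm_eq_L2_set L2_set_nonneg)

lemma euclid_norm_sq: "(euclid_norm v)\<^sup>2 = v \<bullet> v"
  by (simp add: euclid_norm_def scalar_prod_def sum_nonneg)

lemma euclid_norm_sq_sum: "(euclid_norm v)\<^sup>2 = (\<Sum>i<dim_vec v. (v $ i)\<^sup>2)"
  by (simp add: euclid_norm_eq_L2_set L2_set_def sum_nonneg)

lemma euclid_norm_eq_0: "v \<in> carrier_vec n \<Longrightarrow> euclid_norm v = 0 \<longleftrightarrow> v = 0\<^sub>v n"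
  by (auto simp: euclid_norm_eq_L2_set L2_set_eq_0_iff)

lemma euclid_norm_triangle:
  "v \<in> carrier_vec n \<Longrightarrow> w \<in> carrier_vec n \<Longrightarrow> euclid_norm (v + w) \<le> euclid_norm v + euclid_norm w"
  using L2_set_triangle_ineq[of "\<lambda>i. v $ i" "\<lambda>i. w $ i" "{..<n}"]
  by (simp add: euclid_norm_eq_L2_set L2_set_def)

lemma euclid_norm_smult: "euclid_norm (c \<cdot>\<^sub>v v) = \<bar>c\<bar> * euclid_norm v"
proof -
  have "(\<Sum>i<dim_vec v. (c * v $ i)\<^sup>2) = c\<^sup>2 * (\<Sum>i<dim_vec v. (v $ i)\<^sup>2)"
    by (simp add: power_mult_distrib sum_distrib_left)
  thus ?thesis by (simp add: euclid_norm_eq_L2_set L2_set_def real_sqrt_mult)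
qed

lemma euclid_norm_uminus: "euclid_norm (- v) = euclid_norm v"
  by (simp add: euclid_norm_eq_L2_set L2_set_def)

lemma euclid_norm_triangle_diff:
  assumes "v \<in> carrier_vec n" "w \<in> carrier_vec n"
  shows "euclid_norm (v - w) \<le> euclid_norm v + euclid_norm w"
  using euclid_norm_triangle[of v n "-w"] assms by (simp add: euclid_norm_uminus minus_add_uminus_vec)

lemma scalar_prod_le_euclid_norm:
  assumes "v \<in> carrier_vec n" "w \<in> carrier_vec n"
  shows "v \<bullet> w \<le> euclid_norm v * euclid_norm w"
proof -
  have "v \<bullet> w = (\<Sum>i<n. v $ i * w $ i)"
    using assms by (simp add: scalar_prod_def atLeast0LessThan)
  also have "\<dots> \<le> (\<Sum>i<n. \<bar>v $ i\<bar> * \<bar>w $ i\<bar>)"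
    by (intro sum_mono) (metis abs_ge_self abs_mult)
  also have "\<dots> \<le> euclid_norm v * euclid_norm w"
    using assms by (simp add: euclid_norm_eq_L2_set L2_set_mult_ineq)
  finally show ?thesis .
qed

lemma scalar_prod_sq_le:
  assumes "v \<in> carrier_vec n" "w \<in> carrier_vec n"
  shows "(v \<bullet> w)\<^sup>2 \<le> (euclid_norm v)\<^sup>2 * (euclid_norm w)\<^sup>2"
proof -
  have "- (v \<bullet> w) \<le> euclid_norm v * euclid_norm w"
    using scalar_prod_le_euclid_norm[of "-v" n w] assms by (simp add: euclid_norm_uminus)
  with scalar_prod_le_euclid_norm[OF assms] have "\<bar>v \<bullet> w\<bar> \<le> euclid_norm v * euclid_norm w" by linarith
  hence "\<bar>v \<bullet> w\<bar>\<^sup>2 \<le> (euclid_norm v * euclid_norm w)\<^sup>2" by (intro power_mono) auto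
  thus ?thesis by (simp add: power_mult_distrib)
qed

lemma frobenius_sq_cols: "frobenius_sq A = (\<Sum>j<dim_col A. (euclid_norm (col A j))\<^sup>2)"
  unfolding frobenius_sq_def euclid_norm_sq scalar_prod_def
  by (subst sum.swap) (simp add: power2_eq_square atLeast0LessThan)

lemma frobenius_sq_rows: "frobenius_sq A = (\<Sum>i<dim_row A. (euclid_norm (row A i))\<^sup>2)"
  unfolding frobenius_sq_def euclid_norm_sq scalar_prod_def
  by (simp add: power2_eq_square atLeast0LessThan)

lemma euclid_norm_mult_mat_vec:
  assumes "A \<in> carrier_mat m n" "v \<in> carrier_vec n"
  shows "euclid_norm (A *\<^sub>v v) \<le> fnorm A * euclid_norm v"
proof (rule power2_le_imp_le)
  have "(euclid_norm (A *\<^sub>v v))\<^sup>2 = (\<Sum>i<m. (row A i \<bullet> v)\<^sup>2)"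
    using assms by (simp add: euclid_norm_sq_sum)
  also have "\<dots> \<le> (\<Sum>i<m. (euclid_norm (row A i))\<^sup>2 * (euclid_norm v)\<^sup>2)"
    using assms by (intro sum_mono scalar_prod_sq_le[of _ n]) auto
  also have "\<dots> = (fnorm A * euclid_norm v)\<^sup>2"
    using assms by (simp add: power_mult_distrib fnorm_sq frobenius_sq_rows sum_distrib_right)
  finally show "(euclid_norm (A *\<^sub>v v))\<^sup>2 \<le> (fnorm A * euclid_norm v)\<^sup>2" .
qed (simp add: fnorm_nonneg euclid_norm_nonneg)

text \<open>
  Column by column, a bound on how much \<open>A\<close> stretches vectors becomes a bound on the Frobenius norm of
  a product. This keeps one factor in the spectral norm.
\<close>
lemma fnorm_mult_bound:
  assumes A: "A \<in> carrier_mat m k" and B: "B \<in> carrier_mat k n" and "0 \<le> c"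
    and "\<And>v. v \<in> carrier_vec k \<Longrightarrow> euclid_norm (A *\<^sub>v v) \<le> c * euclid_norm v"
  shows "fnorm (A * B) \<le> c * fnorm B"
proof (rule power2_le_imp_le)
  have "(fnorm (A * B))\<^sup>2 = (\<Sum>j<n. (euclid_norm (A *\<^sub>v col B j))\<^sup>2)"
    using A B by (simp add: fnorm_sq frobenius_sq_cols col_mult2[OF A B] del: col_mult)
  also have "\<dots> \<le> (\<Sum>j<n. (c * euclid_norm (col B j))\<^sup>2)"
    using assms by (intro sum_mono power_mono euclid_norm_nonneg) auto
  also have "\<dots> = (c * fnorm B)\<^sup>2"
    using B by (simp add: power_mult_distrib fnorm_sq frobenius_sq_cols sum_distrib_left)
  finally show "(fnorm (A * B))\<^sup>2 \<le> (c * fnorm B)\<^sup>2" .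
qed (use assms in \<open>simp add: fnorm_nonneg\<close>)

lemma fnorm_mult:
  assumes "A \<in> carrier_mat m k" "B \<in> carrier_mat k n"
  shows "fnorm (A * B) \<le> fnorm A * fnorm B"
  by (rule fnorm_mult_bound[OF assms fnorm_nonneg euclid_norm_mult_mat_vec[OF assms(1)]])

lemma fnorm_mult_lower:
  assumes A: "A \<in> carrier_mat m k" and B: "B \<in> carrier_mat k n" and "0 \<le> c"
    and "\<And>v. v \<in> carrier_vec k \<Longrightarrow> c * euclid_norm v \<le> euclid_norm (A *\<^sub>v v)"
  shows "c * fnorm B \<le> fnorm (A * B)"
proof (rule power2_le_imp_le)
  have "(c * fnorm B)\<^sup>2 = (\<Sum>j<n. (c * euclid_norm (col B j))\<^sup>2)"
    using B by (simp add: power_mult_distrib fnorm_sq frobenius_sq_cols sum_distrib_left)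
  also have "\<dots> \<le> (\<Sum>j<n. (euclid_norm (A *\<^sub>v col B j))\<^sup>2)"
    using assms by (intro sum_mono power_mono mult_nonneg_nonneg euclid_norm_nonneg) auto
  also have "\<dots> = (fnorm (A * B))\<^sup>2"
    using A B by (simp add: fnorm_sq frobenius_sq_cols col_mult2[OF A B] del: col_mult)
  finally show "(c * fnorm B)\<^sup>2 \<le> (fnorm (A * B))\<^sup>2" .
qed (use assms in \<open>simp add: fnorm_nonneg\<close>)

lemma frobenius_sq_isometry_left:
  assumes "Q \<in> carrier_mat m k" "Q\<^sup>T * Q = 1\<^sub>m k" "B \<in> carrier_mat k n"
  shows "frobenius_sq (Q * B) = frobenius_sq B"
proof -
  have "frobenius_sq (Q * B) = finner B (Q\<^sup>T * (Q * B))"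
    using assms by (simp add: finner_self[symmetric] finner_mult_left[of _ m k])
  also have "Q\<^sup>T * (Q * B) = B"
    using assms assoc_mult_mat[of "Q\<^sup>T" k m Q k B n] by simp
  finally show ?thesis by (simp add: finner_self)
qed

lemma frobenius_sq_isometry_right:
  assumes "Q \<in> carrier_mat k n" "Q * Q\<^sup>T = 1\<^sub>m k" "B \<in> carrier_mat m k"
  shows "frobenius_sq (B * Q) = frobenius_sq B"
proof -
  have "frobenius_sq (B * Q) = frobenius_sq (Q\<^sup>T * B\<^sup>T)"
    using assms fnorm_transpose[of "B * Q"] by (simp add: fnorm_def transpose_mult)
  also have "\<dots> = frobenius_sq B\<^sup>T"
    using assms by (intro frobenius_sq_isometry_left[of _ n k _ m]) auto
  also have "\<dots> = frobenius_sq B"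
    using fnorm_transpose[of B] by (simp add: fnorm_def)
  finally show ?thesis .
qed

text \<open>
  Pythagoras, for the orthogonal projection \<open>Q * Q\<^sup>T\<close> onto the column space of \<open>Q\<close>.
\<close>
lemma frobenius_sq_residual:
  assumes Q: "Q \<in> carrier_mat m k" "Q\<^sup>T * Q = 1\<^sub>m k" and X: "X \<in> carrier_mat m n"
  shows "frobenius_sq (X - Q * (Q\<^sup>T * X)) = frobenius_sq X - frobenius_sq (Q\<^sup>T * X)"
proof -
  have QX: "Q\<^sup>T * X \<in> carrier_mat k n" using Q X by simp
  have "finner X (Q * (Q\<^sup>T * X)) = finner (Q * (Q\<^sup>T * X)) X"
    using Q X by (intro finner_commute) auto
  also have "\<dots> = frobenius_sq (Q\<^sup>T * X)"
    using finner_mult_left[OF Q(1) QX X] by (simp add: finner_self)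
  finally show ?thesis
    using Q X QX by (subst frobenius_sq_diff[of _ m n]) (simp_all add: frobenius_sq_isometry_left[OF Q QX])
qed

lemma frobenius_sq_one: "frobenius_sq (1\<^sub>m k) = real k"
  by (simp add: frobenius_sq_def if_distrib[of "\<lambda>x. x\<^sup>2"] cong: if_cong)

lemma frobenius_sq_orthonormal:
  assumes "Q \<in> carrier_mat m k" "Q\<^sup>T * Q = 1\<^sub>m k"
  shows "frobenius_sq Q = real k"
  using frobenius_sq_isometry_left[of Q m k "1\<^sub>m k" k] assms by (simp add: frobenius_sq_one)

lemma euclid_norm_isometry:
  assumes "Q \<in> carrier_mat m k" "Q\<^sup>T * Q = 1\<^sub>m k" "v \<in> carrier_vec k"
  shows "euclid_norm (Q *\<^sub>v v) = euclid_norm v"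
proof -
  have "(Q *\<^sub>v v) \<bullet> (Q *\<^sub>v v) = (Q\<^sup>T *\<^sub>v (Q *\<^sub>v v)) \<bullet> v"
    using transpose_vec_mult_scalar[OF assms(1) assms(3), of "Q *\<^sub>v v"] assms by simp
  also have "Q\<^sup>T *\<^sub>v (Q *\<^sub>v v) = v"
    using assms assoc_mult_mat_vec[of "Q\<^sup>T" k m Q k v] by simp
  finally show ?thesis by (simp add: euclid_norm_def)
qed

lemma entry_le_fnorm:
  assumes "A \<in> carrier_mat m n" "i < m" "j < n"
  shows "\<bar>A $$ (i, j)\<bar> \<le> fnorm A"
proof (rule power2_le_imp_le)
  have "(A $$ (i, j))\<^sup>2 \<le> (\<Sum>j<n. (A $$ (i, j))\<^sup>2)"
    using assms by (intro member_le_sum[where f = "\<lambda>j. (A $$ (i, j))\<^sup>2"]) auto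
  also have "\<dots> \<le> (\<Sum>i<m. \<Sum>j<n. (A $$ (i, j))\<^sup>2)"
    using assms by (intro member_le_sum[where f = "\<lambda>i. \<Sum>j<n. (A $$ (i, j))\<^sup>2"]) (auto intro: sum_nonneg)
  finally show "\<bar>A $$ (i, j)\<bar>\<^sup>2 \<le> (fnorm A)\<^sup>2"
    using assms by (simp add: fnorm_sq frobenius_sq_def)
qed (rule fnorm_nonneg)

text \<open>
  \<open>\<parallel>Q\<^sup>T v\<parallel>\<^sup>2 = v \<bullet> Q (Q\<^sup>T v) \<le> \<parallel>v\<parallel> \<parallel>Q\<^sup>T v\<parallel>\<close>, because \<open>Q\<close> preserves norms.
\<close>
lemma euclid_norm_transpose_isometry:
  assumes Q: "Q \<in> carrier_mat m k" "Q\<^sup>T * Q = 1\<^sub>m k" and v: "v \<in> carrier_vec m"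
  shows "euclid_norm (Q\<^sup>T *\<^sub>v v) \<le> euclid_norm v"
proof -
  let ?w = "Q\<^sup>T *\<^sub>v v"
  have w: "?w \<in> carrier_vec k" using Q v by simp
  have "(euclid_norm ?w)\<^sup>2 = v \<bullet> (Q *\<^sub>v ?w)"
    using transpose_vec_mult_scalar[OF Q(1) w v] by (simp add: euclid_norm_sq)
  also have "\<dots> \<le> euclid_norm v * euclid_norm ?w"
    using scalar_prod_le_euclid_norm[OF v, of "Q *\<^sub>v ?w"] Q w by (simp add: euclid_norm_isometry)
  finally show ?thesis
    using euclid_norm_nonneg[of ?w] euclid_norm_nonneg[of v]
    by (cases "euclid_norm ?w = 0") (auto simp: power2_eq_square)
qed

section \<open>Orthogonal matrices near a given matrix\<close>

text \<open>
  One step of the Newton-Schulz iteration for the orthogonal polar factor of \<open>C\<close>.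
\<close>
definition newton_step :: "nat \<Rightarrow> real mat \<Rightarrow> real mat" where
  "newton_step r C = C + C * ((1/2) \<cdot>\<^sub>m (1\<^sub>m r - C\<^sup>T * C))"

lemma newton_step_carrier: "C \<in> carrier_mat r r \<Longrightarrow> newton_step r C \<in> carrier_mat r r"
  by (simp add: newton_step_def)

lemma fnorm_smult: "fnorm (c \<cdot>\<^sub>m A) = \<bar>c\<bar> * fnorm A"
proof -
  have "frobenius_sq (c \<cdot>\<^sub>m A) = c\<^sup>2 * frobenius_sq A"
    by (simp add: frobenius_sq_def power_mult_distrib sum_distrib_left)
  thus ?thesis by (simp add: fnorm_def real_sqrt_mult)
qed

text \<open>
  If \<open>C\<^sup>T * C = I - 2 * H\<close> with \<open>H\<close> symmetric, then \<open>C * (I + H)\<close> has the Gram matrix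
  \<open>(I + H) * (I - 2 * H) * (I + H)\<close>. In its distance from the identity the terms of first order
  in \<open>H\<close> cancel: this is the quadratic convergence of Newton's method.
\<close>
lemma newton_algebra:
  fixes H :: "real mat"
  assumes H: "H \<in> carrier_mat r r"
  shows "1\<^sub>m r - (1\<^sub>m r + H) * ((1\<^sub>m r - (H + H)) * (1\<^sub>m r + H))
           = H * H + H * H + H * H + (H * (H * H) + H * (H * H))"
proof -
  have HH: "H * H \<in> carrier_mat r r" and HHH: "H * (H * H) \<in> carrier_mat r r" using H by auto
  have 1: "(1\<^sub>m r - (H + H)) * (1\<^sub>m r + H) = 1\<^sub>m r - H - (H * H + H * H)"
  proof -
    have "(1\<^sub>m r - (H + H)) * (1\<^sub>m r + H) = (1\<^sub>m r + H) - (H + H) * (1\<^sub>m r + H)"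
      using H minus_mult_distrib_mat[of "1\<^sub>m r" r r "H + H" "1\<^sub>m r + H" r] by simp
    also have "(H + H) * (1\<^sub>m r + H) = H * (1\<^sub>m r + H) + H * (1\<^sub>m r + H)"
      using H by (intro add_mult_distrib_mat[of _ r r]) auto
    also have "H * (1\<^sub>m r + H) = H + H * H"
      using H mult_add_distrib_mat[of H r r "1\<^sub>m r" r H] by simp
    finally show ?thesis using H HH by (intro eq_matI) (auto simp del: index_mult_mat(1))
  qed
  have "(1\<^sub>m r + H) * (1\<^sub>m r - H - (H * H + H * H))
      = (1\<^sub>m r - H - (H * H + H * H)) + H * (1\<^sub>m r - H - (H * H + H * H))"
    using H HH by (subst add_mult_distrib_mat[of _ r r]) auto
  also have "H * (1\<^sub>m r - H - (H * H + H * H)) = H - H * H - (H * (H * H) + H * (H * H))"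
    using H HH by (simp add: mult_minus_distrib_mat[of _ r r _ r] mult_add_distrib_mat[of _ r r _ r])
  finally show ?thesis unfolding 1 using H HH HHH
    by (intro eq_matI) (auto simp del: index_mult_mat(1))
qed

text \<open>
  With \<open>H\<close> half the defect \<open>I - C\<^sup>T * C\<close> of norm \<open>d\<close>, the new defect is \<open>3 * H\<^sup>2 + 2 * H\<^sup>3\<close>, of
  norm at most \<open>3/4 * d\<^sup>2 + 1/4 * d\<^sup>3\<close>; for \<open>d \<le> 1/8\<close> this is at most \<open>d / 8\<close>. The step itself is
  \<open>C * H\<close>, and its norm is nearly that of \<open>H\<close> since \<open>C\<close> is nearly an isometry.
\<close>
lemma newton_step_defect:
  assumes C: "C \<in> carrier_mat r r" and small: "fnorm (1\<^sub>m r - C\<^sup>T * C) \<le> 1/8"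
  shows "fnorm (1\<^sub>m r - (newton_step r C)\<^sup>T * newton_step r C) \<le> fnorm (1\<^sub>m r - C\<^sup>T * C) / 8"
    and "fnorm (newton_step r C - C) \<le> fnorm (1\<^sub>m r - C\<^sup>T * C) * (5/8)"
proof -
  define D where "D = 1\<^sub>m r - C\<^sup>T * C"
  define H where "H = (1/2) \<cdot>\<^sub>m D"
  define d where "d = fnorm D"
  have D: "D \<in> carrier_mat r r" and H: "H \<in> carrier_mat r r" using C by (auto simp: D_def H_def)
  have DT: "D\<^sup>T = D" using C by (simp add: D_def transpose_minus[of _ r r] transpose_mult[of _ r r])
  have HT: "H\<^sup>T = H"
  proof (intro eq_matI)
    fix i j assume "i < dim_row H" "j < dim_col H"
    moreover have "D $$ (j, i) = D $$ (i, j)" if "i < r" "j < r"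
      using D that DT by (metis carrier_matD index_transpose_mat(1))
    ultimately show "H\<^sup>T $$ (i, j) = H $$ (i, j)" using D by (simp add: H_def)
  qed (use H in auto)
  have CC: "C\<^sup>T * C = 1\<^sub>m r - (H + H)"
  proof -
    have "H + H = D" using D by (intro eq_matI) (auto simp: H_def)
    moreover have "C\<^sup>T * C \<in> carrier_mat r r" using C by simp
    ultimately show ?thesis unfolding D_def using C
      by (intro eq_matI) (auto simp del: index_mult_mat(1))
  qed
  have h: "fnorm H = d / 2" by (simp add: H_def d_def fnorm_smult)
  have d: "0 \<le> d" "d \<le> 1/8" using small by (auto simp: d_def D_def fnorm_nonneg)
  have N: "newton_step r C = C * (1\<^sub>m r + H)"
    using C H mult_add_distrib_mat[of C r r "1\<^sub>m r" r H] by (simp add: newton_step_def D_def[symmetric] H_def[symmetric])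
  have "(newton_step r C)\<^sup>T * newton_step r C = (1\<^sub>m r + H) * (C\<^sup>T * (C * (1\<^sub>m r + H)))"
  proof -
    have "(C * (1\<^sub>m r + H))\<^sup>T = (1\<^sub>m r + H) * C\<^sup>T"
      using transpose_mult[of C r r "1\<^sub>m r + H" r] transpose_add[of "1\<^sub>m r" r r H] C H HT by simp
    thus ?thesis using C H assoc_mult_mat[of "1\<^sub>m r + H" r r "C\<^sup>T" r "C * (1\<^sub>m r + H)" r] by (simp add: N)
  qed
  also have "C\<^sup>T * (C * (1\<^sub>m r + H)) = (1\<^sub>m r - (H + H)) * (1\<^sub>m r + H)"
    using C H by (simp add: CC[symmetric] assoc_mult_mat[of _ r r _ r _ r])
  finally have eq: "1\<^sub>m r - (newton_step r C)\<^sup>T * newton_step r C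
      = H * H + H * H + H * H + (H * (H * H) + H * (H * H))"
    using newton_algebra[OF H] by simp
  have HH: "H * H \<in> carrier_mat r r" and HHH: "H * (H * H) \<in> carrier_mat r r" using H by auto
  have b2: "fnorm (H * H) \<le> d\<^sup>2 / 4"
    using fnorm_mult[OF H H] by (simp add: h power2_eq_square)
  have b3: "fnorm (H * (H * H)) \<le> d ^ 3 / 8"
  proof -
    have "fnorm (H * (H * H)) \<le> d / 2 * fnorm (H * H)" using fnorm_mult[OF H HH] by (simp add: h)
    also have "\<dots> \<le> d / 2 * (d\<^sup>2 / 4)" using b2 d by (intro mult_left_mono) auto
    finally show ?thesis by (simp add: power3_eq_cube power2_eq_square)
  qed
  have "fnorm (1\<^sub>m r - (newton_step r C)\<^sup>T * newton_step r C)
      \<le> fnorm (H * H) + fnorm (H * H) + fnorm (H * H) + (fnorm (H * (H * H)) + fnorm (H * (H * H)))"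
  proof -
    note tri = fnorm_triangle[of _ r r]
    have "fnorm (H * H + H * H + H * H + (H * (H * H) + H * (H * H)))
      \<le> fnorm (H * H + H * H + H * H) + fnorm (H * (H * H) + H * (H * H))"
      using HH HHH by (intro tri) auto
    moreover have "fnorm (H * H + H * H + H * H) \<le> fnorm (H * H + H * H) + fnorm (H * H)"
      using HH by (intro tri) auto
    moreover have "fnorm (H * H + H * H) \<le> fnorm (H * H) + fnorm (H * H)"
      using HH by (intro tri) auto
    moreover have "fnorm (H * (H * H) + H * (H * H)) \<le> fnorm (H * (H * H)) + fnorm (H * (H * H))"
      using HHH by (intro tri) auto
    ultimately show ?thesis unfolding eq by linarith
  qed
  also have "\<dots> \<le> 3 * d\<^sup>2 / 4 + d ^ 3 / 4" using b2 b3 by linarith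
  also have "\<dots> \<le> d / 8"
  proof -
    have "d\<^sup>2 \<le> d * (1/8)" unfolding power2_eq_square using d by (intro mult_left_mono) auto
    moreover have "d ^ 3 \<le> d * (1/64)"
    proof -
      have "d\<^sup>2 \<le> (1/8)\<^sup>2" using d by (intro power_mono) auto
      hence "d * d\<^sup>2 \<le> d * (1/64)" using d by (intro mult_left_mono) (auto simp: power2_eq_square)
      thus ?thesis by (simp add: power3_eq_cube power2_eq_square)
    qed
    ultimately show ?thesis using d by linarith
  qed
  finally show "fnorm (1\<^sub>m r - (newton_step r C)\<^sup>T * newton_step r C) \<le> fnorm (1\<^sub>m r - C\<^sup>T * C) / 8"
    by (simp add: d_def D_def)
  have "newton_step r C - C = C * H"
    using C H by (simp add: newton_step_def D_def H_def)
      (intro eq_matI, auto simp del: index_mult_mat(1))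
  moreover have "fnorm (C * H) \<le> d * (5/8)"
  proof (rule power2_le_imp_le)
    have "(fnorm (C * H))\<^sup>2 = finner H (C\<^sup>T * (C * H))"
      using C H by (simp add: fnorm_sq finner_self[symmetric] finner_mult_left[of _ r r _ r])
    also have "C\<^sup>T * (C * H) = H - D * H"
    proof -
      have "C\<^sup>T * (C * H) = (1\<^sub>m r - D) * H"
      proof -
        have "1\<^sub>m r - D = C\<^sup>T * C" using C by (intro eq_matI) (auto simp: D_def simp del: index_mult_mat(1))
        thus ?thesis using C H assoc_mult_mat[of "C\<^sup>T" r r C r H r] by simp
      qed
      thus ?thesis using D H minus_mult_distrib_mat[of "1\<^sub>m r" r r D H r] by simp
    qed
    also have "finner H (H - D * H) = finner H H - finner H (D * H)"
      using D H by (intro finner_diff_right[of _ r r]) auto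
    also have "\<dots> \<le> (fnorm H)\<^sup>2 + fnorm H * (fnorm D * fnorm H)"
    proof -
      have "finner (- H) (D * H) \<le> fnorm H * fnorm (D * H)"
        using finner_le[of "-H" r r "D * H"] D H by (simp add: fnorm_uminus)
      also have "\<dots> \<le> fnorm H * (fnorm D * fnorm H)"
        using D H by (intro mult_left_mono fnorm_mult fnorm_nonneg) auto
      also have "finner (- H) (D * H) = - finner H (D * H)"
        by (simp add: finner_def sum_negf)
      finally show ?thesis by (simp add: finner_self fnorm_sq)
    qed
    also have "\<dots> = d\<^sup>2 / 4 * (1 + d)"
      by (simp add: h d_def[symmetric] power2_eq_square algebra_simps)
    also have "\<dots> \<le> d\<^sup>2 / 4 * (1 + 1/8)" using d by (intro mult_left_mono) auto
    also have "\<dots> \<le> (d * (5/8))\<^sup>2" by (simp add: power_mult_distrib power2_eq_square)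
    finally show "(fnorm (C * H))\<^sup>2 \<le> (d * (5/8))\<^sup>2" .
  qed (use d in simp)
  ultimately show "fnorm (newton_step r C - C) \<le> fnorm (1\<^sub>m r - C\<^sup>T * C) * (5/8)"
    by (simp add: d_def D_def)
qed

lemma geometric_increments_convergent:
  fixes X :: "nat \<Rightarrow> real"
  assumes "\<And>k. \<bar>X (Suc k) - X k\<bar> \<le> a * (1/8) ^ k"
  shows "convergent X"
proof -
  have "summable (\<lambda>k. a * (1/8::real) ^ k)" by (intro summable_mult summable_geometric) auto
  hence "summable (\<lambda>k. X (Suc k) - X k)"
    by (rule summable_comparison_test[rotated]) (use assms in auto)
  hence "(\<lambda>k. X 0 + (\<Sum>j<k. X (Suc j) - X j)) \<longlonglongrightarrow> X 0 + (\<Sum>k. X (Suc k) - X k)"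
    by (intro tendsto_add tendsto_const summable_LIMSEQ)
  thus ?thesis by (subst (asm) sum_lessThan_telescope) (auto simp: convergent_def)
qed

text \<open>
  The defect shrinks by a factor 8 in every Newton step and the steps are proportional to the defect,
  so the iterates converge; the limit is orthogonal. This gives the rotation that aligns two bases
  with an error of second order, and needs no singular value decomposition of \<open>C\<close>.
\<close>
lemma nearby_orthogonal_matrix:
  assumes C: "C \<in> carrier_mat r r" and small: "fnorm (1\<^sub>m r - C\<^sup>T * C) \<le> 1/8"
  obtains R where "R \<in> orthogonal_group r" "fnorm (C - R) \<le> fnorm (1\<^sub>m r - C\<^sup>T * C)"
proof -
  define d where "d = fnorm (1\<^sub>m r - C\<^sup>T * C)"
  define X where "X k = (newton_step r ^^ k) C" for k
  have d: "0 \<le> d" "d \<le> 1/8" using small by (auto simp: d_def fnorm_nonneg)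
  have X: "X k \<in> carrier_mat r r" for k
    by (induction k) (use C in \<open>auto simp: X_def newton_step_carrier\<close>)
  have defect: "fnorm (1\<^sub>m r - (X k)\<^sup>T * X k) \<le> d * (1/8) ^ k" for k
  proof (induction k)
    case (Suc k)
    have "d * (1/8) ^ k \<le> d" using d by (simp add: mult_left_le power_le_one)
    hence "fnorm (1\<^sub>m r - (X k)\<^sup>T * X k) \<le> 1/8" using Suc d by linarith
    from newton_step_defect(1)[OF X this] Suc show ?case by (simp add: X_def)
  qed (simp add: X_def d_def)
  have incr: "fnorm (X (Suc k) - X k) \<le> d * (5/8) * (1/8) ^ k" for k
  proof -
    have "d * (1/8) ^ k \<le> d" using d by (simp add: mult_left_le power_le_one)
    hence "fnorm (1\<^sub>m r - (X k)\<^sup>T * X k) \<le> 1/8" using defect[of k] d by linarith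
    from newton_step_defect(2)[OF X this] defect[of k] show ?thesis by (simp add: X_def)
  qed
  define R where "R = Matrix.mat r r (\<lambda>(i, j). lim (\<lambda>k. X k $$ (i, j)))"
  have R: "R \<in> carrier_mat r r" by (simp add: R_def)
  have lim: "(\<lambda>k. X k $$ (i, j)) \<longlonglongrightarrow> R $$ (i, j)" if ij: "i < r" "j < r" for i j
  proof -
    have "\<bar>X (Suc k) $$ (i, j) - X k $$ (i, j)\<bar> \<le> d * (5/8) * (1/8) ^ k" for k
      using entry_le_fnorm[of "X (Suc k) - X k" r r i j] incr[of k] X[of k] X[of "Suc k"] ij by simp
    hence "convergent (\<lambda>k. X k $$ (i, j))" by (rule geometric_increments_convergent)
    thus ?thesis using ij by (simp add: R_def convergent_LIMSEQ_iff)
  qed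
  have zero: "(\<lambda>k. d * (1/8::real) ^ k) \<longlonglongrightarrow> 0"
    by (intro tendsto_mult_right_zero LIMSEQ_power_zero) auto
  have RR: "R\<^sup>T * R = 1\<^sub>m r"
  proof (intro eq_matI)
    fix i j assume "i < dim_row (1\<^sub>m r)" "j < dim_col (1\<^sub>m r)"
    hence ij: "i < r" "j < r" by auto
    have "(\<lambda>k. \<Sum>l<r. X k $$ (l, i) * X k $$ (l, j)) \<longlonglongrightarrow> (\<Sum>l<r. R $$ (l, i) * R $$ (l, j))"
      using ij by (intro tendsto_sum tendsto_mult lim) auto
    moreover have "((X k)\<^sup>T * X k) $$ (i, j) = (\<Sum>l<r. X k $$ (l, i) * X k $$ (l, j))" for k
      using X[of k] ij by (simp add: scalar_prod_def atLeast0LessThan)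
    moreover have "(R\<^sup>T * R) $$ (i, j) = (\<Sum>l<r. R $$ (l, i) * R $$ (l, j))"
      using R ij by (simp add: scalar_prod_def atLeast0LessThan)
    ultimately have l1: "(\<lambda>k. ((X k)\<^sup>T * X k) $$ (i, j)) \<longlonglongrightarrow> (R\<^sup>T * R) $$ (i, j)" by simp
    have "(\<lambda>k. (1\<^sub>m r) $$ (i, j) - ((X k)\<^sup>T * X k) $$ (i, j)) \<longlonglongrightarrow> 0"
    proof (rule Lim_null_comparison[OF _ zero], intro always_eventually allI)
      fix k
      show "norm ((1\<^sub>m r) $$ (i, j) - ((X k)\<^sup>T * X k) $$ (i, j)) \<le> d * (1/8) ^ k"
        using entry_le_fnorm[of "1\<^sub>m r - (X k)\<^sup>T * X k" r r i j] defect[of k] X[of k] ij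
        by (simp del: index_mult_mat(1) index_one_mat(1))
    qed
    from tendsto_diff[OF tendsto_const[of "(1\<^sub>m r) $$ (i, j)"] this]
    have "(\<lambda>k. ((X k)\<^sup>T * X k) $$ (i, j)) \<longlonglongrightarrow> (1\<^sub>m r) $$ (i, j)" by simp
    with l1 show "(R\<^sup>T * R) $$ (i, j) = (1\<^sub>m r) $$ (i, j)" by (rule LIMSEQ_unique)
  qed (use R in auto)
  have RR': "R * R\<^sup>T = 1\<^sub>m r"
    using mat_mult_left_right_inverse[of "R\<^sup>T" r R] R RR by simp
  (* 5/7 * (1 - 8 ^ -k) is the partial sum of the series of increments 5/8 * 8 ^ -k *)
  have partial: "fnorm (C - X k) \<le> d * (5/7) * (1 - (1/8) ^ k)" for k
  proof (induction k)
    case 0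
    have "frobenius_sq (C - C) = 0" by (simp add: frobenius_sq_def)
    thus ?case by (simp add: X_def fnorm_def)
  next
    case (Suc k)
    have "fnorm (C - X (Suc k)) \<le> fnorm (C - X k) + fnorm (X k - X (Suc k))"
      using C X by (intro fnorm_triangle_via) auto
    also have "\<dots> \<le> d * (5/7) * (1 - (1/8) ^ k) + d * (5/8) * (1/8) ^ k"
      using Suc incr[of k] fnorm_minus_commute[OF X[of k] X[of "Suc k"]] by linarith
    also have "\<dots> = d * (5/7) * (1 - (1/8) ^ Suc k)" by (simp add: field_simps)
    finally show ?case .
  qed
  have "frobenius_sq (C - R) \<le> d\<^sup>2"
  proof (rule LIMSEQ_le_const2)
    have "frobenius_sq (C - Y) = (\<Sum>i<r. \<Sum>j<r. (C $$ (i, j) - Y $$ (i, j))\<^sup>2)"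
      if "Y \<in> carrier_mat r r" for Y using C that by (simp add: frobenius_sq_def)
    thus "(\<lambda>k. frobenius_sq (C - X k)) \<longlonglongrightarrow> frobenius_sq (C - R)"
      using X R by (simp, intro tendsto_sum tendsto_power tendsto_diff tendsto_const lim) auto
    have "frobenius_sq (C - X k) \<le> d\<^sup>2" for k
    proof -
      have "d * (5/7) * (1 - (1/8) ^ k) \<le> d * (5/7) * 1"
        using d by (intro mult_left_mono) auto
      hence "fnorm (C - X k) \<le> d" using partial[of k] d by linarith
      hence "(fnorm (C - X k))\<^sup>2 \<le> d\<^sup>2" by (intro power_mono fnorm_nonneg)
      thus ?thesis by (simp add: fnorm_sq)
    qed
    thus "\<exists>N. \<forall>k\<ge>N. frobenius_sq (C - X k) \<le> d\<^sup>2" by blast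
  qed
  hence "fnorm (C - R) \<le> d"
    using real_sqrt_le_mono[of "frobenius_sq (C - R)" "d\<^sup>2"] d by (simp add: fnorm_def)
  moreover have "R \<in> orthogonal_group r" using R RR RR' by (simp add: orthogonal_group_def)
  ultimately show ?thesis using that by (simp add: d_def)
qed

text \<open>
  The matrix \<open>C = B\<^sup>T * Bh\<close> expresses \<open>Bh\<close> in the basis \<open>B\<close> with error \<open>s\<close>. It is nearly orthogonal:
  \<open>I - C\<^sup>T * C\<close> is the Gram matrix of the residual \<open>Bh - B * C\<close>, so its norm is at most \<open>s\<^sup>2\<close>. Passing
  from \<open>C\<close> to a nearby orthogonal matrix costs no more than that.
\<close>
lemma orthonormal_basis_alignment:
  assumes B: "B \<in> carrier_mat m r" "B\<^sup>T * B = 1\<^sub>m r"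
    and Bh: "Bh \<in> carrier_mat m r" "Bh\<^sup>T * Bh = 1\<^sub>m r"
    and s: "s = fnorm (Bh - B * (B\<^sup>T * Bh))" and small: "s\<^sup>2 \<le> 1/8"
  obtains R where "R \<in> orthogonal_group r" "fnorm (Bh - B * R) \<le> s + s\<^sup>2"
proof -
  define C where "C = B\<^sup>T * Bh"
  define X where "X = Bh - B * C"
  have C: "C \<in> carrier_mat r r" and X: "X \<in> carrier_mat m r" using B Bh by (auto simp: C_def X_def)
  have BX: "B\<^sup>T * X = 0\<^sub>m r r"
  proof -
    have "B\<^sup>T * X = B\<^sup>T * Bh - B\<^sup>T * (B * C)"
      using B Bh C by (simp add: X_def mult_minus_distrib_mat[of _ r m _ r])
    also have "B\<^sup>T * (B * C) = C"
      using B C assoc_mult_mat[of "B\<^sup>T" r m B r C r] by simp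
    finally show ?thesis using C by (simp add: C_def[symmetric])
  qed
  have "X\<^sup>T * X = Bh\<^sup>T * X - C\<^sup>T * (B\<^sup>T * X)"
  proof -
    have "X\<^sup>T = Bh\<^sup>T - C\<^sup>T * B\<^sup>T"
      using B Bh C by (simp add: X_def transpose_minus[of _ m r] transpose_mult[of _ m r _ r])
    hence "X\<^sup>T * X = Bh\<^sup>T * X - C\<^sup>T * B\<^sup>T * X"
      using B Bh C X minus_mult_distrib_mat[of "Bh\<^sup>T" r m "C\<^sup>T * B\<^sup>T" X r] by simp
    thus ?thesis using assoc_mult_mat[of "C\<^sup>T" r r "B\<^sup>T" m X r] B C X by simp
  qed
  also have "\<dots> = Bh\<^sup>T * X" using BX C Bh X by (intro eq_matI) (auto simp del: index_mult_mat(1))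
  also have "\<dots> = Bh\<^sup>T * Bh - Bh\<^sup>T * (B * C)"
    using B Bh C by (simp add: X_def mult_minus_distrib_mat[of _ r m _ r])
  also have "Bh\<^sup>T * (B * C) = C\<^sup>T * C"
    using B Bh C assoc_mult_mat[of "Bh\<^sup>T" r m B r C r]
    by (simp add: C_def transpose_mult[of "B\<^sup>T" r m Bh r])
  finally have D: "1\<^sub>m r - C\<^sup>T * C = X\<^sup>T * X" unfolding Bh(2) by (rule sym)
  have sX: "s = fnorm X" unfolding s X_def C_def by (rule refl)
  have "fnorm (X\<^sup>T * X) \<le> fnorm X\<^sup>T * fnorm X" using X by (intro fnorm_mult) auto
  hence "fnorm (1\<^sub>m r - C\<^sup>T * C) \<le> s\<^sup>2"
    unfolding D sX fnorm_transpose power2_eq_square .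
  moreover from this small have "fnorm (1\<^sub>m r - C\<^sup>T * C) \<le> 1/8" by linarith
  then obtain R where "R \<in> orthogonal_group r" "fnorm (C - R) \<le> fnorm (1\<^sub>m r - C\<^sup>T * C)"
    using nearby_orthogonal_matrix[OF C] by blast
  ultimately have R: "R \<in> orthogonal_group r" "fnorm (C - R) \<le> s\<^sup>2" by linarith+
  have Rc: "R \<in> carrier_mat r r" using R by (simp add: orthogonal_group_def)
  have "fnorm (Bh - B * R) \<le> fnorm (Bh - B * C) + fnorm (B * C - B * R)"
    using B Bh C Rc by (intro fnorm_triangle_via) auto
  also have "B * C - B * R = B * (C - R)"
    using B C Rc by (simp add: mult_minus_distrib_mat[of _ m r _ r])
  also have "fnorm (B * (C - R)) = fnorm (C - R)"
    using frobenius_sq_isometry_left[OF B, of "C - R" r] C Rc by (simp add: fnorm_def)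
  finally show ?thesis using that[OF R(1)] R(2) by (simp add: s C_def)
qed

section \<open>Leading singular vectors and their perturbation\<close>

text \<open>
  Weights between 0 and 1 of total mass at most \<open>r\<close> collect most when they sit on the \<open>r\<close> largest
  terms. Every term is compared with the threshold \<open>a r\<close>.
\<close>
lemma weighted_sum_le_top:
  fixes a w :: "nat \<Rightarrow> real"
  assumes a: "\<And>i j. i \<le> j \<Longrightarrow> j < N \<Longrightarrow> a j \<le> a i" "\<And>i. i < N \<Longrightarrow> 0 \<le> a i"
    and w: "\<And>i. i < N \<Longrightarrow> 0 \<le> w i" "\<And>i. i < N \<Longrightarrow> w i \<le> 1" "(\<Sum>i<N. w i) \<le> real r"
  shows "(\<Sum>i<N. a i * w i) \<le> (\<Sum>i<N. a i * (if i < r then 1 else 0))"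
proof (cases "r < N")
  case True
  have "(\<Sum>i<N. a i * w i - a i * (if i < r then 1 else 0)) \<le> (\<Sum>i<N. a r * (w i - (if i < r then 1 else 0)))"
  proof (intro sum_mono)
    fix i assume i: "i \<in> {..<N}"
    have "(a i - a r) * (w i - (if i < r then 1 else 0)) \<le> 0"
      
    proof (cases "i < r")
      case True
      thus ?thesis using a(1)[of i r] w(2)[of i] i \<open>r < N\<close> by (intro mult_nonneg_nonpos) auto
    next
      case False
      thus ?thesis using a(1)[of r i] w(1)[of i] i by (intro mult_nonpos_nonneg) auto
    qed
    thus "a i * w i - a i * (if i < r then 1 else 0) \<le> a r * (w i - (if i < r then 1 else 0))"
      by (simp add: algebra_simps)
  qed
  also have "\<dots> = a r * ((\<Sum>i<N. w i) - (\<Sum>i<N. if i < r then 1 else 0))"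
    by (simp add: sum_distrib_left[symmetric] sum_subtractf)
  also have "(\<Sum>i<N. if i < r then 1 else 0) = real r"
  proof -
    have "{..<N} \<inter> {i. i < r} = {..<r}" using True by auto
    thus ?thesis by (simp add: sum.If_cases)
  qed
  also have "a r * ((\<Sum>i<N. w i) - real r) \<le> 0"
    using a(2)[OF True] w(3) by (intro mult_nonneg_nonpos) auto
  finally show ?thesis by (simp add: sum_subtractf)
next
  case False
  thus ?thesis using a(2) w(2) by (intro sum_mono mult_left_mono) auto
qed

lemma is_svdD:
  assumes "is_svd M U S V" "M \<in> carrier_mat m n"
  shows "U \<in> carrier_mat m m" "U\<^sup>T * U = 1\<^sub>m m" "U * U\<^sup>T = 1\<^sub>m m"
    "V \<in> carrier_mat n n" "V\<^sup>T * V = 1\<^sub>m n" "V * V\<^sup>T = 1\<^sub>m n"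
    "S \<in> carrier_mat m n" "M = U * S * V\<^sup>T"
    "\<And>i j. i < m \<Longrightarrow> j < n \<Longrightarrow> i \<noteq> j \<Longrightarrow> S $$ (i, j) = 0"
    "\<And>i. i < min m n \<Longrightarrow> 0 \<le> S $$ (i, i)"
    "\<And>i j. j < min m n \<Longrightarrow> i \<le> j \<Longrightarrow> S $$ (j, j) \<le> S $$ (i, i)"
proof -
  have dims: "dim_row M = m" "dim_col M = n" using assms(2) by auto
  note svd = assms(1)[unfolded is_svd_def orthogonal_group_def dims]
  show "U \<in> carrier_mat m m" "U\<^sup>T * U = 1\<^sub>m m" "U * U\<^sup>T = 1\<^sub>m m"
    "V \<in> carrier_mat n n" "V\<^sup>T * V = 1\<^sub>m n" "V * V\<^sup>T = 1\<^sub>m n"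
    "S \<in> carrier_mat m n" "M = U * S * V\<^sup>T" using svd by blast+
  show "S $$ (i, j) = 0" if "i < m" "j < n" "i \<noteq> j" for i j using svd that by blast
  show "0 \<le> S $$ (i, i)" if "i < min m n" for i using svd that by blast
  show "S $$ (j, j) \<le> S $$ (i, i)" if "j < min m n" "i \<le> j" for i j
    using svd that by (cases "i = j") auto
qed

text \<open>
  The orthogonal factor \<open>V\<close> does not change the norm, and \<open>S\<close> scales the columns of \<open>Q * U\<close>.
\<close>
lemma frobenius_sq_mult_svd:
  assumes svd: "is_svd M U S V" and M: "M \<in> carrier_mat m n" and Q: "Q \<in> carrier_mat k m"
  shows "frobenius_sq (Q * M) = (\<Sum>i<min m n. (S $$ (i, i))\<^sup>2 * (euclid_norm (Q *\<^sub>v col U i))\<^sup>2)"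
proof -
  note * = is_svdD[OF svd M]
  define W where "W = Q * U"
  have W: "W \<in> carrier_mat k m" using Q * by (simp add: W_def)
  have Wcol: "col W i = Q *\<^sub>v col U i" if "i < m" for i
    using Q *(1) that by (simp add: W_def col_mult2[of _ k m _ m] del: col_mult)
  have "Q * M = (W * S) * V\<^sup>T"
    using Q * assoc_mult_mat[of Q k m "U * S" n "V\<^sup>T" n] assoc_mult_mat[of Q k m U m S n]
    by (simp add: W_def)
  hence "frobenius_sq (Q * M) = frobenius_sq (W * S)"
    using frobenius_sq_isometry_right[of "V\<^sup>T" n n "W * S" k] W * by simp
  also have "\<dots> = (\<Sum>j<n. \<Sum>l<k. ((W * S) $$ (l, j))\<^sup>2)"
    unfolding frobenius_sq_def using W * by (subst sum.swap) simp
  also have "\<dots> = (\<Sum>j<min m n. \<Sum>l<k. ((W * S) $$ (l, j))\<^sup>2)"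
  proof (rule sum.mono_neutral_right)
    show "\<forall>j\<in>{..<n} - {..<min m n}. (\<Sum>l<k. ((W * S) $$ (l, j))\<^sup>2) = 0"
      using W * by (auto simp: scalar_prod_def)
  qed auto
  also have "\<dots> = (\<Sum>j<min m n. (S $$ (j, j))\<^sup>2 * (euclid_norm (Q *\<^sub>v col U j))\<^sup>2)"
  proof (rule sum.cong[OF refl])
    fix j assume "j \<in> {..<min m n}"
    hence j: "j < m" "j < n" by auto
    have "(W * S) $$ (l, j) = W $$ (l, j) * S $$ (j, j)" if "l < k" for l
    proof -
      have "(W * S) $$ (l, j) = (\<Sum>i<m. W $$ (l, i) * S $$ (i, j))"
        using W * j that by (simp add: scalar_prod_def atLeast0LessThan)
      also have "\<dots> = (\<Sum>i<m. if i = j then W $$ (l, j) * S $$ (j, j) else 0)"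
        using *(9) j by (intro sum.cong) auto
      finally show ?thesis using j by simp
    qed
    thus "(\<Sum>l<k. ((W * S) $$ (l, j))\<^sup>2) = (S $$ (j, j))\<^sup>2 * (euclid_norm (Q *\<^sub>v col U j))\<^sup>2"
      using W j by (simp add: Wcol[symmetric] euclid_norm_sq_sum power_mult_distrib sum_distrib_left mult.commute)
  qed
  finally show ?thesis .
qed

definition leading_cols :: "real mat \<Rightarrow> nat \<Rightarrow> real mat" where
  "leading_cols U s = Matrix.mat (dim_row U) s (\<lambda>(i, j). U $$ (i, j))"

lemma leading_cols_carrier: "U \<in> carrier_mat m n \<Longrightarrow> leading_cols U s \<in> carrier_mat m s"
  by (simp add: leading_cols_def)

lemma leading_cols_cross:
  assumes "U \<in> carrier_mat m m" "U\<^sup>T * U = 1\<^sub>m m" "s \<le> m" "i < s" "j < m"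
  shows "((leading_cols U s)\<^sup>T * U) $$ (i, j) = (if i = j then 1 else 0)"
proof -
  have "((leading_cols U s)\<^sup>T * U) $$ (i, j) = (U\<^sup>T * U) $$ (i, j)"
    using assms(1,3-) by (simp add: leading_cols_def scalar_prod_def)
  thus ?thesis using assms by simp
qed

lemma leading_cols_orthonormal:
  assumes "U \<in> carrier_mat m m" "U\<^sup>T * U = 1\<^sub>m m" "s \<le> m"
  shows "(leading_cols U s)\<^sup>T * leading_cols U s = 1\<^sub>m s"
proof (rule eq_matI)
  fix i j assume "i < dim_row (1\<^sub>m s)" "j < dim_col (1\<^sub>m s)"
  hence ij: "i < s" "j < s" by auto
  have "((leading_cols U s)\<^sup>T * leading_cols U s) $$ (i, j) = ((leading_cols U s)\<^sup>T * U) $$ (i, j)"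
    using assms(1,3) ij by (simp add: leading_cols_def scalar_prod_def)
  also have "\<dots> = 1\<^sub>m s $$ (i, j)" using leading_cols_cross[OF assms, of i j] ij assms(3) by simp
  finally show "((leading_cols U s)\<^sup>T * leading_cols U s) $$ (i, j) = 1\<^sub>m s $$ (i, j)" .
qed (use assms in \<open>simp_all add: leading_cols_def\<close>)

text \<open>
  Ky Fan's principle. For orthonormal \<open>B\<close> the weights \<open>\<parallel>B\<^sup>T u i\<parallel>\<^sup>2\<close> of the squared singular values
  lie between 0 and 1 and add up to \<open>s\<close>; for the leading singular vectors they are 1 for \<open>i < s\<close>
  and 0 afterwards.
\<close>
lemma leading_singular_vectors_maximise_energy:
  assumes svd: "is_svd M U S V" and M: "M \<in> carrier_mat m n" and "s \<le> m"
    and B: "B \<in> carrier_mat m s" "B\<^sup>T * B = 1\<^sub>m s"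
  shows "frobenius_sq (B\<^sup>T * M) \<le> frobenius_sq ((leading_cols U s)\<^sup>T * M)"
proof -
  note * = is_svdD[OF svd M]
  define w where "w i = (euclid_norm (B\<^sup>T *\<^sub>v col U i))\<^sup>2" for i
  have Ucol: "col U i \<in> carrier_vec m" if "i < m" for i using *(1) that by simp
  have unit: "euclid_norm (col U i) = 1" if "i < m" for i
  proof -
    have "col U i \<bullet> col U i = (U\<^sup>T * U) $$ (i, i)" using *(1) that by simp
    thus ?thesis using *(2) that by (simp add: euclid_norm_def)
  qed
  have w1: "w i \<le> 1" if "i < m" for i
  proof -
    have "w i \<le> (euclid_norm (col U i))\<^sup>2"
      unfolding w_def using B Ucol that by (intro power_mono euclid_norm_transpose_isometry euclid_norm_nonneg)
    thus ?thesis using unit that by simp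
  qed
  have wsum: "(\<Sum>i<m. w i) = real s"
  proof -
    have "(\<Sum>i<m. w i) = frobenius_sq (B\<^sup>T * U)"
      using B *(1) by (simp add: frobenius_sq_cols w_def col_mult2[of _ s m _ m] del: col_mult)
    also have "\<dots> = frobenius_sq B\<^sup>T"
      using B * by (intro frobenius_sq_isometry_right) auto
    also have "\<dots> = real s"
      using fnorm_transpose[of B] frobenius_sq_orthonormal[OF B] by (simp add: fnorm_def)
    finally show ?thesis .
  qed
  have "frobenius_sq (B\<^sup>T * M) = (\<Sum>i<min m n. (S $$ (i, i))\<^sup>2 * w i)"
    using B by (simp add: frobenius_sq_mult_svd[OF svd M, of _ s] w_def)
  also have "\<dots> \<le> (\<Sum>i<min m n. (S $$ (i, i))\<^sup>2 * (if i < s then 1 else 0))"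
  proof (rule weighted_sum_le_top)
    show "(S $$ (j, j))\<^sup>2 \<le> (S $$ (i, i))\<^sup>2" if "i \<le> j" "j < min m n" for i j
      using *(10)[of j] *(11)[of j i] that by (intro power_mono) auto
    have "(\<Sum>i<min m n. w i) \<le> (\<Sum>i<m. w i)" by (intro sum_mono2) (auto simp: w_def)
    thus "(\<Sum>i<min m n. w i) \<le> real s" using wsum by simp
  qed (use w1 in \<open>auto simp: w_def\<close>)
  also have "\<dots> = (\<Sum>i<min m n. (S $$ (i, i))\<^sup>2 * (euclid_norm ((leading_cols U s)\<^sup>T *\<^sub>v col U i))\<^sup>2)"
  proof (intro sum.cong refl arg_cong2[of _ _ _ _ times])
    fix i assume "i \<in> {..<min m n}"
    hence i: "i < m" by simp
    have L: "(leading_cols U s)\<^sup>T \<in> carrier_mat s m" using *(1) by (simp add: leading_cols_carrier)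
    have "(euclid_norm ((leading_cols U s)\<^sup>T *\<^sub>v col U i))\<^sup>2
        = (\<Sum>l<s. (((leading_cols U s)\<^sup>T * U) $$ (l, i))\<^sup>2)"
      using L *(1) i by (simp add: euclid_norm_sq_sum)
    also have "\<dots> = (\<Sum>l<s. if l = i then 1 else 0)"
      using leading_cols_cross[OF *(1,2) \<open>s \<le> m\<close> _ i] by (intro sum.cong) (auto simp del: index_mult_mat(1))
    finally show "(if i < s then 1 else 0) = (euclid_norm ((leading_cols U s)\<^sup>T *\<^sub>v col U i))\<^sup>2"
      by simp
  qed
  also have "\<dots> = frobenius_sq ((leading_cols U s)\<^sup>T * M)"
    using *(1) by (simp add: frobenius_sq_mult_svd[OF svd M, of _ s] leading_cols_carrier)
  finally show ?thesis .
qed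

text \<open>
  A bound of Wedin type in the Frobenius norm, for \<open>M\<close> with column space inside that of \<open>B\<close>. By
  optimality of the leading singular vectors, the part of \<open>Mh\<close> outside their span is at most its
  part outside the column space of \<open>B\<close>, hence at most \<open>\<parallel>Mh - M\<parallel>\<close>. So the part of \<open>M\<close> outside that
  span is at most \<open>2 * \<parallel>Mh - M\<parallel>\<close>, and dividing by the smallest singular value \<open>c\<close> of \<open>M\<close> on its column
  space leaves the part of \<open>B\<close> outside the span. The latter is as large as the part of \<open>Bh\<close> outside
  the column space of \<open>B\<close>, since both spaces have dimension \<open>s\<close>.
\<close>
lemma left_singular_subspace_perturbation:
  assumes svd: "is_svd Mh U S V" and Mh: "Mh \<in> carrier_mat m n" and M: "M \<in> carrier_mat m n"
    and "s \<le> m" and Bh: "Bh = leading_cols U s"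
    and B: "B \<in> carrier_mat m s" "B\<^sup>T * B = 1\<^sub>m s" and range: "M = B * (B\<^sup>T * M)"
    and c: "0 \<le> c" "\<And>y. y \<in> carrier_vec s \<Longrightarrow> c * euclid_norm y \<le> euclid_norm ((M\<^sup>T * B) *\<^sub>v y)"
  shows "c * fnorm (Bh - B * (B\<^sup>T * Bh)) \<le> 2 * fnorm (Mh - M)"
proof -
  note * = is_svdD[OF svd Mh]
  define E where "E = Mh - M"
  have E: "E \<in> carrier_mat m n" using M by (simp add: E_def minus_carrier_mat)
  have Bh': "Bh \<in> carrier_mat m s" "Bh\<^sup>T * Bh = 1\<^sub>m s"
    using * \<open>s \<le> m\<close> by (simp_all add: Bh leading_cols_carrier leading_cols_orthonormal)
  have contr: "frobenius_sq (X - Q * (Q\<^sup>T * X)) \<le> frobenius_sq X"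
    if "Q \<in> carrier_mat m s" "Q\<^sup>T * Q = 1\<^sub>m s" "X \<in> carrier_mat m n" for Q X :: "real mat"
    using frobenius_sq_residual[OF that] frobenius_sq_nonneg by simp
  have lin: "(X + Y) - Q * (Q\<^sup>T * (X + Y)) = (X - Q * (Q\<^sup>T * X)) + (Y - Q * (Q\<^sup>T * Y))"
    if "Q \<in> carrier_mat m s" "X \<in> carrier_mat m n" "Y \<in> carrier_mat m n" for Q X Y :: "real mat"
  proof -
    have "Q * (Q\<^sup>T * (X + Y)) = Q * (Q\<^sup>T * X) + Q * (Q\<^sup>T * Y)"
      using that by (simp add: mult_add_distrib_mat[of _ s m _ n] mult_add_distrib_mat[of _ m s _ n])
    thus ?thesis using that by (intro eq_matI) (auto simp del: index_mult_mat(1))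
  qed
  have ME: "Mh = M + E" using M Mh by (intro eq_matI) (auto simp: E_def)
  have "frobenius_sq (Mh - Bh * (Bh\<^sup>T * Mh)) \<le> frobenius_sq (Mh - B * (B\<^sup>T * Mh))"
    using leading_singular_vectors_maximise_energy[OF svd Mh \<open>s \<le> m\<close> B]
    unfolding frobenius_sq_residual[OF B Mh] frobenius_sq_residual[OF Bh' Mh] unfolding Bh by simp
  also have "Mh - B * (B\<^sup>T * Mh) = E - B * (B\<^sup>T * E)"
  proof -
    have "M - B * (B\<^sup>T * M) = 0\<^sub>m m n" using range M by (simp add: minus_r_inv_mat)
    thus ?thesis unfolding ME lin[OF B(1) M E] using B E by (simp add: minus_carrier_mat)
  qed
  also have "frobenius_sq (E - B * (B\<^sup>T * E)) \<le> frobenius_sq E" by (rule contr[OF B E])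
  finally have 1: "fnorm (Mh - Bh * (Bh\<^sup>T * Mh)) \<le> fnorm E" by (simp add: fnorm_def)
  have 2: "fnorm (E - Bh * (Bh\<^sup>T * E)) \<le> fnorm E" using contr[OF Bh' E] by (simp add: fnorm_def)
  have 3: "fnorm (M - Bh * (Bh\<^sup>T * M)) \<le> 2 * fnorm E"
  proof -
    have "M - Bh * (Bh\<^sup>T * M) = (Mh - Bh * (Bh\<^sup>T * Mh)) - (E - Bh * (Bh\<^sup>T * E))"
      unfolding ME lin[OF Bh'(1) M E] using M E Bh'(1)
      by (intro eq_matI) (auto simp del: index_mult_mat(1))
    moreover have "fnorm ((Mh - Bh * (Bh\<^sup>T * Mh)) - (E - Bh * (Bh\<^sup>T * E)))
        \<le> fnorm (Mh - Bh * (Bh\<^sup>T * Mh)) + fnorm (E - Bh * (Bh\<^sup>T * E))"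
      using Mh E Bh'(1) by (intro fnorm_triangle_diff[of _ m n]) (auto simp: minus_carrier_mat)
    ultimately have "fnorm (M - Bh * (Bh\<^sup>T * M)) \<le> fnorm (Mh - Bh * (Bh\<^sup>T * Mh)) + fnorm (E - Bh * (Bh\<^sup>T * E))"
      by simp
    thus ?thesis using 1 2 by linarith
  qed
  define X where "X = B - Bh * (Bh\<^sup>T * B)"
  have X: "X \<in> carrier_mat m s" using B Bh' by (simp add: X_def minus_carrier_mat)
  have "M - Bh * (Bh\<^sup>T * M) = X * (B\<^sup>T * M)"
  proof -
    have BM: "B\<^sup>T * M \<in> carrier_mat s n" using B M by simp
    have "X * (B\<^sup>T * M) = B * (B\<^sup>T * M) - Bh * (Bh\<^sup>T * B) * (B\<^sup>T * M)"
      unfolding X_def using B Bh' BM by (intro minus_mult_distrib_mat[of _ m s _ _ n]) auto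
    also have "Bh * (Bh\<^sup>T * B) * (B\<^sup>T * M) = Bh * (Bh\<^sup>T * (B * (B\<^sup>T * M)))"
      using B Bh' BM assoc_mult_mat[of Bh m s "Bh\<^sup>T * B" s "B\<^sup>T * M" n]
        assoc_mult_mat[of "Bh\<^sup>T" s m B s "B\<^sup>T * M" n] by simp
    finally show ?thesis using range by simp
  qed
  moreover have "fnorm (X * (B\<^sup>T * M)) = fnorm ((M\<^sup>T * B) * X\<^sup>T)"
  proof -
    have "(X * (B\<^sup>T * M))\<^sup>T = (M\<^sup>T * B) * X\<^sup>T"
      using X B M transpose_mult[of X m s "B\<^sup>T * M" n] transpose_mult[of "B\<^sup>T" s m M n] by simp
    thus ?thesis by (metis fnorm_transpose)
  qed
  moreover have "c * fnorm X\<^sup>T \<le> fnorm ((M\<^sup>T * B) * X\<^sup>T)"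
    using X B M c by (intro fnorm_mult_lower[of _ n s _ m]) auto
  ultimately have 4: "c * fnorm X \<le> 2 * fnorm E" using 3 by (simp add: fnorm_transpose)
  have "frobenius_sq X = frobenius_sq (Bh - B * (B\<^sup>T * Bh))"
  proof -
    have "(Bh\<^sup>T * B)\<^sup>T = B\<^sup>T * Bh" using B Bh' by (simp add: transpose_mult[of _ s m _ s])
    hence "frobenius_sq (Bh\<^sup>T * B) = frobenius_sq (B\<^sup>T * Bh)"
      using fnorm_transpose[of "Bh\<^sup>T * B"] by (simp add: fnorm_def)
    thus ?thesis unfolding X_def frobenius_sq_residual[OF B Bh'(1)] frobenius_sq_residual[OF Bh' B(1)]
      by (simp add: frobenius_sq_orthonormal[OF B] frobenius_sq_orthonormal[OF Bh'])
  qed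
  thus ?thesis using 4 by (simp add: fnorm_def E_def)
qed

section \<open>Rank as the least inner dimension of a factorisation\<close>

lemma mult_zero_mat_vec [simp]: "v \<in> carrier_vec n \<Longrightarrow> 0\<^sub>m m n *\<^sub>v v = (0\<^sub>v m :: real vec)"
  by (intro eq_vecI) auto

lemma mult_mat_zero_vec [simp]: "A \<in> carrier_mat m n \<Longrightarrow> A *\<^sub>v 0\<^sub>v n = (0\<^sub>v m :: real vec)"
  by (intro eq_vecI) auto

text \<open>
  The rank of \<open>M\<close> is the least such \<open>q\<close>. In this form ranks are compared by multiplying matrices.
\<close>
definition factors_through :: "real mat \<Rightarrow> nat \<Rightarrow> bool" where
  "factors_through M q \<longleftrightarrow>
     (\<exists>X Y. X \<in> carrier_mat (dim_row M) q \<and> Y \<in> carrier_mat q (dim_col M) \<and> M = X * Y)"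

lemma factors_through_self:
  "factors_through M (dim_row M)" "factors_through M (dim_col M)"
  unfolding factors_through_def
  by (rule exI[of _ "1\<^sub>m (dim_row M)"], rule exI[of _ M], simp)
     (rule exI[of _ M], rule exI[of _ "1\<^sub>m (dim_col M)"], simp)

lemma factors_through_mult:
  assumes M: "factors_through M q" "M \<in> carrier_mat m n" and L: "L \<in> carrier_mat k m" and R: "R \<in> carrier_mat n l"
  shows "factors_through (L * M * R) q"
proof -
  from M obtain X Y where XY: "X \<in> carrier_mat m q" "Y \<in> carrier_mat q n" "M = X * Y"
    unfolding factors_through_def by auto
  have "L * M * R = (L * X) * (Y * R)"
  proof -
    have "L * M * R = L * (X * Y * R)"
      using L R M(2) XY assoc_mult_mat[of L k m "X * Y" n R l] by simp
    also have "X * Y * R = X * (Y * R)" using XY R by (intro assoc_mult_mat) auto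
    also have "L * (X * (Y * R)) = (L * X) * (Y * R)" using L R XY by (intro assoc_mult_mat[symmetric]) auto
    finally show ?thesis .
  qed
  thus ?thesis unfolding factors_through_def using L R M(2) XY
    by (intro exI[of _ "L * X"] exI[of _ "Y * R"]) auto
qed

text \<open>
  Padded with zero rows, the matrix becomes square and singular.
\<close>
lemma wide_matrix_kernel:
  fixes Y :: "real mat"
  assumes Y: "Y \<in> carrier_mat q n" and "q < n"
  obtains v where "v \<in> carrier_vec n" "v \<noteq> 0\<^sub>v n" "Y *\<^sub>v v = 0\<^sub>v q"
proof -
  define Z where "Z = Matrix.mat n n (\<lambda>(i, j). if i < q then Y $$ (i, j) else 0)"
  have Z: "Z \<in> carrier_mat n n" by (simp add: Z_def)
  let ?e = "unit_vec n (n - 1) :: real vec"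
  (* the last row of Z vanishes *)
  have "Z\<^sup>T *\<^sub>v ?e = 0\<^sub>v n"
  proof (rule eq_vecI)
    fix i assume "i < dim_vec (0\<^sub>v n :: real vec)"
    thus "(Z\<^sup>T *\<^sub>v ?e) $ i = 0\<^sub>v n $ i" using \<open>q < n\<close> by (simp add: Z_def)
  qed (simp add: Z_def)
  moreover have "?e \<noteq> 0\<^sub>v n" using \<open>q < n\<close> by (metis diff_less index_unit_vec(1) index_zero_vec(1)
      less_nat_zero_code linorder_neqE_nat zero_less_one zero_neq_one)
  ultimately have "det Z\<^sup>T = 0"
    using Z by (subst det_0_iff_vec_prod_zero_field[of _ n]) (auto intro!: exI[of _ ?e])
  hence "det Z = 0" using Z by (simp add: det_transpose)
  then obtain v where v: "v \<in> carrier_vec n" "v \<noteq> 0\<^sub>v n" "Z *\<^sub>v v = 0\<^sub>v n"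
    using Z by (subst (asm) det_0_iff_vec_prod_zero_field[of _ n]) auto
  have "Y *\<^sub>v v = 0\<^sub>v q"
  proof (rule eq_vecI)
    fix i assume "i < dim_vec (0\<^sub>v q :: real vec)"
    hence i: "i < q" by simp
    have "row Y i = row Z i" using Y i \<open>q < n\<close> by (intro eq_vecI) (auto simp: Z_def)
    hence "(Y *\<^sub>v v) $ i = (Z *\<^sub>v v) $ i" using Y Z i \<open>q < n\<close> by simp
    thus "(Y *\<^sub>v v) $ i = 0\<^sub>v q $ i" using v i \<open>q < n\<close> by simp
  qed (use Y in simp)
  with v that show ?thesis by blast
qed

text \<open>
  Independent columns of \<open>X * Y\<close> are images under \<open>X\<close> of vectors with \<open>q\<close> entries; more than \<open>q\<close> of
  these would satisfy a linear relation, and \<open>X\<close> would carry it over to the columns.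
\<close>
lemma rank_le_factors_through:
  assumes "factors_through M q"
  shows "vec_space.rank (dim_row M) M \<le> q"
proof -
  define m where "m = dim_row M"
  define n where "n = dim_col M"
  interpret vec_space "TYPE(real)" m .
  from assms obtain X Y where XY: "X \<in> carrier_mat m q" "Y \<in> carrier_mat q n" "M = X * Y"
    unfolding factors_through_def m_def n_def by auto
  have M: "M \<in> carrier_mat m n" by (simp add: m_def n_def)
  obtain S where S: "maximal S (\<lambda>T. T \<subseteq> set (cols M) \<and> lin_indpt T)" "finite S"
    using maximal_exists_superset[of "set (cols M)" "\<lambda>T. T \<subseteq> set (cols M) \<and> lin_indpt T" "{}"]
    by (auto simp: finite_lin_indpt2)
  hence S': "S \<subseteq> set (cols M)" "lin_indpt S" by (auto simp: maximal_def)
  have "card S \<le> q"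
  proof (rule ccontr)
    assume less: "\<not> card S \<le> q"
    obtain ss where ss: "distinct ss" "set ss = S" using S(2) finite_distinct_list by blast
    define l where "l = length ss"
    have l: "q < l" using less ss distinct_card l_def by fastforce
    have "\<exists>j<n. s = col M j" if "s \<in> S" for s
    proof -
      have "s \<in> col M ` {0..<n}" using S' that M by (auto simp: cols_def)
      thus ?thesis by auto
    qed
    then obtain \<iota> where \<iota>: "\<And>s. s \<in> S \<Longrightarrow> \<iota> s < n \<and> s = col M (\<iota> s)" by metis
    define Y' where "Y' = mat_of_cols q (map (\<lambda>s. col Y (\<iota> s)) ss)"
    define N where "N = mat_of_cols m ss"
    have Y': "Y' \<in> carrier_mat q l" and N: "N \<in> carrier_mat m l"
      by (auto simp: Y'_def N_def l_def mat_of_cols_def)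
    obtain v where v: "v \<in> carrier_vec l" "v \<noteq> 0\<^sub>v l" "Y' *\<^sub>v v = 0\<^sub>v q"
      using wide_matrix_kernel[OF Y' l] .
    have "set ss \<subseteq> carrier_vec m" using S' ss M by (metis carrier_matD(1) cols_dim subset_trans)
    hence colsN: "cols N = ss" by (simp add: N_def)
    have "N = X * Y'"
    proof (rule mat_col_eqI)
      fix i assume "i < dim_col (X * Y')"
      hence i: "i < l" using Y' by simp
      hence si: "ss ! i \<in> S" using ss l_def nth_mem by blast
      have "col N i = ss ! i" using i colsN N by (metis carrier_matD(2) cols_nth)
      also have "\<dots> = X *\<^sub>v col Y (\<iota> (ss ! i))"
        using \<iota>[OF si] XY by (metis col_mult2)
      also have "col Y (\<iota> (ss ! i)) = col Y' i"
        using i \<iota>[OF si] XY unfolding Y'_def l_def by (subst col_mat_of_cols) auto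
      also have "X *\<^sub>v col Y' i = col (X * Y') i" using XY Y' i by (metis col_mult2)
      finally show "col N i = col (X * Y') i" .
    qed (use N XY Y' in auto)
    hence "N *\<^sub>v v = 0\<^sub>v m"
      using XY Y' v assoc_mult_mat_vec[of X m q Y' l v] by simp
    hence "lin_dep (set (cols N))" using lin_depI[OF N v(1,2)] colsN ss by simp
    thus False using S' colsN ss by simp
  qed
  thus ?thesis using rank_card_indpt[OF M S(1)] by (simp add: m_def)
qed

text \<open>
  A maximal independent set of columns serves as the left factor.
\<close>
lemma factors_through_rank: "factors_through M (vec_space.rank (dim_row M) M)"
proof -
  define m where "m = dim_row M"
  define n where "n = dim_col M"
  interpret vec_space "TYPE(real)" m .
  have M: "M \<in> carrier_mat m n" by (simp add: m_def n_def)
  obtain S where S: "maximal S (\<lambda>T. T \<subseteq> set (cols M) \<and> lin_indpt T)" "finite S"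
    using maximal_exists_superset[of "set (cols M)" "\<lambda>T. T \<subseteq> set (cols M) \<and> lin_indpt T" "{}"]
    by (auto simp: finite_lin_indpt2)
  hence S': "S \<subseteq> set (cols M)" "lin_indpt S" by (auto simp: maximal_def)
  have colsM: "set (cols M) \<subseteq> carrier_vec m" using M cols_dim by blast
  obtain ss where ss: "distinct ss" "set ss = S" using S(2) finite_distinct_list by blast
  define N where "N = mat_of_cols m ss"
  define q where "q = card S"
  have N: "N \<in> carrier_mat m q" using ss by (auto simp: N_def q_def mat_of_cols_def distinct_card)
  have colsN: "cols N = ss" using ss S' colsM by (simp add: N_def)
  have "\<exists>y \<in> carrier_vec q. col M j = N *\<^sub>v y" if j: "j < n" for j
  proof -
    let ?c = "col M j"
    have cM: "?c \<in> set (cols M)" using M j by (auto simp: cols_def)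
    have "?c \<in> span S"
    proof (rule ccontr)
      assume "?c \<notin> span S"
      moreover have "S \<subseteq> carrier_vec m" "?c \<in> carrier_vec m" using S' colsM cM by auto
      ultimately have "lin_indpt (S \<union> {?c})" "?c \<notin> S"
        using lin_dep_iff_in_span[of S ?c] S'(2) span_mem[of S] by auto
      thus False using S(1) S'(1) cM unfolding maximal_def by blast
    qed
    then obtain a where "?c = lincomb a S"
      using finite_span[OF S(2)] S' colsM by auto
    also have "\<dots> = N *\<^sub>v vec q (\<lambda>i. a (col N i))"
      using mat_mult_eq_lincomb[OF N, of a] colsN ss by simp
    finally show ?thesis by (intro bexI[of _ "vec q (\<lambda>i. a (col N i))"]) auto
  qed
  then obtain y where y: "\<And>j. j < n \<Longrightarrow> y j \<in> carrier_vec q \<and> col M j = N *\<^sub>v y j" by metis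
  define Y where "Y = Matrix.mat q n (\<lambda>(i, j). y j $ i)"
  have Y: "Y \<in> carrier_mat q n" by (simp add: Y_def)
  have "M = N * Y"
  proof (rule mat_col_eqI)
    fix j assume "j < dim_col (N * Y)"
    hence j: "j < n" using Y by simp
    have "col Y j = y j" using y[OF j] j by (intro eq_vecI) (auto simp: Y_def)
    thus "col M j = col (N * Y) j" using col_mult2[OF N Y j] y[OF j] by simp
  qed (use M N Y in auto)
  moreover have "rank M = q" using rank_card_indpt[OF M S(1)] by (simp add: q_def)
  ultimately show ?thesis unfolding factors_through_def using N Y
    unfolding m_def[symmetric] n_def[symmetric] by blast
qed

section \<open>Singular values and rank\<close>

text \<open>
  If \<open>S $$ (i, i)\<close> were positive, so would be the \<open>i\<close> values before it. But the right factor, having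
  only \<open>q \<le> i\<close> rows, annihilates some nonzero combination of the first \<open>i + 1\<close> right singular vectors,
  which \<open>M\<close> would not.
\<close>
lemma svd_vanishes_beyond_factorisation:
  assumes svd: "is_svd M U S V" and M: "M \<in> carrier_mat m n"
    and fac: "factors_through M q" and q: "q \<le> i" "i < min m n"
  shows "S $$ (i, i) = 0"
proof (rule ccontr)
  assume nz: "S $$ (i, i) \<noteq> 0"
  note * = is_svdD[OF svd M]
  have pos: "0 < S $$ (j, j)" if "j \<le> i" for j
    using nz *(10)[OF q(2)] *(11)[OF q(2) that] by linarith
  from fac obtain X Y where XY: "X \<in> carrier_mat m q" "Y \<in> carrier_mat q n" "M = X * Y"
    unfolding factors_through_def using M by auto
  define Z where "Z = Matrix.mat q (Suc i) (\<lambda>(a, b). (Y * V) $$ (a, b))"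
  have Z: "Z \<in> carrier_mat q (Suc i)" by (simp add: Z_def)
  obtain v where v: "v \<in> carrier_vec (Suc i)" "v \<noteq> 0\<^sub>v (Suc i)" "Z *\<^sub>v v = 0\<^sub>v q"
    using wide_matrix_kernel[OF Z] q by (metis le_imp_less_Suc)
  (* v padded with zeros, so that Y * V annihilates it *)
  define w where "w = vec n (\<lambda>j. if j \<le> i then v $ j else 0)"
  have w: "w \<in> carrier_vec n" by (simp add: w_def)
  have w_sum: "(A *\<^sub>v w) $ a = (\<Sum>b<Suc i. A $$ (a, b) * v $ b)"
    if "A \<in> carrier_mat k n" "a < k" for A :: "real mat" and k a
  proof -
    have "(A *\<^sub>v w) $ a = (\<Sum>b<n. A $$ (a, b) * w $ b)"
      using that by (simp add: scalar_prod_def w_def atLeast0LessThan)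
    also have "\<dots> = (\<Sum>b<Suc i. A $$ (a, b) * w $ b)"
      using q by (intro sum.mono_neutral_right) (auto simp: w_def)
    also have "\<dots> = (\<Sum>b<Suc i. A $$ (a, b) * v $ b)"
      using q by (intro sum.cong) (auto simp: w_def)
    finally show ?thesis .
  qed
  have YVw: "(Y * V) *\<^sub>v w = 0\<^sub>v q"
  proof (rule eq_vecI)
    fix a assume "a < dim_vec (0\<^sub>v q :: real vec)"
    hence a: "a < q" by simp
    have YV: "Y * V \<in> carrier_mat q n" using XY * by simp
    have "((Y * V) *\<^sub>v w) $ a = (\<Sum>b<Suc i. Z $$ (a, b) * v $ b)"
      unfolding w_sum[OF YV a] using a by (intro sum.cong) (auto simp: Z_def)
    also have "\<dots> = (Z *\<^sub>v v) $ a"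
      using a Z v(1) by (simp add: scalar_prod_def atLeast0LessThan del: sum.lessThan_Suc)
    finally show "((Y * V) *\<^sub>v w) $ a = 0\<^sub>v q $ a" using v by simp
  qed (use XY in simp)
  have "M *\<^sub>v (V *\<^sub>v w) = X *\<^sub>v ((Y * V) *\<^sub>v w)"
    using XY * w assoc_mult_mat_vec[of X m q Y n "V *\<^sub>v w"] assoc_mult_mat_vec[of Y q n V n w] by simp
  also have "\<dots> = 0\<^sub>v m" using YVw XY by simp
  finally have 1: "M *\<^sub>v (V *\<^sub>v w) = 0\<^sub>v m" .
  have VVw: "V\<^sup>T *\<^sub>v (V *\<^sub>v w) = w"
    using assoc_mult_mat_vec[of "V\<^sup>T" n n V n w] * w by simp
  have "M *\<^sub>v (V *\<^sub>v w) = (U * S) *\<^sub>v (V\<^sup>T *\<^sub>v (V *\<^sub>v w))"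
    using assoc_mult_mat_vec[of "U * S" m n "V\<^sup>T" n "V *\<^sub>v w"] * w by simp
  also have "\<dots> = U *\<^sub>v (S *\<^sub>v w)"
    using VVw assoc_mult_mat_vec[of U m m S n w] * w by simp
  finally have "euclid_norm (S *\<^sub>v w) = euclid_norm (0\<^sub>v m :: real vec)"
    using 1 euclid_norm_isometry[of U m m "S *\<^sub>v w"] * w by simp
  hence Sw: "S *\<^sub>v w = 0\<^sub>v m"
    using euclid_norm_eq_0[of "S *\<^sub>v w" m] *(7) w by (simp add: euclid_norm_def)
  have "v $ j = 0" if j: "j \<le> i" for j
  proof -
    have "0 = (S *\<^sub>v w) $ j" using Sw j q by simp
    also have "\<dots> = (\<Sum>b<Suc i. S $$ (j, b) * v $ b)" using w_sum[OF *(7), of j] j q by simp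
    also have "\<dots> = (\<Sum>b<Suc i. if b = j then S $$ (j, j) * v $ j else 0)"
      using *(9)[of j] j q by (intro sum.cong) auto
    also have "\<dots> = S $$ (j, j) * v $ j" using j by simp
    finally show ?thesis using pos[OF j] by simp
  qed
  hence "v = 0\<^sub>v (Suc i)" using v by (intro eq_vecI) auto
  with v show False by simp
qed

text \<open>
  The rows of \<open>S * V\<^sup>T\<close> from \<open>q\<close> on vanish, so that only the first \<open>q\<close> columns of \<open>U\<close> contribute to
  \<open>M = U * (S * V\<^sup>T)\<close>.
\<close>
lemma leading_cols_projection:
  assumes svd: "is_svd M U S V" and M: "M \<in> carrier_mat m n" and "q \<le> m"
    and zero: "\<And>i. q \<le> i \<Longrightarrow> i < min m n \<Longrightarrow> S $$ (i, i) = 0"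
  shows "M = leading_cols U q * ((leading_cols U q)\<^sup>T * M)"
proof -
  note * = is_svdD[OF svd M]
  define L where "L = leading_cols U q"
  define T where "T = S * V\<^sup>T"
  have L: "L \<in> carrier_mat m q" using * by (simp add: L_def leading_cols_carrier)
  have T: "T \<in> carrier_mat m n" using * by (simp add: T_def)
  have MT: "M = U * T" using * by (simp add: T_def assoc_mult_mat[of U m m S n "V\<^sup>T" n])
  have Tz: "T $$ (i, j) = 0" if "q \<le> i" "i < m" "j < n" for i j
  proof -
    have "S $$ (i, l) = 0" if "l < n" for l
      using zero[of i] *(9)[of i l] \<open>q \<le> i\<close> \<open>i < m\<close> that by (cases "i = l") auto
    thus ?thesis using * that by (simp add: T_def scalar_prod_def)
  qed
  have LM: "(L\<^sup>T * M) $$ (i, j) = T $$ (i, j)" if "i < q" "j < n" for i j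
  proof -
    define P where "P = L\<^sup>T * U"
    have P: "P \<in> carrier_mat q m" using L *(1) by (simp add: P_def)
    have "L\<^sup>T * M = P * T" unfolding MT P_def using L T *(1) by (intro assoc_mult_mat[symmetric]) auto
    hence "(L\<^sup>T * M) $$ (i, j) = (\<Sum>l<m. P $$ (i, l) * T $$ (l, j))"
      using P T that by (simp add: scalar_prod_def atLeast0LessThan)
    also have "\<dots> = (\<Sum>l<m. if l = i then T $$ (i, j) else 0)"
      using leading_cols_cross[OF *(1,2) \<open>q \<le> m\<close> that(1)]
      by (intro sum.cong) (auto simp: P_def L_def simp del: index_mult_mat(1))
    finally show ?thesis using that \<open>q \<le> m\<close> by simp
  qed
  show ?thesis unfolding L_def[symmetric]
  proof (rule eq_matI)
    fix i j assume "i < dim_row (L * (L\<^sup>T * M))" "j < dim_col (L * (L\<^sup>T * M))"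
    hence ij: "i < m" "j < n" using L M by auto
    have "M $$ (i, j) = (\<Sum>l<m. U $$ (i, l) * T $$ (l, j))"
      using ij T *(1) by (simp add: MT scalar_prod_def atLeast0LessThan)
    also have "\<dots> = (\<Sum>l<q. U $$ (i, l) * T $$ (l, j))"
      using Tz ij \<open>q \<le> m\<close> by (intro sum.mono_neutral_right) auto
    also have "\<dots> = (\<Sum>l<q. L $$ (i, l) * (L\<^sup>T * M) $$ (l, j))"
      using LM ij * by (intro sum.cong) (auto simp: L_def leading_cols_def simp del: index_mult_mat(1))
    also have "\<dots> = (L * (L\<^sup>T * M)) $$ (i, j)"
      using L M ij by (simp add: scalar_prod_def[of "row L i"] atLeast0LessThan)
    finally show "M $$ (i, j) = (L * (L\<^sup>T * M)) $$ (i, j)" .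
  qed (use L M in auto)
qed

text \<open>
  If the \<open>q\<close>-th singular value vanished, \<open>M\<close> would factor through \<open>q - 1\<close>.
\<close>
lemma singular_value_pos_of_minimal:
  assumes svd: "is_svd M U S V" and M: "M \<in> carrier_mat m n"
    and fac: "factors_through M q" and min: "\<And>q'. factors_through M q' \<Longrightarrow> q \<le> q'" and "0 < q"
  shows "q \<le> min m n" "0 < S $$ (q - 1, q - 1)"
proof -
  show q: "q \<le> min m n" using min factors_through_self[of M] M by auto
  note * = is_svdD[OF svd M]
  show "0 < S $$ (q - 1, q - 1)"
  proof (rule ccontr)
    assume "\<not> ?thesis"
    moreover have "q - 1 < min m n" using q \<open>0 < q\<close> by arith
    ultimately have z: "S $$ (q - 1, q - 1) = 0" using *(10)[of "q - 1"] by linarith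
    have "S $$ (i, i) = 0" if "q - 1 \<le> i" "i < min m n" for i
      using *(10)[of i] *(11)[of i "q - 1"] that z by simp
    moreover have "q - 1 \<le> m" using q by arith
    ultimately have "M = leading_cols U (q - 1) * ((leading_cols U (q - 1))\<^sup>T * M)"
      using leading_cols_projection[OF svd M] by blast
    hence "factors_through M (q - 1)" unfolding factors_through_def
      using M leading_cols_carrier[OF *(1), of "q - 1"]
      by (intro exI[of _ "leading_cols U (q - 1)"] exI[of _ "(leading_cols U (q - 1))\<^sup>T * M"]) auto
    from min[OF this] \<open>0 < q\<close> show False by simp
  qed
qed

text \<open>
  The \<open>j\<close>-th left singular vector is the image of the \<open>j\<close>-th right one, divided by the singular value.
\<close>
lemma leading_cols_in_range:
  assumes svd: "is_svd M U S V" and M: "M \<in> carrier_mat m n" and q: "q \<le> min m n"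
    and pos: "\<And>j. j < q \<Longrightarrow> 0 < S $$ (j, j)"
  obtains Z where "Z \<in> carrier_mat n q" "leading_cols U q = M * Z"
proof -
  note * = is_svdD[OF svd M]
  define W where "W = Matrix.mat n q (\<lambda>(i, j). if i = j then 1 / S $$ (j, j) else 0)"
  define J where "J = Matrix.mat m q (\<lambda>(i, j). if i = j then 1 else (0::real))"
  have W: "W \<in> carrier_mat n q" and J: "J \<in> carrier_mat m q" by (auto simp: W_def J_def)
  have SW: "S * W = J"
  proof (rule eq_matI)
    fix i j assume "i < dim_row J" "j < dim_col J"
    hence ij: "i < m" "j < q" using J by auto
    have "(S * W) $$ (i, j) = (\<Sum>l<n. S $$ (i, l) * W $$ (l, j))"
      using *(7) W ij by (simp add: scalar_prod_def atLeast0LessThan)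
    also have "\<dots> = (\<Sum>l<n. if l = j then S $$ (i, j) / S $$ (j, j) else 0)"
      using ij by (intro sum.cong) (auto simp: W_def)
    also have "\<dots> = S $$ (i, j) / S $$ (j, j)" using ij q by simp
    also have "\<dots> = J $$ (i, j)" using ij q pos[of j] *(9)[of i j] by (auto simp: J_def)
    finally show "(S * W) $$ (i, j) = J $$ (i, j)" .
  qed (use *(7) W J in auto)
  have UJ: "U * J = leading_cols U q"
  proof (rule eq_matI)
    fix i j assume "i < dim_row (leading_cols U q)" "j < dim_col (leading_cols U q)"
    hence ij: "i < m" "j < q" using *(1) by (auto simp: leading_cols_def)
    have "(U * J) $$ (i, j) = (\<Sum>l<m. U $$ (i, l) * J $$ (l, j))"
      using *(1) J ij by (simp add: scalar_prod_def atLeast0LessThan)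
    also have "\<dots> = (\<Sum>l<m. if l = j then U $$ (i, j) else 0)"
      using ij by (intro sum.cong) (auto simp: J_def)
    also have "\<dots> = leading_cols U q $$ (i, j)" using ij q *(1) by (simp add: leading_cols_def)
    finally show "(U * J) $$ (i, j) = leading_cols U q $$ (i, j)" .
  qed (use *(1) J in \<open>auto simp: leading_cols_def\<close>)
  have VW: "V * W \<in> carrier_mat n q" using *(4) W by simp
  have "V\<^sup>T * (V * W) = W"
    using assoc_mult_mat[of "V\<^sup>T" n n V n W q] *(4,5) W by simp
  hence "U * S * V\<^sup>T * (V * W) = U * S * W"
    using assoc_mult_mat[of "U * S" m n "V\<^sup>T" n "V * W" q] *(1,4,7) VW by simp
  also have "\<dots> = U * (S * W)" using *(1,7) W by (intro assoc_mult_mat) auto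
  finally have "leading_cols U q = M * (V * W)" using SW UJ *(8) by simp
  thus ?thesis using that VW by blast
qed

text \<open>
  The decomposition that provides the singular value need not be the one that provides a basis of the
  column space. For this reason the bound is stated for all vectors \<open>M z\<close> of the column space.
\<close>
lemma singular_value_lower_bound:
  assumes svd: "is_svd M U S V" and M: "M \<in> carrier_mat m n" and q: "0 < q" "q \<le> min m n"
    and zero: "\<And>i. q \<le> i \<Longrightarrow> i < min m n \<Longrightarrow> S $$ (i, i) = 0" and z: "z \<in> carrier_vec n"
  shows "S $$ (q - 1, q - 1) * euclid_norm (M *\<^sub>v z) \<le> euclid_norm (M\<^sup>T *\<^sub>v (M *\<^sub>v z))"
proof -
  note * = is_svdD[OF svd M]
  let ?c = "S $$ (q - 1, q - 1)"
  define w where "w = S *\<^sub>v (V\<^sup>T *\<^sub>v z)"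
  have w: "w \<in> carrier_vec m" using * z by (simp add: w_def)
  have Mz: "M *\<^sub>v z = U *\<^sub>v w"
    using * z assoc_mult_mat_vec[of "U * S" m n "V\<^sup>T" n z] assoc_mult_mat_vec[of U m m S n "V\<^sup>T *\<^sub>v z"]
    by (simp add: w_def)
  have wz: "w $ i = 0" if "q \<le> i" "i < m" for i
  proof -
    have "S $$ (i, l) = 0" if "l < n" for l
      using zero[of i] *(9)[of i l] \<open>q \<le> i\<close> \<open>i < m\<close> that by (cases "i = l") auto
    thus ?thesis using * that z by (simp add: w_def scalar_prod_def)
  qed
  have "M\<^sup>T = V * (S\<^sup>T * U\<^sup>T)"
    using * transpose_mult[of "U * S" m n "V\<^sup>T" n] transpose_mult[of U m m S n] by simp
  hence "M\<^sup>T *\<^sub>v (M *\<^sub>v z) = V *\<^sub>v ((S\<^sup>T * U\<^sup>T) *\<^sub>v (U *\<^sub>v w))"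
    using *(1,4,7) w assoc_mult_mat_vec[of V n n "S\<^sup>T * U\<^sup>T" m "U *\<^sub>v w"] by (simp add: Mz)
  also have "(S\<^sup>T * U\<^sup>T) *\<^sub>v (U *\<^sub>v w) = S\<^sup>T *\<^sub>v w"
    using assoc_mult_mat_vec[of "S\<^sup>T" n m "U\<^sup>T" m "U *\<^sub>v w"] assoc_mult_mat_vec[of "U\<^sup>T" m m U m w] * w by simp
  finally have 1: "euclid_norm (M\<^sup>T *\<^sub>v (M *\<^sub>v z)) = euclid_norm (S\<^sup>T *\<^sub>v w)"
    using euclid_norm_isometry[of V n n "S\<^sup>T *\<^sub>v w"] * w by simp
  have 2: "euclid_norm (M *\<^sub>v z) = euclid_norm w"
    using euclid_norm_isometry[OF *(1,2) w] by (simp add: Mz)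
  have Sj: "(S\<^sup>T *\<^sub>v w) $ j = S $$ (j, j) * w $ j" if "j < min m n" for j
  proof -
    have "(S\<^sup>T *\<^sub>v w) $ j = (\<Sum>i<m. S $$ (i, j) * w $ i)"
      using * w that by (simp add: scalar_prod_def atLeast0LessThan)
    also have "\<dots> = (\<Sum>i<m. if i = j then S $$ (j, j) * w $ j else 0)"
      using *(9)[of _ j] that by (intro sum.cong) auto
    finally show ?thesis using that by simp
  qed
  have "q - 1 < min m n" using q by arith
  hence c: "0 \<le> ?c" by (rule *(10))
  have "?c * euclid_norm w \<le> euclid_norm (S\<^sup>T *\<^sub>v w)"
  proof (rule power2_le_imp_le)
    have "(?c * euclid_norm w)\<^sup>2 = (\<Sum>i<m. ?c\<^sup>2 * (w $ i)\<^sup>2)"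
      using w by (simp add: power_mult_distrib euclid_norm_sq_sum sum_distrib_left)
    also have "\<dots> = (\<Sum>i<q. ?c\<^sup>2 * (w $ i)\<^sup>2)"
      using wz q by (intro sum.mono_neutral_right) auto
    also have "\<dots> \<le> (\<Sum>i<q. ((S\<^sup>T *\<^sub>v w) $ i)\<^sup>2)"
    proof (rule sum_mono)
      fix i assume "i \<in> {..<q}"
      hence "i \<le> q - 1" "i < min m n" using q by auto
      hence "?c \<le> S $$ (i, i)" "(S\<^sup>T *\<^sub>v w) $ i = S $$ (i, i) * w $ i"
        using *(11)[OF \<open>q - 1 < min m n\<close>] Sj by auto
      thus "?c\<^sup>2 * (w $ i)\<^sup>2 \<le> ((S\<^sup>T *\<^sub>v w) $ i)\<^sup>2"
        using c by (simp add: power_mult_distrib mult_right_mono power_mono)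
    qed
    also have "\<dots> \<le> (\<Sum>i<n. ((S\<^sup>T *\<^sub>v w) $ i)\<^sup>2)"
      using q by (intro sum_mono2) auto
    also have "\<dots> = (euclid_norm (S\<^sup>T *\<^sub>v w))\<^sup>2"
      using * by (simp add: euclid_norm_sq_sum)
    finally show "(?c * euclid_norm w)\<^sup>2 \<le> (euclid_norm (S\<^sup>T *\<^sub>v w))\<^sup>2" .
  qed (rule euclid_norm_nonneg)
  thus ?thesis using 1 2 by simp
qed

section \<open>Spectral norm and pseudoinverse\<close>

text \<open>
  The supremum in the spectral norm is taken over a nonempty set that is bounded by the Frobenius norm.
\<close>
lemma spectral_norm_set:
  assumes "A \<in> carrier_mat m n"
  defines "Z \<equiv> {euclid_norm (A *\<^sub>v v) |v. v \<in> carrier_vec (dim_col A) \<and> euclid_norm v \<le> 1}"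
  shows "Z \<noteq> {}" "bdd_above Z" "0 \<in> Z"
proof -
  have "euclid_norm (A *\<^sub>v 0\<^sub>v (dim_col A)) \<in> Z"
    unfolding Z_def by (intro CollectI exI[of _ "0\<^sub>v (dim_col A)"]) (simp add: euclid_norm_def)
  moreover have "A *\<^sub>v 0\<^sub>v (dim_col A) = 0\<^sub>v m" using assms(1) by (intro eq_vecI) auto
  ultimately show "0 \<in> Z" by (simp add: euclid_norm_def)
  thus "Z \<noteq> {}" by blast
  show "bdd_above Z"
  proof (rule bdd_aboveI[of _ "fnorm A"])
    fix x assume "x \<in> Z"
    then obtain v where v: "x = euclid_norm (A *\<^sub>v v)" "v \<in> carrier_vec (dim_col A)" "euclid_norm v \<le> 1"
      unfolding Z_def by blast
    have "x \<le> fnorm A * euclid_norm v" using v euclid_norm_mult_mat_vec[of A m n v] assms(1) by simp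
    also have "\<dots> \<le> fnorm A" using v(3) fnorm_nonneg[of A] by (simp add: mult_left_le)
    finally show "x \<le> fnorm A" .
  qed
qed

lemma spectral_norm_nonneg: "0 \<le> spectral_norm A"
  unfolding spectral_norm_def
  using spectral_norm_set[of A "dim_row A" "dim_col A"] by (intro cSup_upper) auto

lemma spectral_norm_bound:
  assumes A: "A \<in> carrier_mat m n" and v: "v \<in> carrier_vec n"
  shows "euclid_norm (A *\<^sub>v v) \<le> spectral_norm A * euclid_norm v"
proof (cases "euclid_norm v = 0")
  case True
  thus ?thesis using euclid_norm_mult_mat_vec[OF A v] by simp
next
  case False
  let ?c = "1 / euclid_norm v"
  have pos: "0 < euclid_norm v" using False euclid_norm_nonneg[of v] by linarith
  have "euclid_norm (A *\<^sub>v (?c \<cdot>\<^sub>v v)) \<le> spectral_norm A"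
    unfolding spectral_norm_def
  proof (rule cSup_upper)
    show "euclid_norm (A *\<^sub>v (?c \<cdot>\<^sub>v v)) \<in> {euclid_norm (A *\<^sub>v v) |v. v \<in> carrier_vec (dim_col A) \<and> euclid_norm v \<le> 1}"
      using A v pos by (intro CollectI exI[of _ "?c \<cdot>\<^sub>v v"]) (simp add: euclid_norm_smult)
  qed (rule spectral_norm_set(2)[OF A])
  also have "A *\<^sub>v (?c \<cdot>\<^sub>v v) = ?c \<cdot>\<^sub>v (A *\<^sub>v v)" by (rule mult_mat_vec[OF A v])
  finally show ?thesis using pos by (simp add: euclid_norm_smult field_simps)
qed

lemma spectral_norm_le:
  assumes A: "A \<in> carrier_mat m n" and "0 \<le> c"
    and b: "\<And>v. v \<in> carrier_vec n \<Longrightarrow> euclid_norm (A *\<^sub>v v) \<le> c * euclid_norm v"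
  shows "spectral_norm A \<le> c"
  unfolding spectral_norm_def
proof (rule cSup_least)
  fix x assume "x \<in> {euclid_norm (A *\<^sub>v v) |v. v \<in> carrier_vec (dim_col A) \<and> euclid_norm v \<le> 1}"
  then obtain v where v: "x = euclid_norm (A *\<^sub>v v)" "v \<in> carrier_vec n" "euclid_norm v \<le> 1"
    using A by auto
  have "x \<le> c * euclid_norm v" using b v by simp
  also have "\<dots> \<le> c" using v(3) \<open>0 \<le> c\<close> by (simp add: mult_left_le)
  finally show "x \<le> c" .
qed (rule spectral_norm_set(1)[OF A])

lemma injective_left_cancel:
  fixes A :: "real mat"
  assumes A: "A \<in> carrier_mat m r" and inj: "\<And>v. v \<in> carrier_vec r \<Longrightarrow> A *\<^sub>v v = 0\<^sub>v m \<Longrightarrow> v = 0\<^sub>v r"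
    and X: "X \<in> carrier_mat r k" and Y: "Y \<in> carrier_mat r k" and eq: "A * X = A * Y"
  shows "X = Y"
proof (rule mat_col_eqI)
  fix j assume "j < dim_col Y"
  hence j: "j < k" using Y by simp
  have cX: "col X j \<in> carrier_vec r" and cY: "col Y j \<in> carrier_vec r" using X Y j by auto
  have "A *\<^sub>v col X j = A *\<^sub>v col Y j"
    using eq col_mult2[OF A X j] col_mult2[OF A Y j] by simp
  hence "A *\<^sub>v (col X j - col Y j) = 0\<^sub>v m"
    using A cX cY by (simp add: mult_minus_distrib_mat_vec[of _ m r])
  hence *: "col X j - col Y j = 0\<^sub>v r" using inj cX cY by simp
  show "col X j = col Y j"
  proof (rule eq_vecI)
    fix i assume "i < dim_vec (col Y j)"
    hence "i < r" using Y by simp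
    hence "(col X j - col Y j) $ i = 0" using * by simp
    thus "col X j $ i = col Y j $ i" using \<open>i < r\<close> Y by simp
  qed (use X Y in simp)
qed (use X Y in auto)

text \<open>
  For injective \<open>A\<close> the matrix \<open>P = (A\<^sup>T * A)\<^sup>-\<^sup>1 * A\<^sup>T\<close> satisfies the four Penrose equations. Any other
  solution \<open>X\<close> is a left inverse of \<open>A\<close> as well, and \<open>A * X = A * P\<close> because each of these symmetric
  matrices absorbs the other; injectivity then gives \<open>X = P\<close>.
\<close>
lemma pseudoinverse_left_inverse:
  assumes A: "A \<in> carrier_mat m r" and inj: "\<And>v. v \<in> carrier_vec r \<Longrightarrow> A *\<^sub>v v = 0\<^sub>v m \<Longrightarrow> v = 0\<^sub>v r"
  shows "pseudoinverse A \<in> carrier_mat r m" "pseudoinverse A * A = 1\<^sub>m r"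
proof -
  let ?G = "A\<^sup>T * A"
  have G: "?G \<in> carrier_mat r r" using A by simp
  have "det ?G \<noteq> 0"
  proof
    assume "det ?G = 0"
    then obtain v where v: "v \<in> carrier_vec r" "v \<noteq> 0\<^sub>v r" "?G *\<^sub>v v = 0\<^sub>v r"
      using det_0_iff_vec_prod_zero_field[OF G] by blast
    have "A\<^sup>T *\<^sub>v (A *\<^sub>v v) = 0\<^sub>v r" using v A assoc_mult_mat_vec[of "A\<^sup>T" r m A r v] by simp
    moreover have "(A\<^sup>T *\<^sub>v (A *\<^sub>v v)) \<bullet> v = (A *\<^sub>v v) \<bullet> (A *\<^sub>v v)"
      using transpose_vec_mult_scalar[OF A v(1), of "A *\<^sub>v v"] A v by simp
    ultimately have "euclid_norm (A *\<^sub>v v) = 0" using v by (simp add: euclid_norm_def)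
    hence "A *\<^sub>v v = 0\<^sub>v m" using euclid_norm_eq_0[of "A *\<^sub>v v" m] A v by simp
    thus False using inj v by blast
  qed
  from det_non_zero_imp_unit[OF G this, of "()"] obtain H where
    H: "H \<in> carrier_mat r r" "H * ?G = 1\<^sub>m r" "?G * H = 1\<^sub>m r"
    unfolding Units_def by (auto simp: ring_mat_simps)
  have GT: "?G\<^sup>T = ?G" using A by (simp add: transpose_mult[of _ r m _ r])
  have HT: "H\<^sup>T = H"
  proof -
    have "H\<^sup>T * ?G = 1\<^sub>m r"
      using transpose_mult[OF G H(1)] H(3) GT by simp
    hence "H\<^sup>T * ?G * H = H" using H by simp
    moreover have "H\<^sup>T * ?G * H = H\<^sup>T * (?G * H)" using H(1) G by (intro assoc_mult_mat[of _ r r _ r _ r]) auto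
    ultimately show ?thesis using H by simp
  qed
  define P where "P = H * A\<^sup>T"
  have P: "P \<in> carrier_mat r m" using H A by (simp add: P_def)
  have PA: "P * A = 1\<^sub>m r" using H A assoc_mult_mat[of H r r "A\<^sup>T" m A r] by (simp add: P_def)
  have APT: "(A * P)\<^sup>T = A * P"
  proof -
    have "P\<^sup>T = A * H" using transpose_mult[of H r r "A\<^sup>T" m] H A HT by (simp add: P_def)
    hence "(A * P)\<^sup>T = A * H * A\<^sup>T" using transpose_mult[of A m r P m] A P by simp
    thus ?thesis using assoc_mult_mat[of A m r H r "A\<^sup>T" m] A H by (simp add: P_def)
  qed
  have pP: "is_pseudoinverse A P"
    unfolding is_pseudoinverse_def
    using A P PA APT assoc_mult_mat[of A m r P m A r] by simp
  have uniq: "X = P" if X: "is_pseudoinverse A X" for X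
  proof -
    have Xc: "X \<in> carrier_mat r m" and AXA: "A * X * A = A" and AXT: "(A * X)\<^sup>T = A * X"
      using X A by (auto simp: is_pseudoinverse_def)
    have "A * (P * A) = A * (X * A)"
      using AXA A Xc PA assoc_mult_mat[of A m r X m A r] by simp
    hence XA: "X * A = 1\<^sub>m r"
      using injective_left_cancel[OF A inj, of "P * A" r "X * A"] A P Xc PA by simp
    have AX: "A * X \<in> carrier_mat m m" and AP: "A * P \<in> carrier_mat m m" using A P Xc by auto
    have "A * P * (A * X) = A * X"
      using assoc_mult_mat[of A m r P m "A * X" m] assoc_mult_mat[of P r m A r X m] A P Xc PA by simp
    moreover have "A * X * (A * P) = A * P"
      using assoc_mult_mat[of A m r X m "A * P" m] assoc_mult_mat[of X r m A r P m] A P Xc XA by simp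
    moreover have "(A * P * (A * X))\<^sup>T = A * X * (A * P)"
      using transpose_mult[OF AP AX] AXT APT by simp
    ultimately have "A * X = A * P" using AXT by metis
    thus ?thesis using injective_left_cancel[OF A inj Xc P] by simp
  qed
  have "pseudoinverse A = P" unfolding pseudoinverse_def
    by (rule the_equality[of "is_pseudoinverse A", OF pP uniq])
  thus "pseudoinverse A \<in> carrier_mat r m" "pseudoinverse A * A = 1\<^sub>m r" using P PA by auto
qed

text \<open>
  This is the form in which \<open>c_A\<close> enters: an injective matrix does not shrink vectors by more than the
  norm of its pseudoinverse.
\<close>
lemma pseudoinverse_lower_bound:
  assumes A: "A \<in> carrier_mat m r" and inj: "\<And>v. v \<in> carrier_vec r \<Longrightarrow> A *\<^sub>v v = 0\<^sub>v m \<Longrightarrow> v = 0\<^sub>v r"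
    and v: "v \<in> carrier_vec r"
  shows "euclid_norm v \<le> spectral_norm (pseudoinverse A) * euclid_norm (A *\<^sub>v v)"
proof -
  note P = pseudoinverse_left_inverse[OF A inj]
  have "v = pseudoinverse A *\<^sub>v (A *\<^sub>v v)"
    using assoc_mult_mat_vec[OF P(1) A v] P(2) v by simp
  thus ?thesis using spectral_norm_bound[OF P(1), of "A *\<^sub>v v"] A v by simp
qed

section \<open>Perturbation of least-squares solutions\<close>

lemma frobenius_sq_eq_0:
  assumes "H \<in> carrier_mat m n" "frobenius_sq H = 0"
  shows "H = 0\<^sub>m m n"
proof (rule eq_matI)
  fix i j assume "i < dim_row (0\<^sub>m m n)" "j < dim_col (0\<^sub>m m n)"
  thus "H $$ (i, j) = 0\<^sub>m m n $$ (i, j)"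
    using entry_le_fnorm[OF assms(1), of i j] assms(2) by (simp add: fnorm_def)
qed (use assms in auto)

text \<open>
  The gradient of the squared residual vanishes at a minimum. It is tested by moving from \<open>X\<close> in the
  direction of the gradient itself, \<open>H = A\<^sup>T * (A * X - B)\<close>.
\<close>
lemma least_squares_normal_equation:
  assumes ls: "least_squares A B X" and A: "A \<in> carrier_mat m r" and B: "B \<in> carrier_mat m k"
  shows "X \<in> carrier_mat r k" "A\<^sup>T * (A * X - B) = 0\<^sub>m r k"
proof -
  show X: "X \<in> carrier_mat r k" using ls A B by (simp add: least_squares_def)
  define E where "E = A * X - B"
  define H where "H = A\<^sup>T * E"
  have E: "E \<in> carrier_mat m k" and H: "H \<in> carrier_mat r k" using A X B by (auto simp: E_def H_def)
  define h where "h = frobenius_sq H"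
  define a where "a = frobenius_sq (A * H)"
  have ineq: "2 * t * h \<le> t\<^sup>2 * a" for t
  proof -
    have tH: "t \<cdot>\<^sub>m H \<in> carrier_mat r k" and tAH: "t \<cdot>\<^sub>m (A * H) \<in> carrier_mat m k" using A H by auto
    have "A * (X - t \<cdot>\<^sub>m H) = A * X - t \<cdot>\<^sub>m (A * H)"
      using A X tH H mult_minus_distrib_mat[OF A X tH] mult_smult_distrib[OF A H] by simp
    hence "A * (X - t \<cdot>\<^sub>m H) - B = E - t \<cdot>\<^sub>m (A * H)"
      using A X B H by (intro eq_matI) (auto simp: E_def simp del: index_mult_mat(1))
    moreover have "X - t \<cdot>\<^sub>m H \<in> carrier_mat r k" using tH by simp
    ultimately have "frobenius_sq E \<le> frobenius_sq (E - t \<cdot>\<^sub>m (A * H))"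
      using ls A B by (auto simp: least_squares_def E_def)
    also have "\<dots> = frobenius_sq E - 2 * finner E (t \<cdot>\<^sub>m (A * H)) + frobenius_sq (t \<cdot>\<^sub>m (A * H))"
      by (rule frobenius_sq_diff[OF E tAH])
    also have "finner E (t \<cdot>\<^sub>m (A * H)) = t * finner E (A * H)"
      using E A H by (simp add: finner_def sum_distrib_left mult_ac del: index_mult_mat(1))
    also have "finner E (A * H) = h"
      using finner_commute[OF E, of "A * H"] finner_mult_left[OF A H E] A H by (simp add: h_def H_def[symmetric] finner_self)
    also have "frobenius_sq (t \<cdot>\<^sub>m (A * H)) = t\<^sup>2 * a"
      using fnorm_smult[of t "A * H"] by (metis a_def fnorm_sq power2_abs power_mult_distrib)
    finally show ?thesis by simp
  qed
  have "h = 0"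
  proof (rule ccontr)
    assume "h \<noteq> 0"
    hence h: "0 < h" using frobenius_sq_nonneg[of H] by (simp add: h_def)
    have a: "0 \<le> a" by (simp add: a_def frobenius_sq_nonneg)
    (* near the minimum h / a of t\<^sup>2 * a - 2 * t * h; the 1 covers a = 0 *)
    define t where "t = h / (a + 1)"
    have t: "0 < t" using h a by (simp add: t_def)
    have "t * (2 * h) \<le> t * (t * a)" using ineq[of t] by (simp add: power2_eq_square mult_ac)
    hence "2 * h \<le> t * a" using t by simp
    also have "t * a \<le> h" using h a by (simp add: t_def field_simps)
    finally show False using h by simp
  qed
  thus "A\<^sup>T * (A * X - B) = 0\<^sub>m r k"
    using frobenius_sq_eq_0[OF H] by (simp add: h_def H_def E_def)
qed

text \<open>
  The rotated solution \<open>G' = R\<^sup>T * G * R'\<close> solves the rotated system \<open>(A * R) * G' = B * R'\<close>, from which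
  \<open>Ah\<close> and \<open>Bh\<close> differ by at most \<open>\<gamma>\<close>. By the normal equation the residual of \<open>Gh\<close> is orthogonal to
  the column space of \<open>Ah\<close>, so \<open>Ah * (Gh - G')\<close> is no larger than the residual \<open>Bh - Ah * G'\<close>, which
  is at most \<open>\<gamma> * (1 + g)\<close>. Finally \<open>Ah\<close> inherits from \<open>A\<close> the lower bound \<open>1 / \<kappa> - \<gamma>\<close>.
\<close>
lemma least_squares_perturbation:
  assumes A: "A \<in> carrier_mat m a" and Ah: "Ah \<in> carrier_mat m a" and G: "G \<in> carrier_mat a b"
    and B: "B \<in> carrier_mat m b" and Bh: "Bh \<in> carrier_mat m b"
    and exact: "A * G = B" and ls: "least_squares Ah Bh Gh"
    and \<kappa>: "0 < \<kappa>" "\<And>v. v \<in> carrier_vec a \<Longrightarrow> euclid_norm v \<le> \<kappa> * euclid_norm (A *\<^sub>v v)"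
    and R: "R \<in> orthogonal_group a" and R': "R' \<in> orthogonal_group b"
    and dA: "fnorm (Ah - A * R) \<le> \<gamma>" and dB: "fnorm (Bh - B * R') \<le> \<gamma>"
    and g: "\<And>v. v \<in> carrier_vec b \<Longrightarrow> euclid_norm (G *\<^sub>v v) \<le> g * euclid_norm v"
    and v: "v \<in> carrier_vec b"
  shows "(1 / \<kappa> - \<gamma>) * euclid_norm ((Gh - R\<^sup>T * G * R') *\<^sub>v v) \<le> \<gamma> * (1 + g) * euclid_norm v"
proof -
  have Rc: "R \<in> carrier_mat a a" "R\<^sup>T * R = 1\<^sub>m a" "R * R\<^sup>T = 1\<^sub>m a"
    and R'c: "R' \<in> carrier_mat b b" "R'\<^sup>T * R' = 1\<^sub>m b"
    using R R' by (auto simp: orthogonal_group_def)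
  note ne = least_squares_normal_equation[OF ls Ah Bh]
  define G' where "G' = R\<^sup>T * G * R'"
  have Gh: "Gh \<in> carrier_mat a b" and G': "G' \<in> carrier_mat a b" using ne Rc R'c G by (auto simp: G'_def)
  define y where "y = (Gh - G') *\<^sub>v v"
  have y: "y \<in> carrier_vec a" unfolding y_def using G' v by (intro mult_mat_vec_carrier[of _ a b]) auto
  have \<gamma>: "0 \<le> \<gamma>" using dA fnorm_nonneg[of "Ah - A * R"] by linarith
  have G'v: "euclid_norm (G' *\<^sub>v v) \<le> g * euclid_norm v"
  proof -
    have R'v: "R' *\<^sub>v v \<in> carrier_vec b" using R'c v by simp
    have "G' *\<^sub>v v = R\<^sup>T *\<^sub>v (G *\<^sub>v (R' *\<^sub>v v))"
      using assoc_mult_mat_vec[of "R\<^sup>T * G" a b R' b v] assoc_mult_mat_vec[of "R\<^sup>T" a a G b "R' *\<^sub>v v"] Rc R'c G v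
      by (simp add: G'_def)
    also have "euclid_norm \<dots> = euclid_norm (G *\<^sub>v (R' *\<^sub>v v))"
      using Rc G R'v by (intro euclid_norm_isometry[of "R\<^sup>T" a a]) auto
    also have "\<dots> \<le> g * euclid_norm v"
      using g[OF R'v] euclid_norm_isometry[OF R'c v] by simp
    finally show ?thesis .
  qed
  have ARG: "(A * R) *\<^sub>v (G' *\<^sub>v v) = (B * R') *\<^sub>v v"
  proof -
    have R'v: "R' *\<^sub>v v \<in> carrier_vec b" using R'c v by simp
    have G'v': "G' *\<^sub>v v = R\<^sup>T *\<^sub>v (G *\<^sub>v (R' *\<^sub>v v))"
      using assoc_mult_mat_vec[of "R\<^sup>T * G" a b R' b v] assoc_mult_mat_vec[of "R\<^sup>T" a a G b "R' *\<^sub>v v"] Rc R'c G v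
      by (simp add: G'_def)
    have GR: "G *\<^sub>v (R' *\<^sub>v v) \<in> carrier_vec a" using G R'v by simp
    have "R *\<^sub>v (R\<^sup>T *\<^sub>v (G *\<^sub>v (R' *\<^sub>v v))) = G *\<^sub>v (R' *\<^sub>v v)"
      using assoc_mult_mat_vec[of R a a "R\<^sup>T" a "G *\<^sub>v (R' *\<^sub>v v)"] Rc GR by simp
    hence "(A * R) *\<^sub>v (G' *\<^sub>v v) = A *\<^sub>v (G *\<^sub>v (R' *\<^sub>v v))"
      using assoc_mult_mat_vec[of A m a R a "R\<^sup>T *\<^sub>v (G *\<^sub>v (R' *\<^sub>v v))"] A Rc GR by (simp add: G'v')
    also have "\<dots> = B *\<^sub>v (R' *\<^sub>v v)"
      using assoc_mult_mat_vec[of A m a G b "R' *\<^sub>v v"] A G R'v exact by simp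
    also have "\<dots> = (B * R') *\<^sub>v v"
      using assoc_mult_mat_vec[of B m b R' b v] B R'c v by simp
    finally show ?thesis .
  qed
  define e where "e = Bh *\<^sub>v v - Ah *\<^sub>v (G' *\<^sub>v v)"
  have Ahy: "Ah *\<^sub>v y \<in> carrier_vec m" and e: "e \<in> carrier_vec m" using Ah y Bh G' v by (auto simp: e_def)
  have "(euclid_norm (Ah *\<^sub>v y))\<^sup>2 = (Ah *\<^sub>v y) \<bullet> e"
  proof -
    define z where "z = (Ah * Gh - Bh) *\<^sub>v v"
    have z: "z \<in> carrier_vec m" unfolding z_def using Bh v by (intro mult_mat_vec_carrier[of _ m b]) auto
    have "Ah *\<^sub>v y = z + e"
    proof -
      have "y = Gh *\<^sub>v v - G' *\<^sub>v v" using Gh G' v by (simp add: y_def minus_mult_distrib_mat_vec[of _ a b])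
      hence "Ah *\<^sub>v y = Ah *\<^sub>v (Gh *\<^sub>v v) - Ah *\<^sub>v (G' *\<^sub>v v)"
        using Ah Gh G' v by (simp add: mult_minus_distrib_mat_vec[of _ m a])
      moreover have "z = Ah *\<^sub>v (Gh *\<^sub>v v) - Bh *\<^sub>v v"
        using Ah Gh Bh v assoc_mult_mat_vec[of Ah m a Gh b v]
        by (simp add: z_def minus_mult_distrib_mat_vec[of "Ah * Gh" m b])
      ultimately show ?thesis using Ah Gh G' Bh v by (intro eq_vecI) (auto simp: e_def simp del: index_mult_mat_vec)
    qed
    moreover have "(Ah *\<^sub>v y) \<bullet> z = 0"
    proof -
      have "Ah\<^sup>T *\<^sub>v z = 0\<^sub>v a"
        using assoc_mult_mat_vec[of "Ah\<^sup>T" a m "Ah * Gh - Bh" b v] ne(2) Ah Gh Bh v by (simp add: z_def)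
      hence "(Ah\<^sup>T *\<^sub>v z) \<bullet> y = 0" using y by simp
      thus ?thesis using transpose_vec_mult_scalar[OF Ah y z] comm_scalar_prod[OF Ahy z] by simp
    qed
    ultimately show ?thesis
      using scalar_prod_add_distrib[OF Ahy z e] by (metis add_0 euclid_norm_sq)
  qed
  also have "\<dots> \<le> euclid_norm (Ah *\<^sub>v y) * euclid_norm e"
    by (rule scalar_prod_le_euclid_norm[OF Ahy e])
  finally have 1: "euclid_norm (Ah *\<^sub>v y) \<le> euclid_norm e"
    using euclid_norm_nonneg[of "Ah *\<^sub>v y"] euclid_norm_nonneg[of e]
    by (cases "euclid_norm (Ah *\<^sub>v y) = 0") (auto simp: power2_eq_square)
  have 2: "euclid_norm e \<le> \<gamma> * (1 + g) * euclid_norm v"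
  proof -
    have G'vc: "G' *\<^sub>v v \<in> carrier_vec a" using G' v by simp
    have AR: "A * R \<in> carrier_mat m a" and BR: "B * R' \<in> carrier_mat m b" using A B Rc R'c by auto
    have "e = (Bh - B * R') *\<^sub>v v - (Ah - A * R) *\<^sub>v (G' *\<^sub>v v)"
    proof -
      have "(Bh - B * R') *\<^sub>v v = Bh *\<^sub>v v - (B * R') *\<^sub>v v"
        by (rule minus_mult_distrib_mat_vec[OF Bh BR v])
      moreover have "(Ah - A * R) *\<^sub>v (G' *\<^sub>v v) = Ah *\<^sub>v (G' *\<^sub>v v) - (B * R') *\<^sub>v v"
        using minus_mult_distrib_mat_vec[OF Ah AR G'vc] ARG by simp
      ultimately show ?thesis using Bh B Ah R'c v
        by (intro eq_vecI) (auto simp: e_def simp del: index_mult_mat_vec)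
    qed
    also have "euclid_norm \<dots> \<le> euclid_norm ((Bh - B * R') *\<^sub>v v) + euclid_norm ((Ah - A * R) *\<^sub>v (G' *\<^sub>v v))"
      using AR BR v G'vc
      by (intro euclid_norm_triangle_diff[of _ m] mult_mat_vec_carrier[of _ m b] mult_mat_vec_carrier[of _ m a]) auto
    also have "euclid_norm ((Bh - B * R') *\<^sub>v v) \<le> \<gamma> * euclid_norm v"
      using euclid_norm_mult_mat_vec[of "Bh - B * R'" m b v] BR v dB euclid_norm_nonneg[of v]
      by (simp add: mult_right_mono order_trans)
    also have "euclid_norm ((Ah - A * R) *\<^sub>v (G' *\<^sub>v v)) \<le> \<gamma> * (g * euclid_norm v)"
    proof -
      have "euclid_norm ((Ah - A * R) *\<^sub>v (G' *\<^sub>v v)) \<le> fnorm (Ah - A * R) * euclid_norm (G' *\<^sub>v v)"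
        using euclid_norm_mult_mat_vec[of "Ah - A * R" m a] AR G'vc by simp
      also have "\<dots> \<le> \<gamma> * (g * euclid_norm v)"
        using dA G'v \<gamma> by (intro mult_mono) (auto simp: euclid_norm_nonneg)
      finally show ?thesis .
    qed
    finally show ?thesis by (simp add: algebra_simps)
  qed
  have 3: "(1 / \<kappa> - \<gamma>) * euclid_norm y \<le> euclid_norm (Ah *\<^sub>v y)"
  proof -
    have AR: "A * R \<in> carrier_mat m a" and Ry: "R *\<^sub>v y \<in> carrier_vec a" using A Rc y by auto
    have "euclid_norm y = euclid_norm (R *\<^sub>v y)" using euclid_norm_isometry[OF Rc(1,2) y] by simp
    also have "\<dots> \<le> \<kappa> * euclid_norm (A *\<^sub>v (R *\<^sub>v y))" by (rule \<kappa>(2)[OF Ry])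
    also have "A *\<^sub>v (R *\<^sub>v y) = (A * R) *\<^sub>v y" using assoc_mult_mat_vec[OF A Rc(1) y] by simp
    finally have "euclid_norm y / \<kappa> \<le> euclid_norm ((A * R) *\<^sub>v y)" using \<kappa>(1) by (simp add: field_simps)
    also have "(A * R) *\<^sub>v y = Ah *\<^sub>v y - (Ah - A * R) *\<^sub>v y"
    proof -
      have "(Ah - A * R) *\<^sub>v y = Ah *\<^sub>v y - (A * R) *\<^sub>v y" by (rule minus_mult_distrib_mat_vec[OF Ah AR y])
      thus ?thesis using Ah AR by (intro eq_vecI) (auto simp del: index_mult_mat_vec)
    qed
    also have "euclid_norm \<dots> \<le> euclid_norm (Ah *\<^sub>v y) + euclid_norm ((Ah - A * R) *\<^sub>v y)"
      using Ah AR y by (intro euclid_norm_triangle_diff[of _ m] mult_mat_vec_carrier[of _ m a]) auto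
    also have "euclid_norm ((Ah - A * R) *\<^sub>v y) \<le> \<gamma> * euclid_norm y"
      using euclid_norm_mult_mat_vec[of "Ah - A * R" m a y] AR y dA euclid_norm_nonneg[of y]
      by (simp add: mult_right_mono order_trans)
    finally show ?thesis by (simp add: algebra_simps)
  qed
  from 1 2 3 show ?thesis by (simp add: y_def G'_def)
qed

lemma finite_grid: "finite (grid n d)"
  by (simp add: grid_def finite_PiE)

lemma grid_iff:
  "x \<in> grid n d \<longleftrightarrow> (\<forall>l\<in>{1..d}. x l < n l) \<and> (\<forall>l. l \<notin> {1..d} \<longrightarrow> x l = undefined)"
  unfolding grid_def PiE_iff extensional_def by auto

lemma grid_less: "x \<in> grid n d \<Longrightarrow> l \<in> {1..d} \<Longrightarrow> x l < n l"
  by (simp add: grid_iff)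

section \<open>Conditional independence in Markov densities\<close>

text \<open>
  The path that follows \<open>x\<close> up to time \<open>k\<close> and \<open>y\<close> afterwards.
\<close>
definition glue :: "nat \<Rightarrow> (nat \<Rightarrow> nat) \<Rightarrow> (nat \<Rightarrow> nat) \<Rightarrow> nat \<Rightarrow> nat" where
  "glue k x y = (\<lambda>i. if i \<le> k then x i else y i)"

lemma glue_in_grid: "x \<in> grid n d \<Longrightarrow> y \<in> grid n d \<Longrightarrow> glue k x y \<in> grid n d"
  unfolding grid_iff glue_def by auto

lemma glue_glue: "glue k (glue k x y) (glue k y x) = x"
  by (auto simp: glue_def)

lemma grid_eqI: "x \<in> grid n d \<Longrightarrow> y \<in> grid n d \<Longrightarrow> (\<And>i. i \<in> {1..d} \<Longrightarrow> x i = y i) \<Longrightarrow> x = y"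
  unfolding grid_def by (rule PiE_ext)

text \<open>
  Two paths that meet at time \<open>k\<close> may exchange their futures: the same transition factors occur on both
  sides.
\<close>
lemma markov_exchange:
  assumes "markov_density n d p" and xy: "x \<in> grid n d" "y \<in> grid n d"
    and k: "k \<in> {1..d}" and eq: "x k = y k"
  shows "p (glue k x y) * p (glue k y x) = p x * p y"
proof -
  let ?T = "\<lambda>j x. transition n d p j (x j) (x (j + 1))"
  have fac: "p z = marg1 n d p 1 (z 1) * (\<Prod>j\<in>{1..<d}. ?T j z)" if "z \<in> grid n d" for z
    using assms(1) that by (auto simp: markov_density_def)
  have "?T j (glue k x y) * ?T j (glue k y x) = ?T j x * ?T j y" for j
  proof (cases "j < k")
    case True
    thus ?thesis by (simp add: glue_def)
  next
    case False
    hence "glue k x y j = y j" "glue k y x j = x j" "glue k x y (j + 1) = y (j + 1)" "glue k y x (j + 1) = x (j + 1)"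
      using eq by (cases "j = k", auto simp: glue_def)+
    thus ?thesis by simp
  qed
  hence "(\<Prod>j\<in>{1..<d}. ?T j (glue k x y)) * (\<Prod>j\<in>{1..<d}. ?T j (glue k y x))
      = (\<Prod>j\<in>{1..<d}. ?T j x) * (\<Prod>j\<in>{1..<d}. ?T j y)"
    by (simp only: prod.distrib[symmetric])
  moreover have "glue k x y 1 = x 1" "glue k y x 1 = y 1" using k by (auto simp: glue_def)
  ultimately show ?thesis
    using fac[OF xy(1)] fac[OF xy(2)] fac[OF glue_in_grid[OF xy]] fac[OF glue_in_grid[OF xy(2,1)]]
    by (simp add: mult_ac)
qed

text \<open>
  Independence of past and future given the present, free of divisions. Exchanging futures is an
  involution that turns a pair of paths, the first with properties \<open>P\<close> and \<open>Q\<close>, into a pair whose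
  first path has \<open>P\<close> and whose second path has \<open>Q\<close>; it preserves the product of the probabilities.
\<close>
lemma markov_conditional_independence:
  assumes p: "markov_density n d p" and k: "k \<in> {1..d}"
    and P: "\<And>x y. (\<And>i. i \<in> {1..k} \<Longrightarrow> x i = y i) \<Longrightarrow> P x = P y"
    and Q: "\<And>x y. (\<And>i. i \<in> {k..d} \<Longrightarrow> x i = y i) \<Longrightarrow> Q x = Q y"
  shows "(\<Sum>x\<in>{x \<in> grid n d. x k = b \<and> P x \<and> Q x}. p x) * (\<Sum>x\<in>{x \<in> grid n d. x k = b}. p x)
       = (\<Sum>x\<in>{x \<in> grid n d. x k = b \<and> P x}. p x) * (\<Sum>x\<in>{x \<in> grid n d. x k = b \<and> Q x}. p x)"
proof -
  have Pg: "P (glue k x y) = P x" for x y by (rule P) (simp add: glue_def)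
  have Qg: "Q (glue k x y) = Q y" if "x k = y k" for x y
    by (rule Q) (use that in \<open>auto simp: glue_def\<close>)
  (* the exchange of futures, its own inverse on pairs of paths that meet at time k *)
  let ?h = "\<lambda>(x, y). (glue k x y, glue k y x)"
  have "(\<Sum>z\<in>{x \<in> grid n d. x k = b \<and> P x \<and> Q x} \<times> {x \<in> grid n d. x k = b}. p (fst z) * p (snd z))
      = (\<Sum>z\<in>{x \<in> grid n d. x k = b \<and> P x} \<times> {x \<in> grid n d. x k = b \<and> Q x}. p (fst z) * p (snd z))"
  proof (rule sum.reindex_bij_witness[of _ ?h ?h])
    fix z assume "z \<in> {x \<in> grid n d. x k = b \<and> P x \<and> Q x} \<times> {x \<in> grid n d. x k = b}"
    then obtain x y where z: "z = (x, y)" "x \<in> grid n d" "x k = b" "P x" "Q x" "y \<in> grid n d" "y k = b" by auto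
    show "?h (?h z) = z" by (simp add: z(1) glue_glue)
    show "?h z \<in> {x \<in> grid n d. x k = b \<and> P x} \<times> {x \<in> grid n d. x k = b \<and> Q x}"
      using z Pg[of x y] Qg[of y x] by (auto simp: glue_in_grid) (auto simp: glue_def)
    show "p (fst (?h z)) * p (snd (?h z)) = p (fst z) * p (snd z)"
      using markov_exchange[OF p z(2,6) k] z by simp
  next
    fix z assume "z \<in> {x \<in> grid n d. x k = b \<and> P x} \<times> {x \<in> grid n d. x k = b \<and> Q x}"
    then obtain x y where z: "z = (x, y)" "x \<in> grid n d" "x k = b" "P x" "Q y" "y \<in> grid n d" "y k = b" by auto
    show "?h (?h z) = z" by (simp add: z(1) glue_glue)
    show "?h z \<in> {x \<in> grid n d. x k = b \<and> P x \<and> Q x} \<times> {x \<in> grid n d. x k = b}"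
      using z Pg[of x y] Qg[of x y] by (auto simp: glue_in_grid) (auto simp: glue_def)
  qed
  thus ?thesis by (simp add: sum_product sum.cartesian_product case_prod_beta)
qed

lemma marginal_mono:
  assumes "markov_density n d p" "A \<subseteq> B" "B \<subseteq> grid n d"
  shows "sum p A \<le> sum p B" "0 \<le> sum p A"
  using assms finite_subset[OF assms(3) finite_grid]
  by (auto simp: markov_density_def intro!: sum_mono2 sum_nonneg)

text \<open>
  Where the state \<open>b\<close> has probability 0 both sides are 0, in view of \<open>x / 0 = 0\<close>.
\<close>
lemma marg3_markov:
  assumes p: "markov_density n d p" and k: "k \<in> {2..d-1}"
  shows "marg3 n d p k a b c = marg2 n d p (k - 1) a b / marg1 n d p k b * marg2 n d p k b c"
proof -
  have eq: "marg3 n d p k a b c * marg1 n d p k b = marg2 n d p (k - 1) a b * marg2 n d p k b c"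
  proof -
    have "k \<in> {1..d}" using k by auto
    hence "(\<Sum>x\<in>{x \<in> grid n d. x k = b \<and> x (k - 1) = a \<and> x (k + 1) = c}. p x) * marg1 n d p k b
      = (\<Sum>x\<in>{x \<in> grid n d. x k = b \<and> x (k - 1) = a}. p x) * (\<Sum>x\<in>{x \<in> grid n d. x k = b \<and> x (k + 1) = c}. p x)"
      unfolding marg1_def using k
      by (intro markov_conditional_independence[OF p, of k "\<lambda>x. x (k - 1) = a" "\<lambda>x. x (k + 1) = c" b]) auto
    moreover have "k - 1 + 1 = k" using k by auto
    moreover have "{x \<in> grid n d. x k = b \<and> x (k - 1) = a \<and> x (k + 1) = c} = {x \<in> grid n d. x (k - 1) = a \<and> x k = b \<and> x (k + 1) = c}"
      "{x \<in> grid n d. x k = b \<and> x (k - 1) = a} = {x \<in> grid n d. x (k - 1) = a \<and> x k = b}" by auto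
    ultimately show ?thesis unfolding marg3_def marg2_def by (simp only:)
  qed
  show ?thesis
  proof (cases "marg1 n d p k b = 0")
    case True
    have "marg3 n d p k a b c \<le> marg1 n d p k b" "0 \<le> marg3 n d p k a b c"
      unfolding marg3_def marg1_def by (intro marginal_mono[OF p]; auto)+
    thus ?thesis using True by simp
  next
    case False
    thus ?thesis using eq by (simp add: field_simps)
  qed
qed

lemma sum_marg3_left:
  assumes "k \<in> {2..d-1}"
  shows "(\<Sum>a<n (k - 1). marg3 n d p k a b c) = marg2 n d p k b c"
proof -
  let ?S = "{x \<in> grid n d. x k = b \<and> x (k + 1) = c}"
  have "(\<Sum>a<n (k - 1). \<Sum>x\<in>{x \<in> ?S. x (k - 1) = a}. p x) = sum p ?S"
  proof (rule sum.group)
    have "k - 1 \<in> {1..d}" using assms by auto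
    thus "(\<lambda>x. x (k - 1)) ` ?S \<subseteq> {..<n (k - 1)}" using grid_less by blast
  qed (use finite_grid in auto)
  moreover have "{x \<in> grid n d. x (k - 1) = a \<and> x k = b \<and> x (k + 1) = c} = {x \<in> ?S. x (k - 1) = a}" for a
    by auto
  ultimately show ?thesis by (simp add: marg3_def marg2_def)
qed

section \<open>Flattened multi-indices\<close>

lemma digit_Suc:
  assumes "l \<le> m"
  shows "digit n (Suc m) l i = digit n m l (i div n (Suc m))"
proof -
  have "{l<..Suc m} = insert (Suc m) {l<..m}" using assms by auto
  thus ?thesis by (simp add: digit_def div_mult2_eq)
qed

text \<open>
  By induction on the number of digits: the last one is the remainder modulo \<open>n m\<close>, and the others are
  the digits of the quotient.
\<close>
lemma digits_inject:
  assumes "i < (\<Prod>l\<in>{a..m}. n l)" "i' < (\<Prod>l\<in>{a..m}. n l)"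
    and "\<And>l. l \<in> {a..m} \<Longrightarrow> digit n m l i = digit n m l i'"
  shows "i = i'"
  using assms
proof (induction m arbitrary: i i')
  case 0
  show ?case
  proof (cases "a = 0")
    case True
    thus ?thesis using 0 by (simp add: digit_def)
  next
    case False
    thus ?thesis using 0 by simp
  qed
next
  case (Suc m)
  show ?case
  proof (cases "a \<le> Suc m")
    case True
    let ?N = "n (Suc m)"
    have eq: "{a..Suc m} = insert (Suc m) {a..m}" using True by auto
    have lt: "i < ?N * (\<Prod>l\<in>{a..m}. n l)" "i' < ?N * (\<Prod>l\<in>{a..m}. n l)"
      using Suc.prems(1,2) by (simp_all add: eq)
    have "i div ?N = i' div ?N"
    proof (rule Suc.IH)
      show "i div ?N < (\<Prod>l\<in>{a..m}. n l)" "i' div ?N < (\<Prod>l\<in>{a..m}. n l)"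
        using lt by (simp_all add: less_mult_imp_div_less mult.commute)
      show "digit n m l (i div ?N) = digit n m l (i' div ?N)" if "l \<in> {a..m}" for l
        using Suc.prems(3)[of l] that by (simp add: digit_Suc)
    qed
    moreover have "i mod ?N = i' mod ?N" using Suc.prems(3)[of "Suc m"] True by (simp add: digit_def)
    ultimately show ?thesis by (metis div_mult_mod_eq)
  next
    case False
    thus ?thesis using Suc.prems by simp
  qed
qed

text \<open>
  The point of the grid that belongs to the entry \<open>(i, j)\<close> of the unfolding at bond \<open>k\<close>.
\<close>
definition grid_point :: "(nat \<Rightarrow> nat) \<Rightarrow> nat \<Rightarrow> nat \<Rightarrow> nat \<Rightarrow> nat \<Rightarrow> nat \<Rightarrow> nat" where
  "grid_point n d k i j = (\<lambda>l\<in>{1..d}. if l \<le> k then digit n k l i else digit n d l j)"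

lemma grid_point_in_grid:
  assumes "\<And>l. l \<in> {1..d} \<Longrightarrow> 0 < n l"
  shows "grid_point n d k i j \<in> grid n d"
  using assms by (auto simp: grid_def grid_point_def digit_def)

text \<open>
  Both sides have the same number of elements, so injectivity suffices.
\<close>
lemma bij_betw_grid_point:
  assumes pos: "\<And>l. l \<in> {1..d} \<Longrightarrow> 0 < n l" and k: "k \<le> d"
  shows "bij_betw (\<lambda>(i, j). grid_point n d k i j)
           ({..<(\<Prod>l\<in>{1..k}. n l)} \<times> {..<(\<Prod>l\<in>{k<..d}. n l)}) (grid n d)"
    (is "bij_betw ?f (?I \<times> ?J) _")
proof -
  have inj: "inj_on ?f (?I \<times> ?J)"
  proof (rule inj_onI)
    fix z w assume zw: "z \<in> ?I \<times> ?J" "w \<in> ?I \<times> ?J" and eq: "?f z = ?f w"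
    obtain i j i' j' where z: "z = (i, j)" "w = (i', j')" by (cases z, cases w) auto
    have pt: "grid_point n d k i j l = grid_point n d k i' j' l" for l using eq z by (simp add: fun_eq_iff)
    have "i = i'"
    proof (rule digits_inject)
      show "digit n k l i = digit n k l i'" if "l \<in> {1..k}" for l
        using pt[of l] that k by (simp add: grid_point_def)
    qed (use zw z in auto)
    moreover have "j = j'"
    proof (rule digits_inject[where a = "Suc k" and m = d])
      show "digit n d l j = digit n d l j'" if "l \<in> {Suc k..d}" for l
        using pt[of l] that by (simp add: grid_point_def)
    qed (use zw z in \<open>auto simp: atLeastSucAtMost_greaterThanAtMost\<close>)
    ultimately show "z = w" using z by simp
  qed
  have sub: "?f ` (?I \<times> ?J) \<subseteq> grid n d" using grid_point_in_grid[of d n k] pos by auto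
  have "card (?f ` (?I \<times> ?J)) = (\<Prod>l\<in>{1..k}. n l) * (\<Prod>l\<in>{k<..d}. n l)"
    using inj by (simp add: card_image)
  also have "\<dots> = (\<Prod>l\<in>{1..d}. n l)"
  proof -
    have "{1..d} = {1..k} \<union> {k<..d}" using k by auto
    moreover have "prod n ({1..k} \<union> {k<..d}) = prod n {1..k} * prod n {k<..d}"
      by (rule prod.union_disjoint) auto
    ultimately show ?thesis by simp
  qed
  also have "\<dots> = card (grid n d)" by (simp add: grid_def card_PiE)
  finally have "?f ` (?I \<times> ?J) = grid n d" using card_subset_eq[OF finite_grid sub] by simp
  thus ?thesis using inj by (simp add: bij_betw_def)
qed

section \<open>Equality of the ranks of unfoldings and sketches\<close>

definition pair_marginal :: "(nat \<Rightarrow> nat) \<Rightarrow> nat \<Rightarrow> ((nat \<Rightarrow> nat) \<Rightarrow> real) \<Rightarrow> nat \<Rightarrow> real mat" where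
  "pair_marginal n d p k = Matrix.mat (n k) (n (k + 1)) (\<lambda>(a, b). marg2 n d p k a b)"

lemma pair_marginal_carrier: "pair_marginal n d p k \<in> carrier_mat (n k) (n (k + 1))"
  by (simp add: pair_marginal_def)

lemma markov_states_nonempty:
  assumes "markov_density n d p" "l \<in> {1..d}"
  shows "0 < n l"
proof -
  have "grid n d \<noteq> {}" using assms(1) by (auto simp: markov_density_def)
  then obtain x where "x \<in> grid n d" by blast
  hence "x l < n l" using assms(2) by (auto simp: grid_def PiE_def Pi_def)
  thus ?thesis by simp
qed

text \<open>
  Conditional independence at \<open>k\<close> splits off the past, and at \<open>k + 1\<close> the future. Each point is thus a
  product of a function of \<open>(x 1, \<dots>, x k)\<close>, the pair marginal, and a function of
  \<open>(x (k+1), \<dots>, x d)\<close>, which is a factorisation of the unfolding matrix.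
\<close>
lemma markov_three_factors:
  assumes p: "markov_density n d p" and k: "k \<in> {1..d-1}" and x: "x \<in> grid n d"
  shows "p x = (\<Sum>y\<in>{y \<in> grid n d. \<forall>l\<in>{1..k}. y l = x l}. p y) / marg1 n d p k (x k)
     * marg2 n d p k (x k) (x (k + 1))
     * ((\<Sum>y\<in>{y \<in> grid n d. \<forall>l\<in>{k<..d}. y l = x l}. p y) / marg1 n d p (k + 1) (x (k + 1)))"
proof -
  (* the probabilities of agreeing with x up to time k, from k on, and from k + 1 on *)
  define PL where "PL = (\<Sum>y\<in>{y \<in> grid n d. \<forall>l\<in>{1..k}. y l = x l}. p y)"
  define PM where "PM = (\<Sum>y\<in>{y \<in> grid n d. \<forall>l\<in>{k..d}. y l = x l}. p y)"
  define PR where "PR = (\<Sum>y\<in>{y \<in> grid n d. \<forall>l\<in>{k<..d}. y l = x l}. p y)"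
  have 1: "p x * marg1 n d p k (x k) = PL * PM"
  proof -
    have k': "k \<in> {1..d}" using k by auto
    have "{y \<in> grid n d. y k = x k \<and> (\<forall>l\<in>{1..k}. y l = x l) \<and> (\<forall>l\<in>{k..d}. y l = x l)} = {x}"
    proof (intro equalityI subsetI)
      fix y assume "y \<in> {y \<in> grid n d. y k = x k \<and> (\<forall>l\<in>{1..k}. y l = x l) \<and> (\<forall>l\<in>{k..d}. y l = x l)}"
      hence y: "y \<in> grid n d" "\<forall>l\<in>{1..k}. y l = x l" "\<forall>l\<in>{k..d}. y l = x l" by auto
      have "y l = x l" if "l \<in> {1..d}" for l using that y by (cases "l \<le> k") auto
      hence "y = x" by (rule grid_eqI[OF y(1) x])
      thus "y \<in> {x}" by simp
    qed (use x in auto)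
    moreover have "{y \<in> grid n d. y k = x k \<and> (\<forall>l\<in>{1..k}. y l = x l)} = {y \<in> grid n d. \<forall>l\<in>{1..k}. y l = x l}"
      "{y \<in> grid n d. y k = x k \<and> (\<forall>l\<in>{k..d}. y l = x l)} = {y \<in> grid n d. \<forall>l\<in>{k..d}. y l = x l}"
      using k by auto
    moreover have "(\<Sum>y\<in>{y \<in> grid n d. y k = x k \<and> (\<forall>l\<in>{1..k}. y l = x l) \<and> (\<forall>l\<in>{k..d}. y l = x l)}. p y)
        * (\<Sum>y\<in>{y \<in> grid n d. y k = x k}. p y)
      = (\<Sum>y\<in>{y \<in> grid n d. y k = x k \<and> (\<forall>l\<in>{1..k}. y l = x l)}. p y)
        * (\<Sum>y\<in>{y \<in> grid n d. y k = x k \<and> (\<forall>l\<in>{k..d}. y l = x l)}. p y)"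
      using k by (intro markov_conditional_independence[OF p k']) auto
    ultimately show ?thesis unfolding PL_def PM_def marg1_def by simp
  qed
  have 2: "PM * marg1 n d p (k + 1) (x (k + 1)) = marg2 n d p k (x k) (x (k + 1)) * PR"
  proof -
    have k': "k + 1 \<in> {1..d}" using k by auto
    have "{y \<in> grid n d. y (k + 1) = x (k + 1) \<and> y k = x k \<and> (\<forall>l\<in>{k<..d}. y l = x l)}
        = {y \<in> grid n d. \<forall>l\<in>{k..d}. y l = x l}"
    proof (intro Collect_cong conj_cong refl)
      fix y
      have "{k..d} = insert k {k<..d}" "k + 1 \<in> {k<..d}" using k by auto
      thus "(y (k + 1) = x (k + 1) \<and> y k = x k \<and> (\<forall>l\<in>{k<..d}. y l = x l)) = (\<forall>l\<in>{k..d}. y l = x l)"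
        by auto
    qed
    moreover have "{y \<in> grid n d. y (k + 1) = x (k + 1) \<and> (\<forall>l\<in>{k<..d}. y l = x l)}
        = {y \<in> grid n d. \<forall>l\<in>{k<..d}. y l = x l}" using k by auto
    moreover have "{y \<in> grid n d. y (k + 1) = x (k + 1) \<and> y k = x k}
        = {y \<in> grid n d. y k = x k \<and> y (k + 1) = x (k + 1)}" by auto
    moreover have "(\<Sum>y\<in>{y \<in> grid n d. y (k + 1) = x (k + 1) \<and> y k = x k \<and> (\<forall>l\<in>{k<..d}. y l = x l)}. p y)
        * (\<Sum>y\<in>{y \<in> grid n d. y (k + 1) = x (k + 1)}. p y)
      = (\<Sum>y\<in>{y \<in> grid n d. y (k + 1) = x (k + 1) \<and> y k = x k}. p y)
        * (\<Sum>y\<in>{y \<in> grid n d. y (k + 1) = x (k + 1) \<and> (\<forall>l\<in>{k<..d}. y l = x l)}. p y)"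
      using k by (intro markov_conditional_independence[OF p k']) auto
    ultimately show ?thesis unfolding PM_def PR_def marg1_def marg2_def by (simp only:)
  qed
  have le: "p x \<le> marg1 n d p l (x l)" and nn: "0 \<le> p x" for l
    using marginal_mono[OF p, of "{x}" "{y \<in> grid n d. y l = x l}"] x by (auto simp: marg1_def)
  show ?thesis
  proof (cases "marg1 n d p k (x k) = 0 \<or> marg1 n d p (k + 1) (x (k + 1)) = 0")
    case True
    moreover have "p x = 0" using True le[of k] le[of "k + 1"] nn by auto
    ultimately show ?thesis by auto
  next
    case False
    have "p x = PL * PM / marg1 n d p k (x k)" using 1 False by (simp add: field_simps)
    also have "PM = marg2 n d p k (x k) (x (k + 1)) * PR / marg1 n d p (k + 1) (x (k + 1))"
      using 2 False by (simp add: field_simps)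
    finally show ?thesis unfolding PL_def[symmetric] PR_def[symmetric] by (simp add: mult_ac)
  qed
qed

lemma mat_mult_entry:
  fixes A B :: "real mat"
  assumes "A \<in> carrier_mat m k" "B \<in> carrier_mat k n" "i < m" "j < n"
  shows "(A * B) $$ (i, j) = (\<Sum>l<k. A $$ (i, l) * B $$ (l, j))"
  using assms by (simp add: scalar_prod_def atLeast0LessThan)

lemma mult_diag_sum:
  fixes f g :: "nat \<Rightarrow> real"
  assumes "c < N"
  shows "(\<Sum>a<N. (if a = c then f a else 0) * g a) = f c * g c"
    "(\<Sum>a<N. g a * (if a = c then f a else 0)) = g c * f c"
  using assms by (simp_all add: if_distrib[of "\<lambda>x. x * _"] if_distrib[of "\<lambda>x. _ * x"] cong: if_cong)

lemma unfolding_factors_pair_marginal: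
  assumes p: "markov_density n d p" and k: "k \<in> {1..d-1}"
  obtains L R where "L \<in> carrier_mat (\<Prod>l\<in>{1..k}. n l) (n k)" "R \<in> carrier_mat (n (k + 1)) (\<Prod>l\<in>{k<..d}. n l)"
    "unfolding_matrix n d p k = L * pair_marginal n d p k * R"
proof -
  have pos: "0 < n l" if "l \<in> {1..d}" for l using markov_states_nonempty[OF p that] .
  let ?m1 = "marg1 n d p k" and ?m2 = "marg1 n d p (k + 1)"
  define PL where "PL i = (\<Sum>y\<in>{y \<in> grid n d. \<forall>l\<in>{1..k}. y l = digit n k l i}. p y)" for i
  define PR where "PR j = (\<Sum>y\<in>{y \<in> grid n d. \<forall>l\<in>{k<..d}. y l = digit n d l j}. p y)" for j
  define L where "L = Matrix.mat (\<Prod>l\<in>{1..k}. n l) (n k) (\<lambda>(i, a). if a = digit n k k i then PL i / ?m1 a else 0)"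
  define R where "R = Matrix.mat (n (k + 1)) (\<Prod>l\<in>{k<..d}. n l) (\<lambda>(b, j). if b = digit n d (k + 1) j then PR j / ?m2 b else 0)"
  let ?Q = "pair_marginal n d p k"
  have Q: "?Q \<in> carrier_mat (n k) (n (k + 1))" by (rule pair_marginal_carrier)
  have LR: "L \<in> carrier_mat (\<Prod>l\<in>{1..k}. n l) (n k)" "R \<in> carrier_mat (n (k + 1)) (\<Prod>l\<in>{k<..d}. n l)"
    by (auto simp: L_def R_def)
  have LQ: "L * ?Q \<in> carrier_mat (\<Prod>l\<in>{1..k}. n l) (n (k + 1))" using LR Q by simp
  have "unfolding_matrix n d p k = L * ?Q * R"
  proof (rule eq_matI)
    fix i j assume "i < dim_row (L * ?Q * R)" "j < dim_col (L * ?Q * R)"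
    hence ij: "i < (\<Prod>l\<in>{1..k}. n l)" "j < (\<Prod>l\<in>{k<..d}. n l)" using LR by auto
    let ?a = "digit n k k i" and ?b = "digit n d (k + 1) j"
    let ?x = "grid_point n d k i j"
    have ab: "?a < n k" "?b < n (k + 1)" using pos[of k] pos[of "k + 1"] k by (auto simp: digit_def)
    have LQe: "(L * ?Q) $$ (i, b) = PL i / ?m1 ?a * marg2 n d p k ?a b" if "b < n (k + 1)" for b
    proof -
      have "(L * ?Q) $$ (i, b) = (\<Sum>a<n k. (if a = ?a then PL i / ?m1 a else 0) * marg2 n d p k a b)"
        using LR Q ij that by (simp add: scalar_prod_def atLeast0LessThan L_def pair_marginal_def)
      thus ?thesis using mult_diag_sum(1)[OF ab(1), of "\<lambda>a. PL i / ?m1 a" "\<lambda>a. marg2 n d p k a b"] by simp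
    qed
    have "(L * ?Q * R) $$ (i, j) = (\<Sum>b<n (k + 1). (L * ?Q) $$ (i, b) * R $$ (b, j))"
      by (rule mat_mult_entry[OF LQ LR(2) ij])
    also have "\<dots> = (\<Sum>b<n (k + 1). (PL i / ?m1 ?a * marg2 n d p k ?a b) * (if b = ?b then PR j / ?m2 b else 0))"
      using LQe ij by (intro sum.cong) (auto simp: R_def simp del: index_mult_mat(1))
    also have "\<dots> = PL i / ?m1 ?a * marg2 n d p k ?a ?b * (PR j / ?m2 ?b)"
      using mult_diag_sum(2)[OF ab(2), of "\<lambda>b. PL i / ?m1 ?a * marg2 n d p k ?a b" "\<lambda>b. PR j / ?m2 b"] by simp
    also have "\<dots> = p ?x"
    proof -
      have xk: "?x k = ?a" "?x (k + 1) = ?b" using k by (auto simp: grid_point_def)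
      have "{y \<in> grid n d. \<forall>l\<in>{1..k}. y l = ?x l} = {y \<in> grid n d. \<forall>l\<in>{1..k}. y l = digit n k l i}"
        "{y \<in> grid n d. \<forall>l\<in>{k<..d}. y l = ?x l} = {y \<in> grid n d. \<forall>l\<in>{k<..d}. y l = digit n d l j}"
        using k by (auto simp: grid_point_def)
      thus ?thesis
        using markov_three_factors[OF p k grid_point_in_grid[of d n k i j]] pos unfolding PL_def PR_def xk by simp
    qed
    also have "\<dots> = unfolding_matrix n d p k $$ (i, j)"
      using ij by (simp add: unfolding_matrix_def grid_point_def)
    finally show "unfolding_matrix n d p k $$ (i, j) = (L * ?Q * R) $$ (i, j)" by simp
  qed (use LR in \<open>auto simp: unfolding_matrix_def\<close>)
  thus ?thesis using that LR by blast
qed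

text \<open>
  Marginalisation is multiplication by 0-1 matrices from both sides.
\<close>
lemma pair_marginal_factors_unfolding:
  assumes pos: "\<And>l. l \<in> {1..d} \<Longrightarrow> 0 < n l" and k: "k \<in> {1..d-1}"
  obtains L R where "L \<in> carrier_mat (n k) (\<Prod>l\<in>{1..k}. n l)" "R \<in> carrier_mat (\<Prod>l\<in>{k<..d}. n l) (n (k + 1))"
    "pair_marginal n d p k = L * unfolding_matrix n d p k * R"
proof -
  let ?I = "\<Prod>l\<in>{1..k}. n l" and ?J = "\<Prod>l\<in>{k<..d}. n l" and ?U = "unfolding_matrix n d p k"
  define L where "L = Matrix.mat (n k) ?I (\<lambda>(a, i). if digit n k k i = a then 1 else (0::real))"
  define R where "R = Matrix.mat ?J (n (k + 1)) (\<lambda>(j, b). if digit n d (k + 1) j = b then 1 else (0::real))"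
  have U: "?U \<in> carrier_mat ?I ?J" by (simp add: unfolding_matrix_def)
  have LR: "L \<in> carrier_mat (n k) ?I" "R \<in> carrier_mat ?J (n (k + 1))" by (auto simp: L_def R_def)
  have UR: "?U * R \<in> carrier_mat ?I (n (k + 1))" using U LR by simp
  have "pair_marginal n d p k = L * (?U * R)"
  proof (rule eq_matI)
    fix a b assume "a < dim_row (L * (?U * R))" "b < dim_col (L * (?U * R))"
    hence ab: "a < n k" "b < n (k + 1)" using LR by auto
    have URe: "(?U * R) $$ (i, b) = (\<Sum>j<?J. p (grid_point n d k i j) * (if digit n d (k + 1) j = b then 1 else 0))"
      if "i < ?I" for i
      using U LR ab that
      by (simp add: scalar_prod_def atLeast0LessThan R_def unfolding_matrix_def grid_point_def)
    have "(L * (?U * R)) $$ (a, b) = (\<Sum>i<?I. L $$ (a, i) * (?U * R) $$ (i, b))"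
      by (rule mat_mult_entry[OF LR(1) UR ab])
    also have "\<dots> = (\<Sum>i<?I. \<Sum>j<?J. (if digit n k k i = a then 1 else 0) * (p (grid_point n d k i j) * (if digit n d (k + 1) j = b then 1 else 0)))"
      using ab URe by (intro sum.cong refl) (auto simp: L_def sum_distrib_left simp del: index_mult_mat(1))
    also have "\<dots> = (\<Sum>z\<in>{..<?I} \<times> {..<?J}. (\<lambda>x. if x k = a \<and> x (k + 1) = b then p x else 0) ((\<lambda>(i, j). grid_point n d k i j) z))"
    proof -
      have "grid_point n d k i j k = digit n k k i" "grid_point n d k i j (k + 1) = digit n d (k + 1) j" for i j
      proof -
        have "k \<in> {1..d}" "k + 1 \<in> {1..d}" using k by auto
        thus "grid_point n d k i j k = digit n k k i" "grid_point n d k i j (k + 1) = digit n d (k + 1) j"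
          by (auto simp: grid_point_def)
      qed
      thus ?thesis unfolding sum.cartesian_product by (intro sum.cong) auto
    qed
    also have "\<dots> = (\<Sum>x\<in>grid n d. if x k = a \<and> x (k + 1) = b then p x else 0)"
      using k pos by (intro sum.reindex_bij_betw bij_betw_grid_point) auto
    also have "\<dots> = marg2 n d p k a b"
      unfolding marg2_def using finite_grid by (simp add: sum.inter_filter)
    finally show "pair_marginal n d p k $$ (a, b) = (L * (?U * R)) $$ (a, b)"
      using ab by (simp add: pair_marginal_def)
  qed (use LR in \<open>auto simp: pair_marginal_def\<close>)
  thus ?thesis using that[OF LR] U LR assoc_mult_mat[of L "n k" ?I ?U ?J R "n (k + 1)"] by simp
qed

lemma sketch_first: "k = 1 \<Longrightarrow> sketch n d p k = pair_marginal n d p 1"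
  by (simp add: sketch_def pair_marginal_def numeral_2_eq_2)

lemma sketch_middle_carrier:
  "k \<in> {2..d-1} \<Longrightarrow> sketch n d p k \<in> carrier_mat (n (k - 1) * n k) (n (k + 1))"
  by (auto simp: sketch_def)

lemma pair_index_less: "a < N \<Longrightarrow> b < m \<Longrightarrow> a * m + b < N * (m::nat)"
proof -
  assume "a < N" "b < m"
  hence "a * m + b < Suc a * m" by simp
  also have "Suc a * m \<le> N * m" using \<open>a < N\<close> by (intro mult_le_mono1) simp
  finally show ?thesis .
qed

lemma sum_pair_index:
  fixes f :: "nat \<Rightarrow> 'a :: comm_monoid_add"
  shows "(\<Sum>i<N * m. f i) = (\<Sum>a<N. \<Sum>b<m. f (a * m + b))"
proof -
  have "sum f {a * m..<a * m + m} = (\<Sum>b<m. f (a * m + b))" for a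
    by (rule sum.reindex_bij_witness[of _ "\<lambda>b. a * m + b" "\<lambda>i. i - a * m"]) auto
  thus ?thesis by (simp add: sum.nat_group[symmetric])
qed

lemma sketch_middle_entry:
  assumes "k \<in> {2..d-1}" "a < n (k - 1)" "b < n k" "c < n (k + 1)"
  shows "sketch n d p k $$ (a * n k + b, c) = marg3 n d p k a b c"
  using assms pair_index_less[of a "n (k - 1)" b "n k"] by (auto simp: sketch_def)

lemma factors_through_unfolding_iff:
  assumes p: "markov_density n d p" and k: "k \<in> {1..d-1}"
  shows "factors_through (unfolding_matrix n d p k) q \<longleftrightarrow> factors_through (pair_marginal n d p k) q"
proof -
  have pos: "0 < n l" if "l \<in> {1..d}" for l using markov_states_nonempty[OF p that] .
  let ?Q = "pair_marginal n d p k"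
  have Q: "?Q \<in> carrier_mat (n k) (n (k + 1))" by (rule pair_marginal_carrier)
  show ?thesis
  proof
    assume "factors_through (unfolding_matrix n d p k) q"
    moreover have "unfolding_matrix n d p k \<in> carrier_mat (\<Prod>l\<in>{1..k}. n l) (\<Prod>l\<in>{k<..d}. n l)"
      by (simp add: unfolding_matrix_def)
    moreover obtain L R where "L \<in> carrier_mat (n k) (\<Prod>l\<in>{1..k}. n l)" "R \<in> carrier_mat (\<Prod>l\<in>{k<..d}. n l) (n (k + 1))"
      "?Q = L * unfolding_matrix n d p k * R"
      using pair_marginal_factors_unfolding[of d n k p, OF pos k] by blast
    ultimately show "factors_through ?Q q" using factors_through_mult by metis
  next
    assume "factors_through ?Q q"
    moreover obtain L R where "L \<in> carrier_mat (\<Prod>l\<in>{1..k}. n l) (n k)" "R \<in> carrier_mat (n (k + 1)) (\<Prod>l\<in>{k<..d}. n l)"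
      "unfolding_matrix n d p k = L * ?Q * R"
      using unfolding_factors_pair_marginal[OF p k] by blast
    ultimately show "factors_through (unfolding_matrix n d p k) q" using factors_through_mult Q by metis
  qed
qed

text \<open>
  The sketch arises from the pair marginal by attaching \<open>x (k-1)\<close> with its conditional probability given
  \<open>x k\<close>, and the pair marginal from the sketch by summing over \<open>x (k-1)\<close>.
\<close>
lemma factors_through_sketch_iff:
  assumes p: "markov_density n d p" and k: "k \<in> {1..d-1}"
  shows "factors_through (sketch n d p k) q \<longleftrightarrow> factors_through (pair_marginal n d p k) q"
proof -
  have pos: "0 < n l" if "l \<in> {1..d}" for l using markov_states_nonempty[OF p that] .
  let ?Q = "pair_marginal n d p k"
  have Q: "?Q \<in> carrier_mat (n k) (n (k + 1))" by (rule pair_marginal_carrier)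
  show ?thesis
  proof (cases "k = 1")
    case True
    thus ?thesis by (simp add: sketch_first)
  next
    case False
    hence k2: "k \<in> {2..d-1}" using k by auto
    let ?S = "sketch n d p k" and ?m = "n (k - 1) * n k"
    have S: "?S \<in> carrier_mat ?m (n (k + 1))" by (rule sketch_middle_carrier[OF k2])
    define L where "L = Matrix.mat ?m (n k) (\<lambda>(i, b). if b = i mod n k
        then marg2 n d p (k - 1) (i div n k) b / marg1 n d p k b else 0)"
    define F where "F = Matrix.mat (n k) ?m (\<lambda>(b, i). if i mod n k = b then 1 else (0::real))"
    have L: "L \<in> carrier_mat ?m (n k)" and F: "F \<in> carrier_mat (n k) ?m" by (auto simp: L_def F_def)
    have "?S = L * ?Q"
    proof (rule eq_matI)
      fix i c assume "i < dim_row (L * ?Q)" "c < dim_col (L * ?Q)"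
      hence ic: "i < ?m" "c < n (k + 1)" using L Q by auto
      have "k \<in> {1..d}" using k by auto
      hence b: "i mod n k < n k" using pos by simp
      have "(L * ?Q) $$ (i, c) = (\<Sum>b<n k. (if b = i mod n k
          then marg2 n d p (k - 1) (i div n k) b / marg1 n d p k b else 0) * marg2 n d p k b c)"
        using L Q ic by (simp add: scalar_prod_def atLeast0LessThan L_def pair_marginal_def)
      also have "\<dots> = marg2 n d p (k - 1) (i div n k) (i mod n k) / marg1 n d p k (i mod n k) * marg2 n d p k (i mod n k) c"
        by (rule mult_diag_sum(1)[OF b])
      also have "\<dots> = ?S $$ (i, c)" using marg3_markov[OF p k2] ic k2 by (auto simp: sketch_def)
      finally show "?S $$ (i, c) = (L * ?Q) $$ (i, c)" by simp
    qed (use S L Q in auto)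
    hence SLQ: "?S = L * ?Q * 1\<^sub>m (n (k + 1))" using L Q by simp
    have "?Q = F * ?S"
    proof (rule eq_matI)
      fix b c assume "b < dim_row (F * ?S)" "c < dim_col (F * ?S)"
      hence bc: "b < n k" "c < n (k + 1)" using F S by auto
      have "(F * ?S) $$ (b, c) = (\<Sum>i<n (k - 1) * n k. (if i mod n k = b then 1 else 0) * ?S $$ (i, c))"
        using F S bc by (simp add: scalar_prod_def atLeast0LessThan F_def)
      also have "\<dots> = (\<Sum>a<n (k - 1). \<Sum>b'<n k. (if b' = b then 1 else 0) * ?S $$ (a * n k + b', c))"
        by (simp add: sum_pair_index)
      also have "\<dots> = (\<Sum>a<n (k - 1). ?S $$ (a * n k + b, c))"
        using mult_diag_sum(1)[OF bc(1), of "\<lambda>_. 1"] by simp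
      also have "\<dots> = marg2 n d p k b c"
        using sketch_middle_entry[OF k2 _ bc] sum_marg3_left[OF k2] by simp
      finally show "?Q $$ (b, c) = (F * ?S) $$ (b, c)" using bc by (simp add: pair_marginal_def)
    qed (use F S Q in auto)
    hence QFS: "?Q = F * ?S * 1\<^sub>m (n (k + 1))" using F S by simp
    show ?thesis
      using factors_through_mult[of ?Q q, OF _ Q L, of "1\<^sub>m (n (k + 1))"]
        factors_through_mult[of ?S q, OF _ S F, of "1\<^sub>m (n (k + 1))"] SLQ QFS by (metis one_carrier_mat)
  qed
qed

section \<open>Concentration of empirical frequencies\<close>

lemma empirical_cong:
  assumes "\<And>i. i \<in> {1..N} \<Longrightarrow> y i = y' i"
  shows "empirical N y = empirical N y'"
proof
  fix x
  have "{i \<in> {1..N}. y i = x} = {i \<in> {1..N}. y' i = x}" using assms by auto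
  thus "empirical N y x = empirical N y' x" by (simp add: empirical_def)
qed

lemma sum_empirical:
  assumes "finite S"
  shows "(\<Sum>x\<in>S. empirical N y x) = (\<Sum>i\<in>{1..N}. indicator S (y i)) / real N"
proof -
  have "(\<Sum>x\<in>S. empirical N y x) = (\<Sum>x\<in>S. \<Sum>i\<in>{1..N}. if y i = x then 1 else 0) / real N"
    by (simp add: empirical_def sum_divide_distrib[symmetric] sum.If_cases Int_def)
  also have "(\<Sum>x\<in>S. \<Sum>i\<in>{1..N}. if y i = x then 1 else 0) = (\<Sum>i\<in>{1..N}. \<Sum>x\<in>S. if y i = x then 1 else (0::real))"
    by (rule sum.swap)
  also have "\<dots> = (\<Sum>i\<in>{1..N}. indicator S (y i))"
    using assms by (intro sum.cong) (auto simp: indicator_def)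
  finally show ?thesis .
qed

text \<open>
  Hoeffding's inequality for the indicators of \<open>Y i \<in> S\<close>, whose expectation is the sum of \<open>q\<close> over \<open>S\<close>.
\<close>
lemma empirical_frequency_concentration:
  fixes Y :: "nat \<Rightarrow> 'a \<Rightarrow> 'b"
  assumes M: "prob_space M" and indep: "prob_space.indep_vars M (\<lambda>_. count_space \<Omega>) Y {1..N}"
    and law: "\<And>i x. i \<in> {1..N} \<Longrightarrow> x \<in> \<Omega> \<Longrightarrow> measure M {\<omega> \<in> space M. Y i \<omega> = x} = q x"
    and fin: "finite \<Omega>" and S: "S \<subseteq> \<Omega>" and N: "0 < N" and t: "0 \<le> t"
  shows "measure M {\<omega> \<in> space M. t \<le> \<bar>(\<Sum>x\<in>S. empirical N (\<lambda>i. Y i \<omega>) x) - sum q S\<bar>}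
           \<le> 2 * exp (- 2 * real N * t\<^sup>2)"
proof -
  interpret prob_space M by (rule M)
  have rv: "Y i \<in> measurable M (count_space \<Omega>)" if "i \<in> {1..N}" for i
    using indep that unfolding indep_vars_def by blast
  define X where "X i \<omega> = (indicator S (Y i \<omega>) :: real)" for i \<omega>
  have indepX: "indep_vars (\<lambda>_. borel) X {1..N}"
    unfolding X_def using indep by (rule indep_vars_compose2) auto
  have E: "expectation (X i) = sum q S" if i: "i \<in> {1..N}" for i
  proof -
    have meas: "{\<omega> \<in> space M. Y i \<omega> = x} \<in> events" if "x \<in> \<Omega>" for x
      using measurable_sets[OF rv[OF i], of "{x}"] that by (simp add: vimage_def Int_def conj_commute)
    have finS: "finite S" using S fin finite_subset by blast
    have "expectation (X i) = expectation (\<lambda>\<omega>. \<Sum>x\<in>S. indicator {\<omega> \<in> space M. Y i \<omega> = x} \<omega>)"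
    proof (rule Bochner_Integration.integral_cong)
      fix \<omega> assume "\<omega> \<in> space M"
      hence "(\<Sum>x\<in>S. indicator {\<omega> \<in> space M. Y i \<omega> = x} \<omega>) = (\<Sum>x\<in>S. if Y i \<omega> = x then 1 else (0::real))"
        by (intro sum.cong) (auto simp: indicator_def)
      also have "\<dots> = X i \<omega>" using finS by (simp add: X_def indicator_def)
      finally show "X i \<omega> = (\<Sum>x\<in>S. indicator {\<omega> \<in> space M. Y i \<omega> = x} \<omega>)" by simp
    qed simp
    also have "\<dots> = (\<Sum>x\<in>S. expectation (indicator {\<omega> \<in> space M. Y i \<omega> = x}))"
      using meas S by (intro Bochner_Integration.integral_sum) (auto simp: integrable_indicator_iff emeasure_eq_measure)
    also have "\<dots> = (\<Sum>x\<in>S. q x)"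
      using meas S law[OF i] by (intro sum.cong) (auto simp: subset_eq)
    finally show ?thesis .
  qed
  interpret H: Hoeffding_ineq M "{1..N}" X "\<lambda>_. 0" "\<lambda>_. 1" "\<Sum>i\<in>{1..N}. expectation (X i)"
    by unfold_locales (use indepX in \<open>auto simp: X_def indicator_def\<close>)
  have eq: "t \<le> \<bar>(\<Sum>x\<in>S. empirical N (\<lambda>i. Y i \<omega>) x) - sum q S\<bar>
      \<longleftrightarrow> real N * t \<le> \<bar>(\<Sum>i\<in>{1..N}. X i \<omega>) - (\<Sum>i\<in>{1..N}. expectation (X i))\<bar>" for \<omega>
  proof -
    have finS: "finite S" using S fin finite_subset by blast
    have "(\<Sum>i\<in>{1..N}. X i \<omega>) - (\<Sum>i\<in>{1..N}. expectation (X i))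
        = real N * ((\<Sum>x\<in>S. empirical N (\<lambda>i. Y i \<omega>) x) - sum q S)"
      using N E by (simp add: sum_empirical[OF finS] X_def field_simps)
    thus ?thesis using N by (simp add: abs_mult)
  qed
  have "prob {\<omega> \<in> space M. real N * t \<le> \<bar>(\<Sum>i\<in>{1..N}. X i \<omega>) - (\<Sum>i\<in>{1..N}. expectation (X i))\<bar>}
      \<le> 2 * exp (-2 * (real N * t)\<^sup>2 / (\<Sum>i\<in>{1..N}. (1 - 0)\<^sup>2))"
    using N t by (intro H.Hoeffding_ineq_abs_ge) auto
  also have "-2 * (real N * t)\<^sup>2 / (\<Sum>i\<in>{1..N}. (1 - 0)\<^sup>2) = - 2 * real N * t\<^sup>2"
    using N by (simp add: power2_eq_square field_simps)
  finally show ?thesis unfolding eq .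
qed

text \<open>
  Such an event is a finite union of cylinders, whatever the property \<open>P\<close>. This is needed because the
  event of the theorem quantifies over all outputs of the algorithm.
\<close>
lemma sample_event_measurable:
  fixes Y :: "nat \<Rightarrow> 'a \<Rightarrow> 'b"
  assumes rv: "\<And>i. i \<in> I \<Longrightarrow> Y i \<in> measurable M (count_space \<Omega>)" and fin: "finite \<Omega>" "finite I"
    and P: "\<And>y y'. (\<And>i. i \<in> I \<Longrightarrow> y i = y' i) \<Longrightarrow> P y = P y'"
  shows "{\<omega> \<in> space M. P (\<lambda>i. Y i \<omega>)} \<in> sets M"
proof -
  let ?F = "{f \<in> PiE I (\<lambda>_. \<Omega>). P f}"
  have in\<Omega>: "Y i \<omega> \<in> \<Omega>" if "i \<in> I" "\<omega> \<in> space M" for i \<omega>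
    using measurable_space[OF rv[OF that(1)] that(2)] by simp
  have "{\<omega> \<in> space M. P (\<lambda>i. Y i \<omega>)} = (\<Union>f\<in>?F. {\<omega> \<in> space M. \<forall>i\<in>I. Y i \<omega> = f i})"
  proof (intro equalityI subsetI)
    fix \<omega> assume \<omega>: "\<omega> \<in> {\<omega> \<in> space M. P (\<lambda>i. Y i \<omega>)}"
    let ?f = "\<lambda>i\<in>I. Y i \<omega>"
    have "P ?f" using \<omega> P[of ?f "\<lambda>i. Y i \<omega>"] by simp
    hence "?f \<in> ?F" using \<omega> in\<Omega> by auto
    thus "\<omega> \<in> (\<Union>f\<in>?F. {\<omega> \<in> space M. \<forall>i\<in>I. Y i \<omega> = f i})" using \<omega> by (intro UN_I[of ?f]) auto
  next
    fix \<omega> assume "\<omega> \<in> (\<Union>f\<in>?F. {\<omega> \<in> space M. \<forall>i\<in>I. Y i \<omega> = f i})"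
    then obtain f where f: "P f" "\<omega> \<in> space M" "\<forall>i\<in>I. Y i \<omega> = f i" by auto
    thus "\<omega> \<in> {\<omega> \<in> space M. P (\<lambda>i. Y i \<omega>)}" using P[of f "\<lambda>i. Y i \<omega>"] by simp
  qed
  also have "\<dots> \<in> sets M"
  proof (rule sets.finite_UN)
    show "finite ?F" using fin by (simp add: finite_PiE)
    fix f assume f: "f \<in> ?F"
    have "{\<omega> \<in> space M. Y i \<omega> = f i} \<in> sets M" if "i \<in> I" for i
    proof -
      have "f i \<in> \<Omega>" using f that by (auto simp: PiE_def)
      thus ?thesis
        using measurable_sets[OF rv[OF that], of "{f i}"] by (simp add: vimage_def Int_def conj_commute)
    qed
    thus "{\<omega> \<in> space M. \<forall>i\<in>I. Y i \<omega> = f i} \<in> sets M"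
      using fin(2) by (intro sets.sets_Collect_finite_All) auto
  qed
  finally show ?thesis .
qed

lemma empirical_uniform_deviation:
  fixes Y :: "nat \<Rightarrow> 'a \<Rightarrow> 'b"
  assumes M: "prob_space M" and indep: "prob_space.indep_vars M (\<lambda>_. count_space \<Omega>) Y {1..N}"
    and law: "\<And>i x. i \<in> {1..N} \<Longrightarrow> x \<in> \<Omega> \<Longrightarrow> measure M {\<omega> \<in> space M. Y i \<omega> = x} = q x"
    and fin: "finite \<Omega>" and F: "finite F" "\<And>S. S \<in> F \<Longrightarrow> S \<subseteq> \<Omega>" and N: "0 < N" and t: "0 \<le> t"
    and count: "real (card F) * (2 * exp (- 2 * real N * t\<^sup>2)) \<le> \<eta>"
  shows "1 - \<eta> \<le> measure M {\<omega> \<in> space M.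
           \<forall>S\<in>F. \<bar>(\<Sum>x\<in>S. empirical N (\<lambda>i. Y i \<omega>) x) - sum q S\<bar> < t}"
proof -
  interpret prob_space M by (rule M)
  let ?dev = "\<lambda>S \<omega>. \<bar>(\<Sum>x\<in>S. empirical N (\<lambda>i. Y i \<omega>) x) - sum q S\<bar>"
  define bad where "bad S = {\<omega> \<in> space M. t \<le> ?dev S \<omega>}" for S
  have rv: "Y i \<in> measurable M (count_space \<Omega>)" if "i \<in> {1..N}" for i
    using indep that unfolding indep_vars_def by blast
  have bad_event: "bad S \<in> events" for S
    unfolding bad_def
  proof (rule sample_event_measurable[where I = "{1..N}" and \<Omega> = \<Omega> and
        P = "\<lambda>y. t \<le> \<bar>(\<Sum>x\<in>S. empirical N y x) - sum q S\<bar>"])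
    fix y y' :: "nat \<Rightarrow> 'b" assume "\<And>i. i \<in> {1..N} \<Longrightarrow> y i = y' i"
    hence "empirical N y = empirical N y'" by (rule empirical_cong)
    thus "(t \<le> \<bar>(\<Sum>x\<in>S. empirical N y x) - sum q S\<bar>) = (t \<le> \<bar>(\<Sum>x\<in>S. empirical N y' x) - sum q S\<bar>)"
      by simp
  qed (use rv fin in auto)
  have "prob (\<Union>S\<in>F. bad S) \<le> (\<Sum>S\<in>F. prob (bad S))"
    using F(1) bad_event by (intro measure_UNION_le) auto
  also have "\<dots> \<le> (\<Sum>S\<in>F. 2 * exp (- 2 * real N * t\<^sup>2))"
    unfolding bad_def by (intro sum_mono empirical_frequency_concentration[OF M indep law fin F(2) N t])
  also have "\<dots> \<le> \<eta>" using count by simp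
  finally have "1 - \<eta> \<le> 1 - prob (\<Union>S\<in>F. bad S)" by simp
  also have "\<dots> = prob (space M - (\<Union>S\<in>F. bad S))"
    using bad_event F(1) by (intro prob_compl[symmetric] sets.finite_UN) auto
  also have "space M - (\<Union>S\<in>F. bad S) = {\<omega> \<in> space M. \<forall>S\<in>F. ?dev S \<omega> < t}"
    by (auto simp: bad_def not_le)
  finally show ?thesis .
qed

section \<open>Coefficient matrices and slices\<close>

text \<open>
  The number of rows of the sketches at \<open>1, \<dots>, d - 1\<close>.
\<close>
definition sketch_rows :: "(nat \<Rightarrow> nat) \<Rightarrow> nat \<Rightarrow> nat" where
  "sketch_rows n k = (if k = 1 then n 1 else n (k - 1) * n k)"

lemma sketch_carrier:
  "k \<in> {1..d-1} \<Longrightarrow> sketch n d p k \<in> carrier_mat (sketch_rows n k) (n (k + 1))"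
  by (auto simp: sketch_def sketch_rows_def numeral_2_eq_2)

lemma coefficient_matrix_carrier:
  "B \<in> carrier_mat (sketch_rows n k) q \<Longrightarrow> coefficient_matrix n k B \<in> carrier_mat (n k) q"
  by (auto simp: coefficient_matrix_def sketch_rows_def)

lemma slice_carrier: "B \<in> carrier_mat m q \<Longrightarrow> slice n k B x \<in> carrier_mat (n (k - 1)) q"
  by (auto simp: slice_def)

lemma coefficient_matrix_diff_mult:
  assumes B: "B \<in> carrier_mat (sketch_rows n k) q" and B': "B' \<in> carrier_mat (sketch_rows n k) q"
    and R: "R \<in> carrier_mat q q"
  shows "coefficient_matrix n k B' - coefficient_matrix n k B * R = coefficient_matrix n k (B' - B * R)"
proof (cases "k = 1")
  case False
  have BR: "B * R \<in> carrier_mat (n (k - 1) * n k) q" using B R False by (simp add: sketch_rows_def)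
  have B'c: "B' \<in> carrier_mat (n (k - 1) * n k) q" and Bc: "B \<in> carrier_mat (n (k - 1) * n k) q"
    using B B' False by (auto simp: sketch_rows_def)
  show ?thesis
  proof (rule eq_matI)
    fix b \<alpha> assume "b < dim_row (coefficient_matrix n k (B' - B * R))" "\<alpha> < dim_col (coefficient_matrix n k (B' - B * R))"
    hence b: "b < n k" "\<alpha> < q" using False R by (auto simp: coefficient_matrix_def)
    have idx: "a * n k + b < n (k - 1) * n k" if "a < n (k - 1)" for a using pair_index_less[OF that b(1)] .
    have "(coefficient_matrix n k B * R) $$ (b, \<alpha>) = (\<Sum>l<q. (\<Sum>a<n (k - 1). B $$ (a * n k + b, l)) * R $$ (l, \<alpha>))"
      using mat_mult_entry[OF coefficient_matrix_carrier[OF B] R b] B b False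
      by (simp add: coefficient_matrix_def del: index_mult_mat(1))
    also have "\<dots> = (\<Sum>a<n (k - 1). \<Sum>l<q. B $$ (a * n k + b, l) * R $$ (l, \<alpha>))"
      unfolding sum_distrib_right by (rule sum.swap)
    also have "\<dots> = (\<Sum>a<n (k - 1). (B * R) $$ (a * n k + b, \<alpha>))"
      using B R b False idx mat_mult_entry[of B "n (k - 1) * n k" q R q]
      by (intro sum.cong) (auto simp: sketch_rows_def)
    finally have "(coefficient_matrix n k B * R) $$ (b, \<alpha>) = (\<Sum>a<n (k - 1). (B * R) $$ (a * n k + b, \<alpha>))" .
    moreover have "(B' - B * R) $$ (a * n k + b, \<alpha>) = B' $$ (a * n k + b, \<alpha>) - (B * R) $$ (a * n k + b, \<alpha>)"
      if "a < n (k - 1)" for a using Bc B'c R idx[OF that] b by (simp del: index_mult_mat(1))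
    ultimately show "(coefficient_matrix n k B' - coefficient_matrix n k B * R) $$ (b, \<alpha>)
        = coefficient_matrix n k (B' - B * R) $$ (b, \<alpha>)"
      using b B' B R False by (simp add: coefficient_matrix_def sum_subtractf del: index_mult_mat(1))
  qed (use B B' R False in \<open>auto simp: coefficient_matrix_def\<close>)
qed (simp add: coefficient_matrix_def)

lemma slice_diff_mult:
  assumes B: "B \<in> carrier_mat (n (k - 1) * n k) q" and B': "B' \<in> carrier_mat (n (k - 1) * n k) q"
    and R: "R \<in> carrier_mat q q" and x: "x < n k"
  shows "slice n k B' x - slice n k B x * R = slice n k (B' - B * R) x"
proof (rule eq_matI)
  fix a \<alpha> assume "a < dim_row (slice n k (B' - B * R) x)" "\<alpha> < dim_col (slice n k (B' - B * R) x)"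
  hence a: "a < n (k - 1)" "\<alpha> < q" using R by (auto simp: slice_def)
  have BR: "B * R \<in> carrier_mat (n (k - 1) * n k) q" using B R by simp
  have idx: "a * n k + x < n (k - 1) * n k" using pair_index_less[OF a(1) x] .
  have "(slice n k B x * R) $$ (a, \<alpha>) = (B * R) $$ (a * n k + x, \<alpha>)"
    using mat_mult_entry[OF slice_carrier[OF B, of n k x] R a] mat_mult_entry[OF B R idx a(2)] a B
    by (simp add: slice_def del: index_mult_mat(1))
  thus "(slice n k B' x - slice n k B x * R) $$ (a, \<alpha>) = slice n k (B' - B * R) x $$ (a, \<alpha>)"
    using a B B' R idx by (simp add: slice_def del: index_mult_mat(1))
qed (use B B' R in \<open>auto simp: slice_def\<close>)

text \<open>
  Each entry is a sum over at most \<open>nm\<close> values of \<open>x (k-1)\<close>, to which Cauchy-Schwarz is applied.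
\<close>
lemma fnorm_coefficient_matrix_le:
  assumes X: "X \<in> carrier_mat (sketch_rows n k) q" and n: "1 \<le> nm" "k \<noteq> 1 \<Longrightarrow> n (k - 1) \<le> nm"
  shows "fnorm (coefficient_matrix n k X) \<le> sqrt (real nm) * fnorm X"
proof (cases "k = 1")
  case True
  have "1 * fnorm X \<le> sqrt (real nm) * fnorm X" using n by (intro mult_right_mono fnorm_nonneg) simp
  thus ?thesis using True by (simp add: coefficient_matrix_def)
next
  case False
  have "frobenius_sq (coefficient_matrix n k X) = (\<Sum>b<n k. \<Sum>\<alpha><q. (\<Sum>a<n (k - 1). X $$ (a * n k + b, \<alpha>))\<^sup>2)"
    using X False by (simp add: frobenius_sq_def coefficient_matrix_def)
  also have "\<dots> \<le> (\<Sum>b<n k. \<Sum>\<alpha><q. (\<Sum>a<n (k - 1). (X $$ (a * n k + b, \<alpha>))\<^sup>2) * real nm)"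
  proof (intro sum_mono)
    fix b \<alpha>
    have "(\<Sum>a<n (k - 1). X $$ (a * n k + b, \<alpha>))\<^sup>2
        \<le> (\<Sum>a<n (k - 1). (X $$ (a * n k + b, \<alpha>))\<^sup>2) * real (card {..<n (k - 1)})"
      by (rule sum_squared_le_sum_of_squares)
    also have "\<dots> \<le> (\<Sum>a<n (k - 1). (X $$ (a * n k + b, \<alpha>))\<^sup>2) * real nm"
      using n False by (intro mult_left_mono sum_nonneg) auto
    finally show "(\<Sum>a<n (k - 1). X $$ (a * n k + b, \<alpha>))\<^sup>2
        \<le> (\<Sum>a<n (k - 1). (X $$ (a * n k + b, \<alpha>))\<^sup>2) * real nm" .
  qed
  also have "\<dots> = (\<Sum>b<n k. \<Sum>a<n (k - 1). \<Sum>\<alpha><q. (X $$ (a * n k + b, \<alpha>))\<^sup>2) * real nm"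
    unfolding sum_distrib_right by (intro sum.cong refl sum.swap)
  also have "(\<Sum>b<n k. \<Sum>a<n (k - 1). \<Sum>\<alpha><q. (X $$ (a * n k + b, \<alpha>))\<^sup>2)
      = (\<Sum>a<n (k - 1). \<Sum>b<n k. \<Sum>\<alpha><q. (X $$ (a * n k + b, \<alpha>))\<^sup>2)" by (rule sum.swap)
  also have "\<dots> = frobenius_sq X"
    using X False by (simp add: frobenius_sq_def sketch_rows_def sum_pair_index)
  finally have "fnorm (coefficient_matrix n k X) \<le> sqrt (frobenius_sq X * real nm)"
    unfolding fnorm_def by (rule real_sqrt_le_mono)
  thus ?thesis by (simp add: fnorm_def real_sqrt_mult mult.commute)
qed

lemma fnorm_slice_le:
  assumes X: "X \<in> carrier_mat (n (k - 1) * n k) q" and x: "x < n k"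
  shows "fnorm (slice n k X x) \<le> fnorm X"
proof -
  have "frobenius_sq (slice n k X x) = (\<Sum>a<n (k - 1). \<Sum>\<alpha><q. (X $$ (a * n k + x, \<alpha>))\<^sup>2)"
    using X by (simp add: frobenius_sq_def slice_def)
  also have "\<dots> \<le> (\<Sum>a<n (k - 1). \<Sum>b<n k. \<Sum>\<alpha><q. (X $$ (a * n k + b, \<alpha>))\<^sup>2)"
  proof (rule sum_mono)
    fix a
    show "(\<Sum>\<alpha><q. (X $$ (a * n k + x, \<alpha>))\<^sup>2) \<le> (\<Sum>b<n k. \<Sum>\<alpha><q. (X $$ (a * n k + b, \<alpha>))\<^sup>2)"
      using x by (intro member_le_sum[where f = "\<lambda>b. \<Sum>\<alpha><q. (X $$ (a * n k + b, \<alpha>))\<^sup>2"]) (auto intro: sum_nonneg)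
  qed
  also have "\<dots> = frobenius_sq X" using X by (simp add: frobenius_sq_def sum_pair_index)
  finally show ?thesis by (simp add: fnorm_def)
qed

section \<open>Singular bases of the exact sketches\<close>

text \<open>
  Otherwise all probabilities vanish by \<open>markov_three_factors\<close>.
\<close>
lemma pair_marginal_nonzero:
  assumes p: "markov_density n d p" and k: "k \<in> {1..d-1}"
  shows "pair_marginal n d p k \<noteq> 0\<^sub>m (n k) (n (k + 1))"
proof
  assume z: "pair_marginal n d p k = 0\<^sub>m (n k) (n (k + 1))"
  have m0: "marg2 n d p k a b = 0" if "a < n k" "b < n (k + 1)" for a b
  proof -
    have "pair_marginal n d p k $$ (a, b) = 0" unfolding z using that by simp
    thus ?thesis using that by (simp add: pair_marginal_def)
  qed
  have "p x = 0" if x: "x \<in> grid n d" for x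
  proof -
    have "k \<in> {1..d}" "k + 1 \<in> {1..d}" using k by auto
    hence "x k < n k" "x (k + 1) < n (k + 1)" using grid_less[OF x] by blast+
    hence "marg2 n d p k (x k) (x (k + 1)) = 0" by (rule m0)
    thus ?thesis using markov_three_factors[OF p k x] by simp
  qed
  hence "(\<Sum>x\<in>grid n d. p x) = 0" by (rule sum.neutral[OF ballI])
  thus False using p by (simp add: markov_density_def)
qed

text \<open>
  The sketch has the rank of the unfolding matrix, which is positive since the density is not zero.
\<close>
lemma sketch_rank:
  assumes p: "markov_density n d p" and k: "k \<in> {1..d-1}"
    and rank: "vec_space.rank (dim_row (unfolding_matrix n d p k)) (unfolding_matrix n d p k) = q"
  shows "factors_through (sketch n d p k) q"
    "\<And>q'. factors_through (sketch n d p k) q' \<Longrightarrow> q \<le> q'" "0 < q"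
proof -
  note iff = factors_through_unfolding_iff[OF p k] factors_through_sketch_iff[OF p k]
  show fac: "factors_through (sketch n d p k) q"
    using factors_through_rank[of "unfolding_matrix n d p k"] rank iff by simp
  show "q \<le> q'" if "factors_through (sketch n d p k) q'" for q'
    using rank_le_factors_through[of "unfolding_matrix n d p k" q'] rank iff that by simp
  show "0 < q"
  proof (rule ccontr)
    assume "\<not> 0 < q"
    hence "factors_through (pair_marginal n d p k) 0" using fac iff by simp
    then obtain X Y where "X \<in> carrier_mat (n k) 0" "Y \<in> carrier_mat 0 (n (k + 1))" "pair_marginal n d p k = X * Y"
      unfolding factors_through_def by (auto simp: pair_marginal_def)
    hence "pair_marginal n d p k = 0\<^sub>m (n k) (n (k + 1))"
      by (intro eq_matI) (auto simp: scalar_prod_def)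
    thus False using pair_marginal_nonzero[OF p k] by simp
  qed
qed

lemma first_left_singular_vectors_leading:
  assumes "first_left_singular_vectors M s B" "M \<in> carrier_mat m n"
  obtains U S V where "is_svd M U S V" "B = leading_cols U s" "s \<le> m"
proof -
  from assms obtain U S V where svd: "is_svd M U S V" "B = Matrix.mat m s (\<lambda>(i, j). U $$ (i, j))" "s \<le> m"
    unfolding first_left_singular_vectors_def by auto
  moreover have "dim_row U = m" using is_svdD(1)[OF svd(1) assms(2)] by simp
  ultimately show ?thesis using that by (simp add: leading_cols_def)
qed

text \<open>
  All that is used of the exact singular vectors: they form an orthonormal basis of the column space of
  the sketch, on which its transpose is bounded below by the singular value in \<open>c_P\<close>.
\<close>
lemma singular_basis_of_sketch:
  assumes p: "markov_density n d p" and k: "k \<in> {1..d-1}"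
    and rank: "vec_space.rank (dim_row (unfolding_matrix n d p k)) (unfolding_matrix n d p k) = q"
    and fl: "first_left_singular_vectors (sketch n d p k) q B"
  defines "M \<equiv> sketch n d p k"
  shows "B \<in> carrier_mat (sketch_rows n k) q" "B\<^sup>T * B = 1\<^sub>m q" "M = B * (B\<^sup>T * M)"
    "\<exists>Z\<in>carrier_mat (n (k + 1)) q. B = M * Z"
    "0 < singular_value M q"
    "\<And>y. y \<in> carrier_vec q \<Longrightarrow> singular_value M q * euclid_norm y \<le> euclid_norm ((M\<^sup>T * B) *\<^sub>v y)"
proof -
  have M: "M \<in> carrier_mat (sketch_rows n k) (n (k + 1))" unfolding M_def by (rule sketch_carrier[OF k])
  note rk = sketch_rank[OF p k rank, folded M_def]
  from first_left_singular_vectors_leading[OF fl[folded M_def] M]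
  obtain U S V where svd: "is_svd M U S V" and B: "B = leading_cols U q" and "q \<le> sketch_rows n k" .
  note * = is_svdD[OF svd M]
  note pos = singular_value_pos_of_minimal[OF svd M rk(1,2,3)]
  have zero: "S $$ (i, i) = 0" if "q \<le> i" "i < min (sketch_rows n k) (n (k + 1))" for i
    by (rule svd_vanishes_beyond_factorisation[OF svd M rk(1) that])
  show Bc: "B \<in> carrier_mat (sketch_rows n k) q" unfolding B by (rule leading_cols_carrier[OF *(1)])
  show BB: "B\<^sup>T * B = 1\<^sub>m q" unfolding B by (rule leading_cols_orthonormal[OF *(1,2) \<open>q \<le> sketch_rows n k\<close>])
  show "M = B * (B\<^sup>T * M)" unfolding B
    by (rule leading_cols_projection[OF svd M \<open>q \<le> sketch_rows n k\<close> zero])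
  have qmin: "q - 1 < min (sketch_rows n k) (n (k + 1))" using pos(1) rk(3) by arith
  have "0 < S $$ (j, j)" if "j < q" for j
  proof -
    have "S $$ (q - 1, q - 1) \<le> S $$ (j, j)" using that by (intro *(11)[OF qmin]) arith
    thus ?thesis using pos(2) by linarith
  qed
  from leading_cols_in_range[OF svd M pos(1) this] obtain Z where
    Z: "Z \<in> carrier_mat (n (k + 1)) q" "B = M * Z" unfolding B by blast
  thus "\<exists>Z\<in>carrier_mat (n (k + 1)) q. B = M * Z" by blast
  (* the singular value is read off from some decomposition, possibly a different one *)
  have "\<exists>c U S V. is_svd M U S V \<and> c = S $$ (q - 1, q - 1)" using svd by blast
  hence "\<exists>U S V. is_svd M U S V \<and> singular_value M q = S $$ (q - 1, q - 1)"
    unfolding singular_value_def by (rule someI_ex)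
  then obtain U' S' V' where svd': "is_svd M U' S' V'" and c: "singular_value M q = S' $$ (q - 1, q - 1)" by blast
  show "0 < singular_value M q" unfolding c by (rule singular_value_pos_of_minimal(2)[OF svd' M rk(1,2,3)])
  fix y :: "real vec" assume y: "y \<in> carrier_vec q"
  have zero': "S' $$ (i, i) = 0" if "q \<le> i" "i < min (sketch_rows n k) (n (k + 1))" for i
    by (rule svd_vanishes_beyond_factorisation[OF svd' M rk(1) that])
  have By: "B *\<^sub>v y = M *\<^sub>v (Z *\<^sub>v y)" unfolding Z(2) by (rule assoc_mult_mat_vec[OF M Z(1) y])
  have "singular_value M q * euclid_norm (M *\<^sub>v (Z *\<^sub>v y)) \<le> euclid_norm (M\<^sup>T *\<^sub>v (M *\<^sub>v (Z *\<^sub>v y)))"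
    unfolding c using Z(1) y by (intro singular_value_lower_bound[OF svd' M rk(3) pos(1) zero']) auto
  moreover have "M\<^sup>T *\<^sub>v (B *\<^sub>v y) = (M\<^sup>T * B) *\<^sub>v y"
    using M Bc y by (intro assoc_mult_mat_vec[symmetric]) auto
  ultimately show "singular_value M q * euclid_norm y \<le> euclid_norm ((M\<^sup>T * B) *\<^sub>v y)"
    using euclid_norm_isometry[OF Bc BB y] by (simp add: By)
qed

text \<open>
  A vector \<open>w\<close> of the column space of the sketch satisfies
  \<open>w (a, b) = p(a, b) / p(b) * (\<Sum>a'. w (a', b))\<close> by the Markov property, so it is determined by its sums
  over the first variable. These are what the coefficient matrix computes.
\<close>
lemma coefficient_matrix_injective:
  assumes p: "markov_density n d p" and k: "k \<in> {1..d-1}"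
    and B: "B \<in> carrier_mat (sketch_rows n k) q" "B\<^sup>T * B = 1\<^sub>m q"
    and Z: "Z \<in> carrier_mat (n (k + 1)) q" "B = sketch n d p k * Z"
    and v: "v \<in> carrier_vec q" and z: "coefficient_matrix n k B *\<^sub>v v = 0\<^sub>v (n k)"
  shows "v = 0\<^sub>v q"
proof -
  have pos: "0 < n l" if "l \<in> {1..d}" for l using markov_states_nonempty[OF p that] .
  have "B *\<^sub>v v = 0\<^sub>v (sketch_rows n k)"
  proof (cases "k = 1")
    case True
    thus ?thesis using z by (simp add: coefficient_matrix_def sketch_rows_def)
  next
    case False
    hence k2: "k \<in> {2..d-1}" and rows: "sketch_rows n k = n (k - 1) * n k" using k by (auto simp: sketch_rows_def)
    have M: "sketch n d p k \<in> carrier_mat (n (k - 1) * n k) (n (k + 1))" by (rule sketch_middle_carrier[OF k2])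
    define u where "u = Z *\<^sub>v v"
    have u: "u \<in> carrier_vec (n (k + 1))" using Z v by (simp add: u_def)
    define s where "s b = (\<Sum>c<n (k + 1). marg2 n d p k b c * u $ c)" for b
    have Bv: "B *\<^sub>v v = sketch n d p k *\<^sub>v u" unfolding Z(2) u_def by (rule assoc_mult_mat_vec[OF M Z(1) v])
    have Bv_entry: "(B *\<^sub>v v) $ (a * n k + b) = (\<Sum>c<n (k + 1). marg3 n d p k a b c * u $ c)"
      if "a < n (k - 1)" "b < n k" for a b
      using M u pair_index_less[OF that] sketch_middle_entry[OF k2 that]
      by (simp add: Bv scalar_prod_def atLeast0LessThan)
    have s0: "s b = 0" if b: "b < n k" for b
    proof -
      have "0 = (coefficient_matrix n k B *\<^sub>v v) $ b" using z b by simp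
      also have "\<dots> = (\<Sum>\<alpha><q. (\<Sum>a<n (k - 1). B $$ (a * n k + b, \<alpha>)) * v $ \<alpha>)"
        using b B v False by (simp add: coefficient_matrix_def scalar_prod_def atLeast0LessThan)
      also have "\<dots> = (\<Sum>a<n (k - 1). \<Sum>\<alpha><q. B $$ (a * n k + b, \<alpha>) * v $ \<alpha>)"
        unfolding sum_distrib_right by (rule sum.swap)
      also have "\<dots> = (\<Sum>a<n (k - 1). (B *\<^sub>v v) $ (a * n k + b))"
        using B v pair_index_less[OF _ b] by (intro sum.cong) (auto simp: rows scalar_prod_def atLeast0LessThan)
      also have "\<dots> = (\<Sum>a<n (k - 1). \<Sum>c<n (k + 1). marg3 n d p k a b c * u $ c)"
        using Bv_entry b by (intro sum.cong) auto
      also have "\<dots> = (\<Sum>c<n (k + 1). (\<Sum>a<n (k - 1). marg3 n d p k a b c) * u $ c)"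
        unfolding sum_distrib_right by (rule sum.swap)
      also have "\<dots> = s b" unfolding sum_marg3_left[OF k2] s_def by (rule refl)
      finally show ?thesis by simp
    qed
    show ?thesis
    proof (rule eq_vecI)
      fix i assume "i < dim_vec (0\<^sub>v (sketch_rows n k) :: real vec)"
      hence i: "i < n (k - 1) * n k" by (simp add: rows)
      have "k \<in> {1..d}" using k by auto
      hence b: "i mod n k < n k" using pos by simp
      have a: "i div n k < n (k - 1)" using i by (simp add: less_mult_imp_div_less)
      have "(B *\<^sub>v v) $ i = (\<Sum>c<n (k + 1). marg3 n d p k (i div n k) (i mod n k) c * u $ c)"
        using Bv_entry[OF a b] by simp
      also have "\<dots> = marg2 n d p (k - 1) (i div n k) (i mod n k) / marg1 n d p k (i mod n k) * s (i mod n k)"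
        unfolding s_def sum_distrib_left by (intro sum.cong refl) (simp add: marg3_markov[OF p k2])
      finally show "(B *\<^sub>v v) $ i = 0\<^sub>v (sketch_rows n k) $ i" using s0[OF b] i rows by simp
    qed (use B in simp)
  qed
  hence "euclid_norm v = 0" using euclid_norm_isometry[OF B v] by (simp add: euclid_norm_def)
  thus ?thesis using euclid_norm_eq_0[OF v] by simp
qed

lemma pair_marginal_in_range:
  assumes k: "k \<in> {1..d-1}" and B: "B \<in> carrier_mat (sketch_rows n k) q"
    and Y: "Y \<in> carrier_mat q (n (k + 1))" "sketch n d p k = B * Y"
  shows "pair_marginal n d p k = coefficient_matrix n k B * Y"
proof (cases "k = 1")
  case True
  thus ?thesis using Y by (simp add: coefficient_matrix_def sketch_first)
next
  case False
  hence k2: "k \<in> {2..d-1}" and rows: "sketch_rows n k = n (k - 1) * n k" using k by (auto simp: sketch_rows_def)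
  note A = coefficient_matrix_carrier[OF B]
  show ?thesis
  proof (rule eq_matI)
    fix b c assume "b < dim_row (coefficient_matrix n k B * Y)" "c < dim_col (coefficient_matrix n k B * Y)"
    hence bc: "b < n k" "c < n (k + 1)" using A Y by auto
    have "pair_marginal n d p k $$ (b, c) = (\<Sum>a<n (k - 1). sketch n d p k $$ (a * n k + b, c))"
      using bc sum_marg3_left[OF k2, of n p b c] sketch_middle_entry[OF k2 _ bc] by (simp add: pair_marginal_def)
    also have "\<dots> = (\<Sum>a<n (k - 1). \<Sum>\<alpha><q. B $$ (a * n k + b, \<alpha>) * Y $$ (\<alpha>, c))"
      unfolding Y(2) using mat_mult_entry[OF B[unfolded rows] Y(1) _ bc(2)] pair_index_less[OF _ bc(1)]
      by (intro sum.cong) auto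
    also have "\<dots> = (\<Sum>\<alpha><q. (\<Sum>a<n (k - 1). B $$ (a * n k + b, \<alpha>)) * Y $$ (\<alpha>, c))"
      unfolding sum_distrib_right by (rule sum.swap)
    also have "\<dots> = (coefficient_matrix n k B * Y) $$ (b, c)"
      using mat_mult_entry[OF A Y(1) bc] bc B False by (simp add: coefficient_matrix_def del: index_mult_mat(1))
    finally show "pair_marginal n d p k $$ (b, c) = (coefficient_matrix n k B * Y) $$ (b, c)" .
  qed (use A Y in \<open>auto simp: pair_marginal_def\<close>)
qed

text \<open>
  For fixed \<open>x k = x\<close> the marginal \<open>p(x (k-1), x, x (k+1))\<close> depends on \<open>x (k-1)\<close> only through the factor
  \<open>p(x (k-1), x)\<close>, a column of the pair marginal.
\<close>
lemma slice_in_range: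
  assumes p: "markov_density n d p" and k: "k \<in> {2..d-1}" and B: "B \<in> carrier_mat (n (k - 1) * n k) q"
    and Z: "Z \<in> carrier_mat (n (k + 1)) q" "B = sketch n d p k * Z" and x: "x < n k"
  obtains W where "W \<in> carrier_mat (n k) q" "slice n k B x = pair_marginal n d p (k - 1) * W"
proof -
  define \<zeta> where "\<zeta> \<alpha> = (\<Sum>c<n (k + 1). marg2 n d p k x c * Z $$ (c, \<alpha>)) / marg1 n d p k x" for \<alpha>
  (* only row x of W is nonzero: it selects the column x of the pair marginal *)
  define W where "W = Matrix.mat (n k) q (\<lambda>(b, \<alpha>). if b = x then \<zeta> \<alpha> else 0)"
  have W: "W \<in> carrier_mat (n k) q" by (simp add: W_def)
  have kk: "k - 1 + 1 = k" using k by auto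
  have Q: "pair_marginal n d p (k - 1) \<in> carrier_mat (n (k - 1)) (n k)"
    using pair_marginal_carrier[of n d p "k - 1"] kk by simp
  have M: "sketch n d p k \<in> carrier_mat (n (k - 1) * n k) (n (k + 1))" by (rule sketch_middle_carrier[OF k])
  have "slice n k B x = pair_marginal n d p (k - 1) * W"
  proof (rule eq_matI)
    fix a \<alpha> assume "a < dim_row (pair_marginal n d p (k - 1) * W)" "\<alpha> < dim_col (pair_marginal n d p (k - 1) * W)"
    hence a: "a < n (k - 1)" "\<alpha> < q" using Q W by auto
    have "slice n k B x $$ (a, \<alpha>) = (\<Sum>c<n (k + 1). sketch n d p k $$ (a * n k + x, c) * Z $$ (c, \<alpha>))"
    proof -
      have "slice n k B x $$ (a, \<alpha>) = B $$ (a * n k + x, \<alpha>)" using a B by (simp add: slice_def)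
      thus ?thesis unfolding Z(2) mat_mult_entry[OF M Z(1) pair_index_less[OF a(1) x] a(2)] .
    qed
    also have "\<dots> = (\<Sum>c<n (k + 1). marg2 n d p (k - 1) a x / marg1 n d p k x * (marg2 n d p k x c * Z $$ (c, \<alpha>)))"
      using sketch_middle_entry[OF k a(1) x] marg3_markov[OF p k] by (intro sum.cong) auto
    also have "\<dots> = marg2 n d p (k - 1) a x * \<zeta> \<alpha>"
      unfolding sum_distrib_left[symmetric] \<zeta>_def by simp
    also have "\<dots> = (\<Sum>b<n k. marg2 n d p (k - 1) a b * (if b = x then \<zeta> \<alpha> else 0))"
      using mult_diag_sum(2)[OF x, of "marg2 n d p (k - 1) a" "\<lambda>_. \<zeta> \<alpha>"] by simp
    also have "\<dots> = (pair_marginal n d p (k - 1) * W) $$ (a, \<alpha>)"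
      unfolding mat_mult_entry[OF Q W a] using a kk
      by (intro sum.cong) (auto simp: pair_marginal_def W_def)
    finally show "slice n k B x $$ (a, \<alpha>) = (pair_marginal n d p (k - 1) * W) $$ (a, \<alpha>)" .
  qed (use Q W B in \<open>auto simp: slice_def\<close>)
  thus ?thesis using that W by blast
qed

text \<open>
  If the residual can be 0, its minimum is 0.
\<close>
lemma least_squares_exact:
  assumes ls: "least_squares A B X" and A: "A \<in> carrier_mat m r" and B: "B \<in> carrier_mat m k"
    and Z: "Z \<in> carrier_mat r k" "A * Z = B"
  shows "A * X = B"
proof -
  have X: "X \<in> carrier_mat r k" using ls A B by (simp add: least_squares_def)
  have "frobenius_sq (A * X - B) \<le> frobenius_sq (A * Z - B)"
    using ls A B Z(1) by (auto simp: least_squares_def)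
  also have "A * Z - B = 0\<^sub>m m k" using B Z(2) by simp
  finally have "frobenius_sq (A * X - B) = 0"
    using frobenius_sq_nonneg[of "A * X - B"] by (simp add: frobenius_sq_def)
  hence D: "A * X - B = 0\<^sub>m m k" using B by (intro frobenius_sq_eq_0) auto
  show ?thesis
  proof (rule eq_matI)
    fix i j assume ij: "i < dim_row B" "j < dim_col B"
    have "(A * X - B) $$ (i, j) = 0" unfolding D using ij B by simp
    thus "(A * X) $$ (i, j) = B $$ (i, j)" using ij B A X by (simp del: index_mult_mat(1))
  qed (use A B X in auto)
qed

section \<open>Norms and distances of cores\<close>

lemma slice_norm_nonneg: "0 \<le> slice_norm d k X"
  by (simp add: slice_norm_def euclid_norm_nonneg spectral_norm_nonneg)

lemma core_norm_ge: "x < n k \<Longrightarrow> slice_norm d k (G x) \<le> core_norm n d k G"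
  unfolding core_norm_def by (intro Max_ge) auto

lemma core_norm_le:
  "0 < n k \<Longrightarrow> (\<And>x. x < n k \<Longrightarrow> slice_norm d k (G x) \<le> c) \<Longrightarrow> core_norm n d k G \<le> c"
  unfolding core_norm_def by (intro Max.boundedI) auto

lemma core_norm_nonneg: "0 < n k \<Longrightarrow> 0 \<le> core_norm n d k G"
  using core_norm_ge[of 0 n k d G] slice_norm_nonneg[of d k "G 0"] by linarith

text \<open>
  The infimum is bounded by the value at any admissible pair of rotations.
\<close>
lemma core_dist_le:
  assumes "0 < n k" "R \<in> rotations d r (k - 1)" "R' \<in> rotations d r k"
    and "\<And>x. x < n k \<Longrightarrow> slice_norm d k (H x - R * G x * R') \<le> c"
  shows "core_dist n d r k H G \<le> c"
proof -
  have "core_dist n d r k H G \<le> core_norm n d k (\<lambda>x. H x - R * G x * R')"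
    unfolding core_dist_def
  proof (rule cInf_lower)
    show "bdd_below {core_norm n d k (\<lambda>x. H x - R * G x * R') |R R'.
            R \<in> rotations d r (k - 1) \<and> R' \<in> rotations d r k}"
      by (rule bdd_belowI[of _ 0]) (use core_norm_nonneg[of n k d] assms(1) in auto)
  qed (use assms(2,3) in blast)
  also have "\<dots> \<le> c" using assms(1,4) by (intro core_norm_le) auto
  finally show ?thesis .
qed

lemma orthogonal_group_transpose: "R \<in> orthogonal_group m \<Longrightarrow> R\<^sup>T \<in> orthogonal_group m"
  by (auto simp: orthogonal_group_def)

lemma sketch_last: "2 \<le> d \<Longrightarrow> sketch n d p d = pair_marginal n d p (d - 1)"
  by (auto simp: sketch_def pair_marginal_def)

section \<open>Cores of a Markov density\<close>

lemma tt_rs_basis: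
  assumes "tt_rs n d r p A G"
  obtains B where
    "\<And>k. k \<in> {1..d-1} \<Longrightarrow> first_left_singular_vectors (sketch n d p k) (r k) (B k)"
    "\<And>k. k \<in> {1..d-1} \<Longrightarrow> A k = coefficient_matrix n k (B k)"
    "\<And>x. x < n 1 \<Longrightarrow> G 1 x = Matrix.mat 1 (r 1) (\<lambda>(_, \<alpha>). B 1 $$ (x, \<alpha>))"
    "\<And>k x. k \<in> {2..d-1} \<Longrightarrow> x < n k \<Longrightarrow> least_squares (A (k - 1)) (slice n k (B k) x) (G k x)"
    "\<And>x. x < n d \<Longrightarrow> least_squares (A (d - 1)) (Matrix.mat (n (d - 1)) 1 (\<lambda>(a, _). sketch n d p d $$ (a, x))) (G d x)"
proof -
  from assms obtain B where B: "\<forall>k\<in>{1..d-1}. first_left_singular_vectors (sketch n d p k) (r k) (B k)"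
    "B d = sketch n d p d" "\<forall>k\<in>{1..d-1}. A k = coefficient_matrix n k (B k)"
    "\<forall>x<n 1. G 1 x = Matrix.mat 1 (r 1) (\<lambda>(_, \<alpha>). B 1 $$ (x, \<alpha>))"
    "\<forall>k\<in>{2..d-1}. \<forall>x<n k. least_squares (A (k - 1)) (slice n k (B k) x) (G k x)"
    "\<forall>x<n d. least_squares (A (d - 1)) (Matrix.mat (n (d - 1)) 1 (\<lambda>(a, _). B d $$ (a, x))) (G d x)"
    unfolding tt_rs_def by blast
  show ?thesis by (rule that[of B]) (use B in simp_all)
qed

text \<open>
  The right-hand sides lie in the column space of the pair marginal at \<open>k - 1\<close>, hence in that of the
  coefficient matrix, since the pair marginal is the coefficient matrix times the coordinates of the
  sketch in the singular basis.
\<close>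
lemma exact_core_equations:
  assumes d: "2 \<le> d" and p: "markov_density n d p"
    and rank: "\<And>k. k \<in> {1..d-1} \<Longrightarrow> vec_space.rank (dim_row (unfolding_matrix n d p k)) (unfolding_matrix n d p k) = r k"
    and B: "\<And>k. k \<in> {1..d-1} \<Longrightarrow> first_left_singular_vectors (sketch n d p k) (r k) (B k)"
    and A: "\<And>k. k \<in> {1..d-1} \<Longrightarrow> A k = coefficient_matrix n k (B k)"
    and Gm: "\<And>k x. k \<in> {2..d-1} \<Longrightarrow> x < n k \<Longrightarrow> least_squares (A (k - 1)) (slice n k (B k) x) (G k x)"
    and Gd: "\<And>x. x < n d \<Longrightarrow> least_squares (A (d - 1)) (Matrix.mat (n (d - 1)) 1 (\<lambda>(a, _). sketch n d p d $$ (a, x))) (G d x)"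
  shows "\<And>k x. k \<in> {2..d-1} \<Longrightarrow> x < n k \<Longrightarrow> G k x \<in> carrier_mat (r (k - 1)) (r k) \<and> A (k - 1) * G k x = slice n k (B k) x"
    "\<And>x. x < n d \<Longrightarrow> G d x \<in> carrier_mat (r (d - 1)) 1 \<and>
       A (d - 1) * G d x = Matrix.mat (n (d - 1)) 1 (\<lambda>(a, _). sketch n d p d $$ (a, x))"
proof -
  note basis = singular_basis_of_sketch[OF p _ rank B]
  have Ac: "A k \<in> carrier_mat (n k) (r k)" if "k \<in> {1..d-1}" for k
    unfolding A[OF that] by (rule coefficient_matrix_carrier[OF basis(1)[OF that that that]])
  have range: "\<exists>Y\<in>carrier_mat (r k) (n (k + 1)). pair_marginal n d p k = A k * Y" if k: "k \<in> {1..d-1}" for k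
  proof -
    have "(B k)\<^sup>T * sketch n d p k \<in> carrier_mat (r k) (n (k + 1))"
      using basis(1)[OF k k k] sketch_carrier[OF k, of n p] by simp
    moreover from this have "pair_marginal n d p k = A k * ((B k)\<^sup>T * sketch n d p k)"
      unfolding A[OF k] by (rule pair_marginal_in_range[OF k basis(1)[OF k k k] _ basis(3)[OF k k k]])
    ultimately show ?thesis by blast
  qed
  show "G k x \<in> carrier_mat (r (k - 1)) (r k) \<and> A (k - 1) * G k x = slice n k (B k) x"
    if k: "k \<in> {2..d-1}" and x: "x < n k" for k x
  proof -
    have k1: "k \<in> {1..d-1}" and km: "k - 1 \<in> {1..d-1}" and kk: "k - 1 + 1 = k" and ne: "k \<noteq> 1" using k by auto
    have Bk: "B k \<in> carrier_mat (n (k - 1) * n k) (r k)"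
      using basis(1)[OF k1 k1 k1] ne by (simp add: sketch_rows_def)
    obtain Z where Z: "Z \<in> carrier_mat (n (k + 1)) (r k)" "B k = sketch n d p k * Z"
      using basis(4)[OF k1 k1 k1] by blast
    obtain W where W: "W \<in> carrier_mat (n k) (r k)" "slice n k (B k) x = pair_marginal n d p (k - 1) * W"
      using slice_in_range[OF p k Bk Z x] by blast
    obtain Y where Y: "Y \<in> carrier_mat (r (k - 1)) (n k)" "pair_marginal n d p (k - 1) = A (k - 1) * Y"
      using range[OF km] unfolding kk by blast
    have "A (k - 1) * (Y * W) = slice n k (B k) x"
      unfolding W(2) Y(2) using Ac[OF km] Y W by (intro assoc_mult_mat[symmetric]) auto
    moreover have "Y * W \<in> carrier_mat (r (k - 1)) (r k)" using Y W by simp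
    ultimately show ?thesis
      using least_squares_exact[OF Gm[OF k x] Ac[OF km] slice_carrier[OF Bk]]
        least_squares_normal_equation(1)[OF Gm[OF k x] Ac[OF km] slice_carrier[OF Bk]] by blast
  qed
  show "G d x \<in> carrier_mat (r (d - 1)) 1 \<and>
       A (d - 1) * G d x = Matrix.mat (n (d - 1)) 1 (\<lambda>(a, _). sketch n d p d $$ (a, x))"
    if x: "x < n d" for x
  proof -
    let ?b = "Matrix.mat (n (d - 1)) 1 (\<lambda>(a, _). sketch n d p d $$ (a, x))"
    have km: "d - 1 \<in> {1..d-1}" and kk: "d - 1 + 1 = d" using d by auto
    define W where "W = Matrix.mat (n d) 1 (\<lambda>(b, _). if b = x then 1 else (0::real))"
    have W: "W \<in> carrier_mat (n d) 1" by (simp add: W_def)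
    have Q: "pair_marginal n d p (d - 1) \<in> carrier_mat (n (d - 1)) (n d)"
      using pair_marginal_carrier[of n d p "d - 1"] unfolding kk .
    obtain Y where Y: "Y \<in> carrier_mat (r (d - 1)) (n d)" "pair_marginal n d p (d - 1) = A (d - 1) * Y"
      using range[OF km] unfolding kk by blast
    have "?b = pair_marginal n d p (d - 1) * W"
    proof (rule eq_matI)
      fix a j assume "a < dim_row (pair_marginal n d p (d - 1) * W)" "j < dim_col (pair_marginal n d p (d - 1) * W)"
      hence a: "a < n (d - 1)" "j < 1" using Q W by auto
      have "(pair_marginal n d p (d - 1) * W) $$ (a, j)
          = (\<Sum>b<n d. pair_marginal n d p (d - 1) $$ (a, b) * (if b = x then 1 else 0))"
        unfolding mat_mult_entry[OF Q W a] using a by (intro sum.cong) (auto simp: W_def)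
      also have "\<dots> = pair_marginal n d p (d - 1) $$ (a, x)"
        using mult_diag_sum(2)[OF x, of "\<lambda>b. pair_marginal n d p (d - 1) $$ (a, b)" "\<lambda>_. 1"] by simp
      finally show "?b $$ (a, j) = (pair_marginal n d p (d - 1) * W) $$ (a, j)"
        using a by (simp add: sketch_last[OF d])
    qed (use Q W in auto)
    hence "A (d - 1) * (Y * W) = ?b"
      unfolding Y(2) using Ac[OF km] Y W by (subst assoc_mult_mat[symmetric]) auto
    moreover have "Y * W \<in> carrier_mat (r (d - 1)) 1" using Y W by simp
    moreover have "?b \<in> carrier_mat (n (d - 1)) 1" by simp
    ultimately show ?thesis
      using least_squares_exact[OF Gd[OF x] Ac[OF km]] least_squares_normal_equation(1)[OF Gd[OF x] Ac[OF km]] by blast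
  qed
qed

lemma spectral_norm_eq_0:
  assumes "X \<in> carrier_mat m q" "spectral_norm X \<le> 0" "Y \<in> carrier_mat l m"
  shows "Y * X = 0\<^sub>m l q"
proof -
  have "X = 0\<^sub>m m q"
  proof (rule eq_matI)
    fix i j assume "i < dim_row (0\<^sub>m m q)" "j < dim_col (0\<^sub>m m q)"
    hence ij: "i < m" "j < q" by auto
    have "euclid_norm (X *\<^sub>v unit_vec q j) \<le> spectral_norm X * euclid_norm (unit_vec q j)"
      by (rule spectral_norm_bound[OF assms(1)]) simp
    also have "\<dots> \<le> 0" using assms(2) euclid_norm_nonneg[of "unit_vec q j"] by (simp add: mult_nonpos_nonneg)
    finally have "euclid_norm (X *\<^sub>v unit_vec q j) = 0" using euclid_norm_nonneg[of "X *\<^sub>v unit_vec q j"] by linarith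
    hence "X *\<^sub>v unit_vec q j = 0\<^sub>v m" using assms(1) by (subst (asm) euclid_norm_eq_0[of _ m]) auto
    hence "(X *\<^sub>v unit_vec q j) $ i = 0" using ij by simp
    thus "X $$ (i, j) = 0\<^sub>m m q $$ (i, j)" using ij assms(1) by simp
  qed (use assms in auto)
  thus ?thesis using assms(3) by simp
qed

lemma orthonormal_nonzero:
  fixes B :: "real mat"
  assumes "B \<in> carrier_mat m q" "B\<^sup>T * B = 1\<^sub>m q" "0 < q"
  obtains i j where "i < m" "j < q" "B $$ (i, j) \<noteq> 0"
proof -
  have "B \<noteq> 0\<^sub>m m q"
  proof
    assume z: "B = 0\<^sub>m m q"
    have "real q = frobenius_sq B" using frobenius_sq_orthonormal[OF assms(1,2)] by simp
    also have "\<dots> = 0" by (simp add: z frobenius_sq_def)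
    finally show False using assms(3) by simp
  qed
  hence "\<exists>i<m. \<exists>j<q. B $$ (i, j) \<noteq> 0"
    by (rule contrapos_np) (use assms(1) in \<open>auto intro!: eq_matI\<close>)
  thus ?thesis using that by blast
qed

text \<open>
  The cores determine the singular bases for \<open>k < d\<close>, and the last pair marginal for \<open>k = d\<close>; none of these
  vanishes.
\<close>
lemma exact_core_norm_pos:
  assumes d: "2 \<le> d" and p: "markov_density n d p"
    and rank: "\<And>k. k \<in> {1..d-1} \<Longrightarrow> vec_space.rank (dim_row (unfolding_matrix n d p k)) (unfolding_matrix n d p k) = r k"
    and tt: "tt_rs n d r p A G" and k: "k \<in> {1..d}"
  shows "0 < core_norm n d k (G k)"
proof -
  obtain B where B: "\<And>k. k \<in> {1..d-1} \<Longrightarrow> first_left_singular_vectors (sketch n d p k) (r k) (B k)"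
    "\<And>k. k \<in> {1..d-1} \<Longrightarrow> A k = coefficient_matrix n k (B k)"
    "\<And>x. x < n 1 \<Longrightarrow> G 1 x = Matrix.mat 1 (r 1) (\<lambda>(_, \<alpha>). B 1 $$ (x, \<alpha>))"
    "\<And>k x. k \<in> {2..d-1} \<Longrightarrow> x < n k \<Longrightarrow> least_squares (A (k - 1)) (slice n k (B k) x) (G k x)"
    "\<And>x. x < n d \<Longrightarrow> least_squares (A (d - 1)) (Matrix.mat (n (d - 1)) 1 (\<lambda>(a, _). sketch n d p d $$ (a, x))) (G d x)"
    using tt_rs_basis[OF tt] by blast
  note basis = singular_basis_of_sketch[OF p _ rank B(1)]
  have exact1: "G k x \<in> carrier_mat (r (k - 1)) (r k) \<and> A (k - 1) * G k x = slice n k (B k) x"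
    if "k \<in> {2..d-1}" "x < n k" for k x
    by (rule exact_core_equations(1)[where B = B, OF d p]) (fact rank B that)+
  have exact2: "G d x \<in> carrier_mat (r (d - 1)) 1 \<and>
       A (d - 1) * G d x = Matrix.mat (n (d - 1)) 1 (\<lambda>(a, _). sketch n d p d $$ (a, x))"
    if "x < n d" for x
    by (rule exact_core_equations(2)[where B = B, OF d p]) (fact rank B that)+
  have Ac: "A k \<in> carrier_mat (n k) (r k)" if "k \<in> {1..d-1}" for k
    unfolding B(2)[OF that] by (rule coefficient_matrix_carrier[OF basis(1)[OF that that that]])
  have "\<exists>x<n k. 0 < slice_norm d k (G k x)"
  proof (rule ccontr)
    assume "\<not> ?thesis"
    hence z: "slice_norm d k (G k x) \<le> 0" if "x < n k" for x using that by (meson not_less)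
    consider "k = 1" | "k \<in> {2..d-1}" | "k = d" "k \<noteq> 1" using k by force
    thus False
    proof cases
      case 1
      have k1: "1 \<in> {1..d-1}" using d by auto
      have "B 1 \<in> carrier_mat (n 1) (r 1)" using basis(1)[OF k1 k1 k1] by (simp add: sketch_rows_def)
      from orthonormal_nonzero[OF this basis(2)[OF k1 k1 k1] sketch_rank(3)[OF p k1 rank[OF k1]]]
      obtain i j where ij: "i < n 1" "j < r 1" "B 1 $$ (i, j) \<noteq> 0" .
      have "euclid_norm (Matrix.row (G 1 i) 0) \<le> 0" using z[of i] 1 ij by (simp add: slice_norm_def)
      hence "euclid_norm (Matrix.row (G 1 i) 0) = 0" using euclid_norm_nonneg[of "Matrix.row (G 1 i) 0"] by linarith
      moreover have "Matrix.row (G 1 i) 0 \<in> carrier_vec (r 1)" using B(3)[OF ij(1)] by simp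
      ultimately have "Matrix.row (G 1 i) 0 = 0\<^sub>v (r 1)" using euclid_norm_eq_0 by blast
      hence "Matrix.row (G 1 i) 0 $ j = 0" using ij by simp
      thus False using B(3)[OF ij(1)] ij by simp
    next
      case 2
      hence k1: "k \<in> {1..d-1}" and km: "k - 1 \<in> {1..d-1}" and ne: "k \<noteq> 1" "k \<noteq> d" by auto
      have Bk: "B k \<in> carrier_mat (n (k - 1) * n k) (r k)"
        using basis(1)[OF k1 k1 k1] ne by (simp add: sketch_rows_def)
      from orthonormal_nonzero[OF this basis(2)[OF k1 k1 k1] sketch_rank(3)[OF p k1 rank[OF k1]]]
      obtain i j where ij: "i < n (k - 1) * n k" "j < r k" "B k $$ (i, j) \<noteq> 0" .
      have x: "i mod n k < n k" using markov_states_nonempty[OF p, of k] k by simp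
      have a: "i div n k < n (k - 1)" using ij(1) by (simp add: less_mult_imp_div_less)
      have "spectral_norm (G k (i mod n k)) \<le> 0" using z[OF x] ne by (simp add: slice_norm_def)
      hence "slice n k (B k) (i mod n k) = 0\<^sub>m (n (k - 1)) (r k)"
        using spectral_norm_eq_0[of "G k (i mod n k)" "r (k - 1)" "r k" "A (k - 1)" "n (k - 1)"]
          exact1[OF 2 x] Ac[OF km] by simp
      hence "slice n k (B k) (i mod n k) $$ (i div n k, j) = 0" using a ij by simp
      thus False using a ij Bk by (simp add: slice_def)
    next
      case 3
      have km: "d - 1 \<in> {1..d-1}" and kk: "d - 1 + 1 = d" using d by auto
      have "pair_marginal n d p (d - 1) = 0\<^sub>m (n (d - 1)) (n (d - 1 + 1))"
      proof (rule eq_matI)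
        fix a x assume "a < dim_row (0\<^sub>m (n (d - 1)) (n (d - 1 + 1)))" "x < dim_col (0\<^sub>m (n (d - 1)) (n (d - 1 + 1)))"
        hence ax: "a < n (d - 1)" "x < n d" using kk by auto
        note ex = exact2[OF ax(2)]
        have "euclid_norm (col (G d x) 0) \<le> 0" using z[of x] 3 ax by (simp add: slice_norm_def)
        hence "euclid_norm (col (G d x) 0) = 0" using euclid_norm_nonneg[of "col (G d x) 0"] by linarith
        moreover have "col (G d x) 0 \<in> carrier_vec (r (d - 1))"
          by (rule col_carrier_vec[OF _ conjunct1[OF ex]]) simp
        ultimately have "col (G d x) 0 = 0\<^sub>v (r (d - 1))" using euclid_norm_eq_0 by blast
        hence "A (d - 1) *\<^sub>v col (G d x) 0 = 0\<^sub>v (n (d - 1))" using Ac[OF km] by simp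
        moreover have "col (A (d - 1) * G d x) 0 = A (d - 1) *\<^sub>v col (G d x) 0"
          using ex Ac[OF km] by (intro col_mult2) auto
        ultimately have "col (A (d - 1) * G d x) 0 $ a = 0" using ax by simp
        hence "sketch n d p d $$ (a, x) = 0" using ex ax by simp
        thus "pair_marginal n d p (d - 1) $$ (a, x) = 0\<^sub>m (n (d - 1)) (n (d - 1 + 1)) $$ (a, x)"
          using ax kk by (simp add: sketch_last[OF d])
      qed (simp_all add: pair_marginal_def)
      thus False using pair_marginal_nonzero[OF p km] by simp
    qed
  qed
  then obtain x where "x < n k" "0 < slice_norm d k (G k x)" by blast
  thus ?thesis using core_norm_ge[of x n k d "G k"] by linarith
qed

section \<open>Constants and the error budget\<close>

lemma c_P_pos_le:
  assumes d: "2 \<le> d" and pos: "\<And>k. k \<in> {1..d-1} \<Longrightarrow> 0 < singular_value (sketch n d p k) (r k)"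
  shows "0 < c_P n d r p" "\<And>k. k \<in> {1..d-1} \<Longrightarrow> c_P n d r p \<le> singular_value (sketch n d p k) (r k)"
proof -
  have "(\<lambda>k. singular_value (sketch n d p k) (r k)) ` {1..d-1} \<noteq> {}" using d by auto
  thus "0 < c_P n d r p" unfolding c_P_def using pos by (subst Min_gr_iff) auto
  show "c_P n d r p \<le> singular_value (sketch n d p k) (r k)" if "k \<in> {1..d-1}" for k
    unfolding c_P_def using that by (intro Min_le) auto
qed

lemma c_G_pos_le:
  assumes d: "2 \<le> d" and pos: "\<And>k. k \<in> {1..d} \<Longrightarrow> 0 < core_norm n d k (G k)"
  shows "0 < c_G n d G" "\<And>k. k \<in> {1..d} \<Longrightarrow> c_G n d G \<le> core_norm n d k (G k)"
proof -
  have "(\<lambda>k. core_norm n d k (G k)) ` {1..d} \<noteq> {}" using d by auto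
  thus "0 < c_G n d G" unfolding c_G_def using pos by (subst Min_gr_iff) auto
  show "c_G n d G \<le> core_norm n d k (G k)" if "k \<in> {1..d}" for k
    unfolding c_G_def using that by (intro Min_le) auto
qed

lemma c_A_ge: "1 \<le> c_A d A" "k \<in> {1..d-1} \<Longrightarrow> spectral_norm (pseudoinverse (A k)) \<le> c_A d A"
  unfolding c_A_def by (rule Max_ge; simp)+

text \<open>
  The constants of the argument. Here \<open>\<gamma>\<close> is the error allowed in the linear systems: by the last two
  items it changes a core of norm \<open>g \<ge> cG\<close> by at most \<open>\<delta> * g\<close>. The quantity \<open>s\<close> is the distance
  allowed between singular subspaces. It contains \<open>1 / sqrt 2\<close> to pay for the alignment, as
  \<open>1 + s \<le> sqrt 2\<close>, and \<open>1 / nm\<close> to pay for the marginalisation.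
\<close>
lemma error_budget:
  fixes \<delta> \<epsilon> cA cG cP nm :: real
  assumes \<delta>: "0 < \<delta>" "\<delta> < 1" and c: "1 \<le> cA" "0 < cG" "0 < cP" "1 \<le> nm"
    and \<epsilon>: "\<epsilon> \<le> \<delta> / (4 * sqrt 2 * cA * (1 + 1 / cG) * (1 + 1 / cP) * nm)"
  defines "\<gamma> \<equiv> \<delta> / (2 * cA * (1 + 1 / cG))"
  defines "s \<equiv> \<gamma> / (sqrt 2 * nm)"
  shows "0 < \<gamma>" "2 * \<epsilon> / cP \<le> s" "s\<^sup>2 \<le> 1/8" "s + s\<^sup>2 \<le> \<gamma> / nm" "\<epsilon> \<le> \<gamma>" "\<gamma> \<le> \<delta> * cG" "\<gamma> < 1 / cA"
    "\<And>g. cG \<le> g \<Longrightarrow> \<gamma> * (1 + g) \<le> (1 / cA - \<gamma>) * (\<delta> * g)"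
proof -
  have G1: "1 < 1 + 1 / cG" and P1: "1 < 1 + 1 / cP" using c by auto
  hence G0: "0 < 1 + 1 / cG" and P0: "0 < 1 + 1 / cP" by linarith+
  show \<gamma>: "0 < \<gamma>" unfolding \<gamma>_def using \<delta> c G0 by (intro divide_pos_pos mult_pos_pos) simp_all
  have AG: "1 \<le> cA * (1 + 1 / cG)" using c G1 mult_mono[of 1 cA 1 "1 + 1 / cG"] by auto
  have \<gamma>2: "\<gamma> \<le> 1/2"
  proof -
    have "\<gamma> = \<delta> / (2 * (cA * (1 + 1 / cG)))" by (simp add: \<gamma>_def mult.assoc)
    also have "\<dots> \<le> 1 / (2 * 1)" using \<delta> AG by (intro frac_le) auto
    finally show ?thesis by simp
  qed
  have sq2: "0 < sqrt (2::real)" "sqrt (2::real) * sqrt 2 = 2" by auto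
  have s: "0 < s" unfolding s_def using \<gamma> c by auto
  have \<epsilon>': "\<epsilon> \<le> \<gamma> / (2 * sqrt 2 * (1 + 1 / cP) * nm)"
  proof -
    have "(2 * a * b) * (2 * c * u * v) = 4 * c * a * b * u * v" for a b c u v :: real by simp
    from this[of cA "1 + 1 / cG" "sqrt 2" "1 + 1 / cP" nm] show ?thesis
      using \<epsilon> unfolding \<gamma>_def divide_divide_eq_left by (simp only:)
  qed
  show "2 * \<epsilon> / cP \<le> s"
  proof -
    have "2 * \<epsilon> / cP \<le> 2 * (\<gamma> / (2 * sqrt 2 * (1 + 1 / cP) * nm)) / cP"
      using \<epsilon>' c by (intro divide_right_mono mult_left_mono) auto
    also have "\<dots> = \<gamma> / (sqrt 2 * nm) / ((1 + 1 / cP) * cP)" using c by simp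
    also have "(1 + 1 / cP) * cP = cP + 1" using c by (simp add: field_simps)
    also have "\<gamma> / (sqrt 2 * nm) / (cP + 1) \<le> \<gamma> / (sqrt 2 * nm) / 1"
      using \<gamma> c by (intro divide_left_mono) auto
    finally show ?thesis by (simp add: s_def)
  qed
  have sle: "s \<le> \<gamma> / sqrt 2"
    unfolding s_def using \<gamma> c by (intro divide_left_mono) auto
  have "s \<le> (1/2) / sqrt 2" using sle \<gamma>2 by (rule order_trans[OF _ divide_right_mono]) auto
  hence "s\<^sup>2 \<le> ((1/2) / sqrt 2)\<^sup>2" using s by (intro power_mono) auto
  thus s8: "s\<^sup>2 \<le> 1/8" by (simp add: power_divide)
  (* 1 + s \<le> 1 + 2/5 \<le> sqrt 2 *)
  have "sqrt 2 \<ge> (7/5::real)" by (rule real_le_rsqrt) (simp add: power2_eq_square)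
  moreover have s25: "s \<le> 2/5"
  proof -
    have "s\<^sup>2 \<le> (2/5)\<^sup>2" using s8 by (simp add: power2_eq_square)
    thus ?thesis by (rule power2_le_imp_le) simp
  qed
  ultimately have "s * (1 + s) \<le> s * sqrt 2" using s by (intro mult_left_mono) auto
  also have "s * sqrt 2 = \<gamma> / nm" by (simp add: s_def)
  finally show "s + s\<^sup>2 \<le> \<gamma> / nm" by (simp add: power2_eq_square distrib_left)
  show "\<epsilon> \<le> \<gamma>"
  proof -
    have sq1: "1 \<le> sqrt (2::real)" by simp
    have "1 \<le> 2 * sqrt (2::real)" using sq1 by linarith
    hence "1 * 1 \<le> (2 * sqrt 2) * (1 + 1 / cP)" using P1 by (rule mult_mono[OF _ less_imp_le]) auto
    hence "1 * 1 \<le> (2 * sqrt 2) * (1 + 1 / cP) * nm" using c by (intro mult_mono) auto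
    moreover have "\<gamma> / X \<le> \<gamma>" if "1 * 1 \<le> X" for X
      using that \<gamma> by (simp add: divide_le_eq mult_le_cancel_left1)
    ultimately have "\<gamma> / (2 * sqrt 2 * (1 + 1 / cP) * nm) \<le> \<gamma>" by blast
    thus ?thesis using \<epsilon>' by linarith
  qed
  show "\<gamma> \<le> \<delta> * cG"
  proof -
    have "\<gamma> \<le> \<delta> / (1 / cG)" unfolding \<gamma>_def
    proof (rule divide_left_mono)
      have "1 * (1 + 1 / cG) \<le> 2 * cA * (1 + 1 / cG)" using c G1 by (intro mult_right_mono) auto
      moreover have "1 / cG \<le> 1 * (1 + 1 / cG)" by simp
      ultimately show "1 / cG \<le> 2 * cA * (1 + 1 / cG)" by (rule order_trans[rotated])
    next
      show "0 < 2 * cA * (1 + 1 / cG) * (1 / cG)" using c G0 by (intro mult_pos_pos) simp_all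
    qed (use \<delta> in simp)
    thus ?thesis by simp
  qed
  have \<gamma>A: "\<gamma> * cA * (1 + 1 / cG) = \<delta> / 2"
  proof -
    have "\<delta> / (2 * a * u) * a * u = \<delta> / 2" if "a \<noteq> 0" "u \<noteq> 0" for a u
      using that by (simp add: field_simps)
    moreover have "cA \<noteq> 0" "1 + 1 / cG \<noteq> 0" using c G0 by auto
    ultimately show ?thesis unfolding \<gamma>_def by blast
  qed
  show "\<gamma> < 1 / cA"
  proof -
    have "\<gamma> * cA * 1 \<le> \<gamma> * cA * (1 + 1 / cG)" using \<gamma> c G1 by (intro mult_left_mono) auto
    hence "\<gamma> * cA < 1" using \<gamma>A \<delta> by linarith
    thus ?thesis using c by (simp add: field_simps)
  qed
  show "\<gamma> * (1 + g) \<le> (1 / cA - \<gamma>) * (\<delta> * g)" if g: "cG \<le> g" for g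
  proof -
    have "1 \<le> g / cG" using g c by simp
    have g0: "0 < g" using g c by linarith
    have "\<delta> * g \<le> 1 * g" using \<delta> g0 by (intro mult_right_mono) auto
    hence "1 + g + \<delta> * g \<le> 2 * (1 + 1 / cG) * g"
    proof -
      have "2 * (1 + 1 / cG) * g = 2 * g + 2 * (g / cG)" by (simp add: distrib_right)
      thus ?thesis using \<open>\<delta> * g \<le> 1 * g\<close> \<open>1 \<le> g / cG\<close> by linarith
    qed
    hence "\<gamma> * cA * (1 + g + \<delta> * g) \<le> \<gamma> * cA * (2 * (1 + 1 / cG) * g)"
      using \<gamma> c by (intro mult_left_mono) auto
    also have "\<dots> = 2 * (\<gamma> * cA * (1 + 1 / cG)) * g" by simp
    also have "\<dots> = \<delta> * g" unfolding \<gamma>A by simp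
    finally show ?thesis using c by (simp add: field_simps)
  qed
qed

section \<open>Stability of the algorithm\<close>

lemma singular_basis_alignment:
  assumes p: "markov_density n d p" and k: "k \<in> {1..d-1}"
    and rank: "vec_space.rank (dim_row (unfolding_matrix n d p k)) (unfolding_matrix n d p k) = q"
    and fl: "first_left_singular_vectors (sketch n d p k) q B"
    and fl': "first_left_singular_vectors (sketch n d ph k) q B'"
    and dev: "fnorm (sketch n d ph k - sketch n d p k) \<le> \<epsilon>"
    and c: "0 < c" "c \<le> singular_value (sketch n d p k) q"
    and s: "2 * \<epsilon> / c \<le> s" "s\<^sup>2 \<le> 1/8"
  obtains R where "R \<in> orthogonal_group q" "fnorm (B' - B * R) \<le> s + s\<^sup>2" "B' \<in> carrier_mat (sketch_rows n k) q"
proof -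
  let ?M = "sketch n d p k" and ?M' = "sketch n d ph k"
  note basis = singular_basis_of_sketch[OF p k rank fl]
  have M: "?M \<in> carrier_mat (sketch_rows n k) (n (k + 1))" "?M' \<in> carrier_mat (sketch_rows n k) (n (k + 1))"
    by (rule sketch_carrier[OF k])+
  from first_left_singular_vectors_leading[OF fl' M(2)] obtain U S V
    where svd: "is_svd ?M' U S V" and B': "B' = leading_cols U q" and q: "q \<le> sketch_rows n k" .
  note * = is_svdD[OF svd M(2)]
  have B'c: "B' \<in> carrier_mat (sketch_rows n k) q" "B'\<^sup>T * B' = 1\<^sub>m q"
    unfolding B' by (rule leading_cols_carrier[OF *(1)], rule leading_cols_orthonormal[OF *(1,2) q])
  let ?s = "fnorm (B' - B * (B\<^sup>T * B'))"
  have "singular_value ?M q * ?s \<le> 2 * fnorm (?M' - ?M)"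
    using basis(5)
    by (intro left_singular_subspace_perturbation[OF svd M(2,1) q B' basis(1,2,3) _ basis(6)]) auto
  hence "c * ?s \<le> 2 * \<epsilon>"
    using c(2) dev mult_right_mono[OF c(2) fnorm_nonneg[of "B' - B * (B\<^sup>T * B')"]] by linarith
  hence "?s \<le> 2 * \<epsilon> / c" using c(1) by (simp add: field_simps)
  hence le: "?s \<le> s" using s by linarith
  hence sq: "?s\<^sup>2 \<le> s\<^sup>2" by (intro power_mono fnorm_nonneg)
  hence "?s\<^sup>2 \<le> 1/8" using s by linarith
  from orthonormal_basis_alignment[OF basis(1,2) B'c refl this] obtain R where
    "R \<in> orthogonal_group q" "fnorm (B' - B * R) \<le> ?s + ?s\<^sup>2" .
  thus ?thesis using that B'c le sq by auto
qed

text \<open>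
  The deterministic core of the theorem. The rotation \<open>R k\<close> that aligns the perturbed singular basis at
  bond \<open>k\<close> with the exact one serves for both cores at this bond: it multiplies core \<open>k\<close> from the
  right, and its transpose multiplies core \<open>k + 1\<close> from the left.
\<close>
theorem tt_rs_stability:
  assumes d: "2 \<le> d" and p: "markov_density n d p"
    and rank: "\<And>k. k \<in> {1..d-1} \<Longrightarrow> vec_space.rank (dim_row (unfolding_matrix n d p k)) (unfolding_matrix n d p k) = r k"
    and tt: "tt_rs n d r p A G" and tt': "tt_rs n d r ph A' G'"
    and \<delta>: "0 < \<delta>" "\<delta> < 1"
    and dev: "\<And>k. k \<in> {1..d} \<Longrightarrow> fnorm (sketch n d ph k - sketch n d p k) \<le> \<epsilon>"
    and \<epsilon>: "\<epsilon> \<le> \<delta> / (4 * sqrt 2 * c_A d A * (1 + 1 / c_G n d G) * (1 + 1 / c_P n d r p) * real (Max (n ` {1..d})))"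
    and k: "k \<in> {1..d}"
  shows "core_dist n d r k (G' k) (G k) \<le> \<delta> * core_norm n d k (G k)"
proof -
  obtain B where B: "\<And>k. k \<in> {1..d-1} \<Longrightarrow> first_left_singular_vectors (sketch n d p k) (r k) (B k)"
    "\<And>k. k \<in> {1..d-1} \<Longrightarrow> A k = coefficient_matrix n k (B k)"
    "\<And>x. x < n 1 \<Longrightarrow> G 1 x = Matrix.mat 1 (r 1) (\<lambda>(_, \<alpha>). B 1 $$ (x, \<alpha>))"
    "\<And>k x. k \<in> {2..d-1} \<Longrightarrow> x < n k \<Longrightarrow> least_squares (A (k - 1)) (slice n k (B k) x) (G k x)"
    "\<And>x. x < n d \<Longrightarrow> least_squares (A (d - 1)) (Matrix.mat (n (d - 1)) 1 (\<lambda>(a, _). sketch n d p d $$ (a, x))) (G d x)"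
    using tt_rs_basis[OF tt] by blast
  obtain B' where B': "\<And>k. k \<in> {1..d-1} \<Longrightarrow> first_left_singular_vectors (sketch n d ph k) (r k) (B' k)"
    "\<And>k. k \<in> {1..d-1} \<Longrightarrow> A' k = coefficient_matrix n k (B' k)"
    "\<And>x. x < n 1 \<Longrightarrow> G' 1 x = Matrix.mat 1 (r 1) (\<lambda>(_, \<alpha>). B' 1 $$ (x, \<alpha>))"
    "\<And>k x. k \<in> {2..d-1} \<Longrightarrow> x < n k \<Longrightarrow> least_squares (A' (k - 1)) (slice n k (B' k) x) (G' k x)"
    "\<And>x. x < n d \<Longrightarrow> least_squares (A' (d - 1)) (Matrix.mat (n (d - 1)) 1 (\<lambda>(a, _). sketch n d ph d $$ (a, x))) (G' d x)"
    using tt_rs_basis[OF tt'] by blast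
  note basis = singular_basis_of_sketch[OF p _ rank B(1)]
  have exact1: "G k x \<in> carrier_mat (r (k - 1)) (r k) \<and> A (k - 1) * G k x = slice n k (B k) x"
    if "k \<in> {2..d-1}" "x < n k" for k x
    by (rule exact_core_equations(1)[where B = B, OF d p]) (fact rank B that)+
  have exact2: "G d x \<in> carrier_mat (r (d - 1)) 1 \<and>
       A (d - 1) * G d x = Matrix.mat (n (d - 1)) 1 (\<lambda>(a, _). sketch n d p d $$ (a, x))"
    if "x < n d" for x
    by (rule exact_core_equations(2)[where B = B, OF d p]) (fact rank B that)+
  have pos: "0 < n l" if "l \<in> {1..d}" for l using markov_states_nonempty[OF p that] .
  define cA cG cP nm where "cA = c_A d A" and "cG = c_G n d G" and "cP = c_P n d r p" and "nm = Max (n ` {1..d})"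
  have nm: "n l \<le> nm" if "l \<in> {1..d}" for l unfolding nm_def using that by (intro Max_ge) auto
  have nm1: "1 \<le> nm" using nm[of 1] pos[of 1] d by simp
  have cP: "0 < cP"
    unfolding cP_def by (rule c_P_pos_le(1)[OF d]) (rule basis(5); assumption)
  have cP_le: "cP \<le> singular_value (sketch n d p l) (r l)" if l: "l \<in> {1..d-1}" for l
    unfolding cP_def by (rule c_P_pos_le(2)[OF d _ l]) (rule basis(5); assumption)
  have cG: "0 < cG"
    unfolding cG_def by (rule c_G_pos_le(1)[OF d]) (rule exact_core_norm_pos[OF d p rank tt]; assumption)
  have cG_le: "cG \<le> core_norm n d l (G l)" if l: "l \<in> {1..d}" for l
    unfolding cG_def by (rule c_G_pos_le(2)[OF d _ l]) (rule exact_core_norm_pos[OF d p rank tt]; assumption)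
  have cA: "1 \<le> cA" unfolding cA_def by (rule c_A_ge)
  define \<gamma> where "\<gamma> = \<delta> / (2 * cA * (1 + 1 / cG))"
  define s where "s = \<gamma> / (sqrt 2 * real nm)"
  have nm1': "1 \<le> real nm" using nm1 by simp
  note budget = error_budget[OF \<delta> cA cG cP nm1' \<epsilon>[folded cA_def cG_def cP_def nm_def], folded \<gamma>_def, folded s_def]
  have Ac: "A k \<in> carrier_mat (n k) (r k)" if "k \<in> {1..d-1}" for k
    unfolding B(2)[OF that] by (rule coefficient_matrix_carrier[OF basis(1)[OF that that that]])
  have lower: "euclid_norm v \<le> cA * euclid_norm (A k *\<^sub>v v)" if k: "k \<in> {1..d-1}" and v: "v \<in> carrier_vec (r k)" for k v
  proof -
    obtain Z where Z: "Z \<in> carrier_mat (n (k + 1)) (r k)" "B k = sketch n d p k * Z"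
      using basis(4)[OF k k k] by blast
    have inj: "w = 0\<^sub>v (r k)" if "w \<in> carrier_vec (r k)" "A k *\<^sub>v w = 0\<^sub>v (n k)" for w
      using coefficient_matrix_injective[OF p k basis(1,2)[OF k k k] Z that(1)] that(2) B(2)[OF k] by simp
    have "euclid_norm v \<le> spectral_norm (pseudoinverse (A k)) * euclid_norm (A k *\<^sub>v v)"
      by (rule pseudoinverse_lower_bound[OF Ac[OF k] inj v])
    also have "\<dots> \<le> cA * euclid_norm (A k *\<^sub>v v)"
      unfolding cA_def using c_A_ge(2)[OF k] by (intro mult_right_mono euclid_norm_nonneg)
    finally show ?thesis .
  qed
  have "\<exists>R. R \<in> orthogonal_group (r k) \<and> fnorm (B' k - B k * R) \<le> \<gamma> / real nm \<and> B' k \<in> carrier_mat (sketch_rows n k) (r k)"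
    if k: "k \<in> {1..d-1}" for k
  proof -
    have kd: "k \<in> {1..d}" using k by auto
    obtain R where "R \<in> orthogonal_group (r k)" "fnorm (B' k - B k * R) \<le> s + s\<^sup>2" "B' k \<in> carrier_mat (sketch_rows n k) (r k)"
      using singular_basis_alignment[OF p k rank[OF k] B(1)[OF k] B'(1)[OF k] dev[OF kd] cP cP_le[OF k] budget(2,3)] .
    thus ?thesis using budget(4) by (intro exI[of _ R]) auto
  qed
  then obtain R where R: "\<And>k. k \<in> {1..d-1} \<Longrightarrow> R k \<in> orthogonal_group (r k)"
      "\<And>k. k \<in> {1..d-1} \<Longrightarrow> fnorm (B' k - B k * R k) \<le> \<gamma> / real nm"
      "\<And>k. k \<in> {1..d-1} \<Longrightarrow> B' k \<in> carrier_mat (sketch_rows n k) (r k)" by metis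
  have Rc: "R k \<in> carrier_mat (r k) (r k)" if "k \<in> {1..d-1}" for k
    using R(1)[OF that] by (simp add: orthogonal_group_def)
  have \<gamma>nm: "\<gamma> / real nm \<le> \<gamma>" using nm1' budget(1) by (simp add: divide_le_eq mult_le_cancel_left1)
  have A'c: "A' k \<in> carrier_mat (n k) (r k)" if "k \<in> {1..d-1}" for k
    unfolding B'(2)[OF that] by (rule coefficient_matrix_carrier[OF R(3)[OF that]])
  have dA: "fnorm (A' k - A k * R k) \<le> \<gamma>" if k: "k \<in> {1..d-1}" for k
  proof -
    have X: "B' k - B k * R k \<in> carrier_mat (sketch_rows n k) (r k)"
      using basis(1)[OF k k k] Rc[OF k] by simp
    have "fnorm (A' k - A k * R k) = fnorm (coefficient_matrix n k (B' k - B k * R k))"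
      unfolding B(2)[OF k] B'(2)[OF k] coefficient_matrix_diff_mult[OF basis(1)[OF k k k] R(3)[OF k] Rc[OF k]] by (rule refl)
    also have "\<dots> \<le> sqrt (real nm) * fnorm (B' k - B k * R k)"
    proof (rule fnorm_coefficient_matrix_le[OF X nm1])
      assume "k \<noteq> 1"
      thus "n (k - 1) \<le> nm" using k by (intro nm) auto
    qed
    also have "\<dots> \<le> sqrt (real nm) * (\<gamma> / real nm)" using R(2)[OF k] by (intro mult_left_mono) auto
    (* Cauchy-Schwarz needs only sqrt nm; the budget provides nm *)
    also have "\<dots> \<le> real nm * (\<gamma> / real nm)"
    proof (rule mult_right_mono)
      show "sqrt (real nm) \<le> real nm" using nm1' by (intro real_le_lsqrt) (auto simp: power2_eq_square)
    qed (use budget(1) in simp)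
    finally show ?thesis using nm1' by simp
  qed
  define g where "g = core_norm n d k (G k)"
  have g: "cG \<le> g" "0 < g" using cG_le[OF k] cG by (auto simp: g_def)
  have pert: "euclid_norm ((Gh - (R l)\<^sup>T * X * R') *\<^sub>v v) \<le> \<delta> * g * euclid_norm v"
    if l: "l \<in> {1..d-1}" and X: "X \<in> carrier_mat (r l) q" and b: "b \<in> carrier_mat (n l) q" "b' \<in> carrier_mat (n l) q"
      and eq: "A l * X = b" and ls: "least_squares (A' l) b' Gh" and R': "R' \<in> orthogonal_group q"
      and db: "fnorm (b' - b * R') \<le> \<gamma>"
      and gX: "\<And>v. v \<in> carrier_vec q \<Longrightarrow> euclid_norm (X *\<^sub>v v) \<le> g * euclid_norm v"
      and v: "v \<in> carrier_vec q" for l X q b b' Gh R' v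
  proof -
    have "0 < cA" using cA by linarith
    have "(1 / cA - \<gamma>) * euclid_norm ((Gh - (R l)\<^sup>T * X * R') *\<^sub>v v) \<le> \<gamma> * (1 + g) * euclid_norm v"
      by (rule least_squares_perturbation[OF Ac[OF l] A'c[OF l] X b eq ls \<open>0 < cA\<close> lower[OF l] R(1)[OF l] R' dA[OF l] db gX v])
    also have "\<dots> \<le> (1 / cA - \<gamma>) * (\<delta> * g) * euclid_norm v"
      using budget(8)[OF g(1)] by (intro mult_right_mono euclid_norm_nonneg)
    finally show ?thesis using budget(7) by simp
  qed
  show ?thesis unfolding g_def[symmetric]
  proof -
    consider "k = 1" | "k \<in> {2..d-1}" | "k = d" "k \<noteq> 1" using k by force
    thus "core_dist n d r k (G' k) (G k) \<le> \<delta> * g"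
    proof cases
      case 1
      have k1: "1 \<in> {1..d-1}" using d by auto
      have B1: "B 1 \<in> carrier_mat (n 1) (r 1)" "B' 1 \<in> carrier_mat (n 1) (r 1)"
        using basis(1)[OF k1 k1 k1] R(3)[OF k1] by (auto simp: sketch_rows_def)
      show ?thesis unfolding 1
      proof (rule core_dist_le[where n = n and R = "1\<^sub>m 1" and R' = "R 1"])
        show "0 < n 1" using pos d by simp
        show "1\<^sub>m 1 \<in> rotations d r (1 - 1)" by (simp add: rotations_def)
        show "R 1 \<in> rotations d r 1" using R(1)[OF k1] d by (simp add: rotations_def)
        fix x assume x: "x < n 1"
        define D where "D = G' 1 x - 1\<^sub>m 1 * G 1 x * R 1"
        have G1: "G 1 x \<in> carrier_mat 1 (r 1)" "G' 1 x \<in> carrier_mat 1 (r 1)" by (simp_all only: B(3)[OF x] B'(3)[OF x] mat_carrier)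
        note G1B = B(3)[OF x, simplified] B'(3)[OF x, simplified]
        have rowG: "Matrix.row (G 1 x) 0 = Matrix.row (B 1) x" using B1 x by (intro eq_vecI) (auto simp: G1B)
        have "Matrix.row D 0 = Matrix.row (B' 1 - B 1 * R 1) x"
        proof (rule eq_vecI)
          fix \<alpha> assume "\<alpha> < dim_vec (Matrix.row (B' 1 - B 1 * R 1) x)"
          hence \<alpha>: "\<alpha> < r 1" using Rc[OF k1] by simp
          have "(G 1 x * R 1) $$ (0, \<alpha>) = (B 1 * R 1) $$ (x, \<alpha>)"
            using G1 B1 Rc[OF k1] \<alpha> x rowG by simp
          thus "Matrix.row D 0 $ \<alpha> = Matrix.row (B' 1 - B 1 * R 1) x $ \<alpha>"
            using G1 B1 Rc[OF k1] \<alpha> x by (simp add: D_def G1B(2) del: index_mult_mat(1))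
        qed (use Rc[OF k1] in \<open>simp add: D_def\<close>)
        hence "(slice_norm d 1 D)\<^sup>2 = (euclid_norm (Matrix.row (B' 1 - B 1 * R 1) x))\<^sup>2" by (simp add: slice_norm_def)
        also have "\<dots> \<le> frobenius_sq (B' 1 - B 1 * R 1)"
          unfolding frobenius_sq_rows using x B1 Rc[OF k1]
          by (intro member_le_sum[where f = "\<lambda>i. (euclid_norm (Matrix.row (B' 1 - B 1 * R 1) i))\<^sup>2"]) auto
        finally have "(slice_norm d 1 D)\<^sup>2 \<le> (fnorm (B' 1 - B 1 * R 1))\<^sup>2" by (simp add: fnorm_sq)
        hence "slice_norm d 1 D \<le> fnorm (B' 1 - B 1 * R 1)" by (rule power2_le_imp_le[OF _ fnorm_nonneg])
        also have "\<dots> \<le> \<gamma>" using R(2)[OF k1] \<gamma>nm by linarith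
        also have "\<dots> \<le> \<delta> * cG" by (rule budget(6))
        also have "\<dots> \<le> \<delta> * g" using g \<delta> by (intro mult_left_mono) auto
        finally show "slice_norm d 1 (G' 1 x - 1\<^sub>m 1 * G 1 x * R 1) \<le> \<delta> * g" by (simp add: D_def)
      qed
    next
      case 2
      hence k1: "k \<in> {1..d-1}" and km: "k - 1 \<in> {1..d-1}" and ne: "k \<noteq> 1" "k \<noteq> d" "k \<noteq> 0" "k - 1 \<noteq> 0" "k - 1 \<noteq> d" by auto
      have Bk: "B k \<in> carrier_mat (n (k - 1) * n k) (r k)" "B' k \<in> carrier_mat (n (k - 1) * n k) (r k)"
        using basis(1)[OF k1 k1 k1] R(3)[OF k1] ne by (auto simp: sketch_rows_def)
      show ?thesis
      proof (rule core_dist_le[where n = n and R = "(R (k - 1))\<^sup>T" and R' = "R k"])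
        show "0 < n k" using pos k by simp
        show "(R (k - 1))\<^sup>T \<in> rotations d r (k - 1)"
          using orthogonal_group_transpose[OF R(1)[OF km]] ne by (simp add: rotations_def)
        show "R k \<in> rotations d r k" using R(1)[OF k1] ne by (simp add: rotations_def)
        fix x assume x: "x < n k"
        note ex = exact1[OF 2 x]
        have X: "B' k - B k * R k \<in> carrier_mat (n (k - 1) * n k) (r k)" using Bk Rc[OF k1] by simp
        have db: "fnorm (slice n k (B' k) x - slice n k (B k) x * R k) \<le> \<gamma>"
          using fnorm_slice_le[OF X x] R(2)[OF k1] \<gamma>nm slice_diff_mult[OF Bk Rc[OF k1] x] by simp
        have gX: "euclid_norm (G k x *\<^sub>v v) \<le> g * euclid_norm v" if v: "v \<in> carrier_vec (r k)" for v
        proof -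
          have "euclid_norm (G k x *\<^sub>v v) \<le> spectral_norm (G k x) * euclid_norm v"
            using ex v by (intro spectral_norm_bound) auto
          also have "\<dots> \<le> g * euclid_norm v"
            using core_norm_ge[of x n k d "G k"] x ne unfolding g_def
            by (intro mult_right_mono euclid_norm_nonneg) (simp add: slice_norm_def)
          finally show ?thesis .
        qed
        have Gh: "G' k x \<in> carrier_mat (r (k - 1)) (r k)"
          by (rule least_squares_normal_equation(1)[OF B'(4)[OF 2 x] A'c[OF km] slice_carrier[OF Bk(2)]])
        have "spectral_norm (G' k x - (R (k - 1))\<^sup>T * G k x * R k) \<le> \<delta> * g"
        proof (rule spectral_norm_le)
          show "G' k x - (R (k - 1))\<^sup>T * G k x * R k \<in> carrier_mat (r (k - 1)) (r k)"
          proof -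
            have "(R (k - 1))\<^sup>T * G k x \<in> carrier_mat (r (k - 1)) (r k)"
              using conjunct1[OF ex] Rc[OF km] by simp
            thus ?thesis by (rule minus_carrier_mat[OF mult_carrier_mat[OF _ Rc[OF k1]]])
          qed
          show "0 \<le> \<delta> * g" using \<delta> g by simp
          fix v :: "real vec" assume v: "v \<in> carrier_vec (r k)"
          show "euclid_norm ((G' k x - (R (k - 1))\<^sup>T * G k x * R k) *\<^sub>v v) \<le> \<delta> * g * euclid_norm v"
            by (rule pert[OF km conjunct1[OF ex] slice_carrier[OF Bk(1)] slice_carrier[OF Bk(2)] conjunct2[OF ex]
                B'(4)[OF 2 x] R(1)[OF k1] db gX v])
        qed
        thus "slice_norm d k (G' k x - (R (k - 1))\<^sup>T * G k x * R k) \<le> \<delta> * g" using ne by (simp add: slice_norm_def)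
      qed
    next
      case 3
      have km: "d - 1 \<in> {1..d-1}" and ne: "d \<noteq> 1" "d - 1 \<noteq> 0" "d - 1 \<noteq> d" using d by auto
      show ?thesis unfolding 3(1)
      proof (rule core_dist_le[where n = n and R = "(R (d - 1))\<^sup>T" and R' = "1\<^sub>m 1"])
        show "0 < n d" using pos d by simp
        show "(R (d - 1))\<^sup>T \<in> rotations d r (d - 1)"
          using orthogonal_group_transpose[OF R(1)[OF km]] ne by (simp add: rotations_def)
        show "1\<^sub>m 1 \<in> rotations d r d" by (simp add: rotations_def)
        fix x assume x: "x < n d"
        note ex = exact2[OF x]
        define b b' where "b = Matrix.mat (n (d - 1)) 1 (\<lambda>(a, _). sketch n d p d $$ (a, x))"
          and "b' = Matrix.mat (n (d - 1)) 1 (\<lambda>(a, _). sketch n d ph d $$ (a, x))"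
        have b: "b \<in> carrier_mat (n (d - 1)) 1" "b' \<in> carrier_mat (n (d - 1)) 1" by (simp_all add: b_def b'_def)
        have one: "1\<^sub>m 1 \<in> orthogonal_group 1" by (simp add: orthogonal_group_def)
        have "fnorm (b' - b * 1\<^sub>m 1) \<le> fnorm (sketch n d ph d - sketch n d p d)"
        proof -
          have Q: "sketch n d q d \<in> carrier_mat (n (d - 1)) (n d)" for q
            using d pair_marginal_carrier[of n d q "d - 1"] by (simp add: sketch_last)
          have D: "sketch n d ph d - sketch n d p d \<in> carrier_mat (n (d - 1)) (n d)" using Q by simp
          have "frobenius_sq (b' - b) = (\<Sum>a<n (d - 1). ((sketch n d ph d - sketch n d p d) $$ (a, x))\<^sup>2)"
            using Q[of p] Q[of ph] x by (simp add: frobenius_sq_def b_def b'_def)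
          also have "\<dots> \<le> (\<Sum>a<n (d - 1). \<Sum>j<n d. ((sketch n d ph d - sketch n d p d) $$ (a, j))\<^sup>2)"
          proof (rule sum_mono)
            fix a
            show "((sketch n d ph d - sketch n d p d) $$ (a, x))\<^sup>2 \<le> (\<Sum>j<n d. ((sketch n d ph d - sketch n d p d) $$ (a, j))\<^sup>2)"
              using x by (intro member_le_sum[where f = "\<lambda>j. ((sketch n d ph d - sketch n d p d) $$ (a, j))\<^sup>2"]) auto
          qed
          also have "\<dots> = frobenius_sq (sketch n d ph d - sketch n d p d)"
            using Q[of p] Q[of ph] by (simp add: frobenius_sq_def)
          finally show ?thesis using b by (simp add: fnorm_def)
        qed
        also have "\<dots> \<le> \<gamma>" using dev[of d] d budget(5) by simp
        finally have db: "fnorm (b' - b * 1\<^sub>m 1) \<le> \<gamma>" .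
        have col_eq: "X *\<^sub>v v = (v $ 0) \<cdot>\<^sub>v col X 0" if "X \<in> carrier_mat m 1" "v \<in> carrier_vec 1" for X :: "real mat" and v m
          using that by (intro eq_vecI) (auto simp: scalar_prod_def)
        have norm1: "euclid_norm v = \<bar>v $ 0\<bar>" if "v \<in> carrier_vec 1" for v :: "real vec"
          using that by (simp add: euclid_norm_def scalar_prod_def)
        have gX: "euclid_norm (G d x *\<^sub>v v) \<le> g * euclid_norm v" if v: "v \<in> carrier_vec 1" for v
        proof -
          have "euclid_norm (G d x *\<^sub>v v) = \<bar>v $ 0\<bar> * euclid_norm (col (G d x) 0)"
            using col_eq[OF conjunct1[OF ex] v] by (simp add: euclid_norm_smult)
          also have "\<dots> \<le> \<bar>v $ 0\<bar> * g"
            using core_norm_ge[of x n d d "G d"] x ne unfolding g_def 3(1)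
            by (intro mult_left_mono) (auto simp: slice_norm_def)
          finally show ?thesis using norm1[OF v] by (simp add: mult.commute)
        qed
        define D where "D = G' d x - (R (d - 1))\<^sup>T * G d x * 1\<^sub>m 1"
        have Dc: "D \<in> carrier_mat (r (d - 1)) 1"
        proof -
          have "(R (d - 1))\<^sup>T * G d x \<in> carrier_mat (r (d - 1)) 1"
            using conjunct1[OF ex] Rc[OF km] by simp
          thus ?thesis unfolding D_def by (rule minus_carrier_mat[OF mult_carrier_mat]) simp
        qed
        have e: "unit_vec 1 0 \<in> carrier_vec 1" by simp
        have "euclid_norm (D *\<^sub>v unit_vec 1 0) \<le> \<delta> * g * euclid_norm (unit_vec 1 0)"
          unfolding D_def
          by (rule pert[OF km conjunct1[OF ex] b conjunct2[OF ex, folded b_def] B'(5)[OF x, folded b'_def] one db gX e])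
        also have "D *\<^sub>v unit_vec 1 0 = col D 0" using col_eq[OF Dc e] by simp
        also have "euclid_norm (unit_vec 1 0) = 1" using norm1[OF e] by simp
        finally show "slice_norm d d (G' d x - (R (d - 1))\<^sup>T * G d x * 1\<^sub>m 1) \<le> \<delta> * g"
          using ne by (simp add: slice_norm_def D_def)
      qed
    qed
  qed
qed

section \<open>Sketches of the empirical density\<close>

text \<open>
  The grid points whose probabilities add up to the entry \<open>(i, j)\<close> of the sketch at \<open>k\<close>.
\<close>
definition sketch_cell :: "(nat \<Rightarrow> nat) \<Rightarrow> nat \<Rightarrow> nat \<Rightarrow> nat \<Rightarrow> nat \<Rightarrow> (nat \<Rightarrow> nat) set" where
  "sketch_cell n d k i j =
     (if k = 1 then {x \<in> grid n d. x 1 = i \<and> x 2 = j}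
      else if k = d then {x \<in> grid n d. x (d - 1) = i \<and> x d = j}
      else {x \<in> grid n d. x (k - 1) = i div n k \<and> x k = i mod n k \<and> x (k + 1) = j})"

lemma sketch_entry:
  assumes "2 \<le> d" "i < dim_row (sketch n d p k)" "j < dim_col (sketch n d p k)"
  shows "sketch n d p k $$ (i, j) = sum p (sketch_cell n d k i j)"
proof -
  have "d - 1 + 1 = d" using assms(1) by simp
  thus ?thesis using assms(2,3)
    by (auto simp: sketch_def sketch_cell_def marg2_def marg3_def numeral_2_eq_2)
qed

text \<open>
  The sizes of the sketches do not depend on \<open>p\<close>, so this family serves for the exact and the empirical
  density alike.
\<close>
definition sketch_cells :: "(nat \<Rightarrow> nat) \<Rightarrow> nat \<Rightarrow> ((nat \<Rightarrow> nat) \<Rightarrow> real) \<Rightarrow> (nat \<Rightarrow> nat) set set" where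
  "sketch_cells n d p = (\<Union>k\<in>{1..d}. (\<lambda>(i, j). sketch_cell n d k i j) `
     ({..<dim_row (sketch n d p k)} \<times> {..<dim_col (sketch n d p k)}))"

lemma sketch_dims:
  "dim_row (sketch n d p k) = (if k = 1 then n 1 else if k = d then n (d - 1) else n (k - 1) * n k)"
  "dim_col (sketch n d p k) = (if k = 1 then n 2 else if k = d then n d else n (k + 1))"
  by (auto simp: sketch_def)

lemma sketch_size_le:
  assumes "2 \<le> d" "k \<in> {1..d}" and nm: "\<And>l. l \<in> {1..d} \<Longrightarrow> n l \<le> nm" and "1 \<le> nm"
  shows "dim_row (sketch n d p k) * dim_col (sketch n d p k) \<le> nm ^ 3"
proof -
  have two: "a * b \<le> nm ^ 3" if "a \<le> nm" "b \<le> nm" for a b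
  proof -
    have "a * b * 1 \<le> nm * nm * nm" using that \<open>1 \<le> nm\<close> by (intro mult_le_mono) auto
    thus ?thesis by (simp add: power3_eq_cube)
  qed
  consider "k = 1" | "k = d" "k \<noteq> 1" | "k \<in> {2..d-1}" using assms(2) by force
  thus ?thesis
  proof cases
    case 1
    thus ?thesis using two[of "n 1" "n 2"] nm[of 1] nm[of 2] assms(1) by (simp add: sketch_dims)
  next
    case 2
    have "d - 1 \<in> {1..d}" "d \<in> {1..d}" using assms(1) by auto
    thus ?thesis using two[of "n (d - 1)" "n d"] nm 2 by (simp add: sketch_dims)
  next
    case 3
    hence "k - 1 \<in> {1..d}" "k \<in> {1..d}" "k + 1 \<in> {1..d}" "k \<noteq> 1" "k \<noteq> d" by auto
    hence "n (k - 1) * n k * n (k + 1) \<le> nm * nm * nm" using nm by (intro mult_le_mono) auto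
    thus ?thesis using \<open>k \<noteq> 1\<close> \<open>k \<noteq> d\<close> by (simp add: sketch_dims power3_eq_cube)
  qed
qed

lemma sketch_cells_family:
  "finite (sketch_cells n d p)" "S \<in> sketch_cells n d p \<Longrightarrow> S \<subseteq> grid n d"
proof -
  show "finite (sketch_cells n d p)" unfolding sketch_cells_def by (intro finite_UN_I finite_imageI) auto
  show "S \<in> sketch_cells n d p \<Longrightarrow> S \<subseteq> grid n d"
    unfolding sketch_cells_def by (auto simp: sketch_cell_def split: if_splits)
qed

lemma card_sketch_cells:
  assumes "2 \<le> d" and nm: "\<And>l. l \<in> {1..d} \<Longrightarrow> n l \<le> nm" and "1 \<le> nm"
  shows "card (sketch_cells n d p) \<le> d * nm ^ 3"
proof -
  have "card (sketch_cells n d p) \<le> (\<Sum>k\<in>{1..d}. card ((\<lambda>(i, j). sketch_cell n d k i j) `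
     ({..<dim_row (sketch n d p k)} \<times> {..<dim_col (sketch n d p k)})))"
    unfolding sketch_cells_def by (rule card_UN_le) simp
  also have "\<dots> \<le> (\<Sum>k\<in>{1..d}. nm ^ 3)"
  proof (rule sum_mono)
    fix k assume k: "k \<in> {1..d}"
    have "card ((\<lambda>(i, j). sketch_cell n d k i j) `
       ({..<dim_row (sketch n d p k)} \<times> {..<dim_col (sketch n d p k)}))
      \<le> card ({..<dim_row (sketch n d p k)} \<times> {..<dim_col (sketch n d p k)})" by (rule card_image_le) simp
    also have "\<dots> \<le> nm ^ 3" using sketch_size_le[OF assms(1) k nm assms(3), where p = p] by (simp add: card_cartesian_product)
    finally show "card ((\<lambda>(i, j). sketch_cell n d k i j) `
       ({..<dim_row (sketch n d p k)} \<times> {..<dim_col (sketch n d p k)})) \<le> nm ^ 3" .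
  qed
  finally show ?thesis by simp
qed

lemma fnorm_le_entries:
  assumes X: "X \<in> carrier_mat m q" and t: "0 \<le> t"
    and e: "\<And>i j. i < m \<Longrightarrow> j < q \<Longrightarrow> \<bar>X $$ (i, j)\<bar> \<le> t"
  shows "fnorm X \<le> t * sqrt (real (m * q))"
proof -
  have "frobenius_sq X = (\<Sum>i<m. \<Sum>j<q. \<bar>X $$ (i, j)\<bar>\<^sup>2)"
    using X by (simp add: frobenius_sq_def)
  also have "\<dots> \<le> (\<Sum>i<m. \<Sum>j<q. t\<^sup>2)"
    using e by (intro sum_mono power_mono) auto
  also have "\<dots> = t\<^sup>2 * real (m * q)" by simp
  finally have "fnorm X \<le> sqrt (t\<^sup>2 * real (m * q))" unfolding fnorm_def by (rule real_sqrt_le_mono)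
  thus ?thesis using t by (simp add: real_sqrt_mult)
qed

lemma sketch_deviation:
  assumes d: "2 \<le> d" and k: "k \<in> {1..d}" and nm: "\<And>l. l \<in> {1..d} \<Longrightarrow> n l \<le> nm" "1 \<le> nm" and t: "0 \<le> t"
    and dev: "\<And>S. S \<in> sketch_cells n d p \<Longrightarrow> \<bar>sum q S - sum p S\<bar> < t"
  shows "fnorm (sketch n d q k - sketch n d p k) \<le> t * sqrt (real nm ^ 3)"
proof -
  let ?m = "dim_row (sketch n d p k)" and ?c = "dim_col (sketch n d p k)"
  have dims: "dim_row (sketch n d q k) = ?m" "dim_col (sketch n d q k) = ?c" by (simp_all add: sketch_dims)
  have "fnorm (sketch n d q k - sketch n d p k) \<le> t * sqrt (real (?m * ?c))"
  proof (rule fnorm_le_entries[OF _ t])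
    show "sketch n d q k - sketch n d p k \<in> carrier_mat ?m ?c" by (intro minus_carrier_mat) simp
    fix i j assume ij: "i < ?m" "j < ?c"
    have "sketch_cell n d k i j \<in> sketch_cells n d p" unfolding sketch_cells_def using k ij by force
    from dev[OF this] show "\<bar>(sketch n d q k - sketch n d p k) $$ (i, j)\<bar> \<le> t"
      using ij dims by (simp add: sketch_entry[OF d])
  qed
  also have "\<dots> \<le> t * sqrt (real (nm ^ 3))"
    using sketch_size_le[OF d k nm, where p = p] t by (intro mult_left_mono real_sqrt_le_mono of_nat_mono) auto
  finally show ?thesis by simp
qed

text \<open>
  The bound on \<open>N\<close>, solved for the Frobenius norm \<open>t * sqrt (n ^ 3)\<close> of a sketch whose entries are at
  most \<open>t = sqrt (L / (2 * N))\<close>. Here \<open>a\<close>, \<open>g\<close>, \<open>c\<close> stand for \<open>c_A\<close>, \<open>1 + 1 / c_G\<close>, \<open>1 + 1 / c_P\<close>.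
\<close>
lemma sample_size_budget:
  fixes \<delta> \<eta> a g c nm rm L N dd :: real
  assumes pos: "0 < \<delta>" "0 < a" "0 < g" "0 < c" "1 \<le> nm" "1 \<le> rm" "0 < L"
    and N: "16 * a\<^sup>2 * g\<^sup>2 * c\<^sup>2 * (nm ^ 5 * rm * L / \<delta>\<^sup>2) \<le> N"
  shows "0 < N" "sqrt (L / (2 * N)) * sqrt (nm ^ 3) \<le> \<delta> / (4 * sqrt 2 * a * g * c * nm)"
proof -
  have "0 < 16 * a\<^sup>2 * g\<^sup>2 * c\<^sup>2 * (nm ^ 5 * rm * L / \<delta>\<^sup>2)"
    using pos by (intro mult_pos_pos divide_pos_pos zero_less_power) auto
  thus Npos: "0 < N" using N by linarith
  have "16 * a\<^sup>2 * g\<^sup>2 * c\<^sup>2 * nm ^ 5 * L * 1 \<le> 16 * a\<^sup>2 * g\<^sup>2 * c\<^sup>2 * nm ^ 5 * L * rm"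
    using pos by (intro mult_left_mono) auto
  also have "\<dots> = 16 * a\<^sup>2 * g\<^sup>2 * c\<^sup>2 * (nm ^ 5 * rm * L / \<delta>\<^sup>2) * \<delta>\<^sup>2" using pos by simp
  also have "\<dots> \<le> N * \<delta>\<^sup>2" using N by (intro mult_right_mono) auto
  finally have main: "16 * a\<^sup>2 * g\<^sup>2 * c\<^sup>2 * nm ^ 5 * L \<le> N * \<delta>\<^sup>2" unfolding mult_1_right .
  have "sqrt (L / (2 * N)) * sqrt (nm ^ 3) = sqrt (L / (2 * N) * nm ^ 3)" by (rule real_sqrt_mult[symmetric])
  also have "\<dots> \<le> \<delta> / (4 * sqrt 2 * a * g * c * nm)"
  proof (rule real_le_lsqrt)
    show "0 \<le> \<delta> / (4 * sqrt 2 * a * g * c * nm)" using pos by simp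
    have "(4 * sqrt 2 * a * g * c * nm)\<^sup>2 = 32 * a\<^sup>2 * g\<^sup>2 * c\<^sup>2 * nm\<^sup>2"
      by (simp add: power_mult_distrib)
    moreover have "L / (2 * N) * nm ^ 3 \<le> \<delta>\<^sup>2 / (32 * a\<^sup>2 * g\<^sup>2 * c\<^sup>2 * nm\<^sup>2)"
    proof -
      have "L * nm ^ 3 * (32 * a\<^sup>2 * g\<^sup>2 * c\<^sup>2 * nm\<^sup>2) = 2 * (16 * a\<^sup>2 * g\<^sup>2 * c\<^sup>2 * nm ^ 5 * L)"
        by (simp add: power_numeral_reduce)
      also have "\<dots> \<le> 2 * (N * \<delta>\<^sup>2)" using main by (rule mult_left_mono) simp
      also have "\<dots> = \<delta>\<^sup>2 * (2 * N)" by simp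
      finally have "L * nm ^ 3 * (32 * a\<^sup>2 * g\<^sup>2 * c\<^sup>2 * nm\<^sup>2) \<le> \<delta>\<^sup>2 * (2 * N)" .
      moreover have "0 < 32 * a\<^sup>2 * g\<^sup>2 * c\<^sup>2 * nm\<^sup>2" using pos by simp
      moreover have "L / (2 * N) * u \<le> D / y" if "L * u * y \<le> D * (2 * N)" "0 < y" for u D y
        using that Npos by (simp add: field_simps)
      ultimately show ?thesis by blast
    qed
    ultimately show "L / (2 * N) * nm ^ 3 \<le> (\<delta> / (4 * sqrt 2 * a * g * c * nm))\<^sup>2"
      by (simp add: power_divide)
  qed
  finally show "sqrt (L / (2 * N)) * sqrt (nm ^ 3) \<le> \<delta> / (4 * sqrt 2 * a * g * c * nm)" .
qed

theorem theorem19: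
  fixes p :: "nat \<Rightarrow> (nat \<Rightarrow> nat) \<Rightarrow> real"
    and K :: "nat \<Rightarrow> nat \<Rightarrow> nat \<Rightarrow> real"
    and n r :: "nat \<Rightarrow> nat"
    and d N :: nat
    and A :: "nat \<Rightarrow> real mat"
    and G :: "nat \<Rightarrow> nat \<Rightarrow> real mat"
    and M :: "'a measure"
    and Y :: "nat \<Rightarrow> 'a \<Rightarrow> (nat \<Rightarrow> nat)"
    and \<delta> \<eta> :: real
  assumes "d \<ge> 2"
    and "\<And>d'. d' \<ge> 2 \<Longrightarrow> markov_density n d' (p d')"
    and "\<And>d' k a b. d' \<ge> 2 \<Longrightarrow> k \<in> {1..<d'} \<Longrightarrow> a < n k \<Longrightarrow> b < n (k + 1) \<Longrightarrow>
           marg1 n d' (p d') k a \<noteq> 0 \<Longrightarrow> transition n d' (p d') k a b = K k a b"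
    and "\<And>k. k \<in> {1..d-1} \<Longrightarrow>
           vec_space.rank (dim_row (unfolding_matrix n d (p d) k)) (unfolding_matrix n d (p d) k) = r k"
    and "tt_rs n d r (p d) A G"
    and "prob_space M"
    and "prob_space.indep_vars M (\<lambda>_. count_space (grid n d)) Y {1..N}"
    and "\<And>i x. i \<in> {1..N} \<Longrightarrow> x \<in> grid n d \<Longrightarrow>
           measure M {\<omega> \<in> space M. Y i \<omega> = x} = p d x"
    and "0 < \<delta>" "\<delta> < 1"
    and "0 < \<eta>" "\<eta> < 1"
    and "real N \<ge> 16 * (c_A d A)\<^sup>2 * (1 + 1 / c_G n d G)\<^sup>2 * (1 + 1 / c_P n d r (p d))\<^sup>2 *
           (real (Max (n ` {1..d})) ^ 5 * real (Max (r ` {1..d-1})) *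
            ln (2 * real (Max (n ` {1..d})) ^ 3 * real d / \<eta>) / \<delta>\<^sup>2)"
  shows "measure M {\<omega> \<in> space M.
           \<forall>A' G'. tt_rs n d r (empirical N (\<lambda>i. Y i \<omega>)) A' G' \<longrightarrow>
             (\<forall>k\<in>{1..d}. core_dist n d r k (G' k) (G k) / core_norm n d k (G k) \<le> \<delta>)}
         \<ge> 1 - \<eta>"
proof -
  interpret prob_space M by (rule assms(6))
  note d = assms(1)
  have p: "markov_density n d (p d)" using assms(2) d by simp
  note rank = assms(4)
  note tt = assms(5)
  define nm rm where "nm = Max (n ` {1..d})" and "rm = Max (r ` {1..d-1})"
  define L where "L = ln (2 * real nm ^ 3 * real d / \<eta>)"
  define t where "t = sqrt (L / (2 * real N))"
  define accurate where "accurate q \<longleftrightarrow> (\<forall>A' G'. tt_rs n d r q A' G' \<longrightarrow>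
     (\<forall>k\<in>{1..d}. core_dist n d r k (G' k) (G k) / core_norm n d k (G k) \<le> \<delta>))" for q
  let ?emp = "\<lambda>\<omega>. empirical N (\<lambda>i. Y i \<omega>)"
  have pos: "0 < n l" if "l \<in> {1..d}" for l using markov_states_nonempty[OF p that] .
  have nm: "n l \<le> nm" if "l \<in> {1..d}" for l unfolding nm_def using that by (intro Max_ge) auto
  have d1: "1 \<in> {1..d}" "1 \<in> {1..d-1}" using d by auto
  have nm1: "1 \<le> nm" using nm[OF d1(1)] pos[OF d1(1)] by simp
  have rm1: "1 \<le> rm"
  proof -
    have "r 1 \<le> rm" unfolding rm_def using d1 by (intro Max_ge) auto
    thus ?thesis using sketch_rank(3)[OF p d1(2) rank[OF d1(2)]] by simp
  qed
  have core_pos: "0 < core_norm n d k (G k)" if "k \<in> {1..d}" for k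
    by (rule exact_core_norm_pos[OF d p rank tt that])
  have cG: "0 < c_G n d G" by (rule c_G_pos_le(1)[OF d core_pos])
  have cP: "0 < c_P n d r (p d)"
  proof (rule c_P_pos_le(1)[OF d])
    fix k assume k: "k \<in> {1..d-1}"
    obtain B where "\<And>k. k \<in> {1..d-1} \<Longrightarrow> first_left_singular_vectors (sketch n d (p d) k) (r k) (B k)"
      using tt_rs_basis[OF tt] by metis
    from singular_basis_of_sketch(5)[OF p k rank[OF k] this[OF k]]
    show "0 < singular_value (sketch n d (p d) k) (r k)" .
  qed
  have arg: "1 < 2 * real nm ^ 3 * real d / \<eta>"
  proof -
    have "1 * 1 \<le> real nm ^ 3 * real d" using nm1 d by (intro mult_mono one_le_power) auto
    hence "\<eta> < 2 * real nm ^ 3 * real d" using assms(12) by linarith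
    thus ?thesis using assms(11) by simp
  qed
  hence L: "0 < L" by (simp add: L_def)
  have G0: "0 < 1 + 1 / c_G n d G" and P0: "0 < 1 + 1 / c_P n d r (p d)"
    using cG cP by (auto intro: add_pos_pos)
  have A0: "0 < c_A d A" using c_A_ge(1)[of d A] by linarith
  have "1 \<le> real nm" "1 \<le> real rm" using nm1 rm1 by auto
  note budget = sample_size_budget[OF assms(9) A0 G0 P0 this L assms(13)[folded nm_def rm_def, folded L_def], folded t_def]
  have N: "0 < N" using budget(1) by simp
  have t: "0 \<le> t" using L by (simp add: t_def)
  have count: "real (card (sketch_cells n d (p d))) * (2 * exp (- 2 * real N * t\<^sup>2)) \<le> \<eta>"
  proof -
    (* t is the deviation at which the union bound over d * nm ^ 3 entries gives exactly \<eta> *)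
    have "t\<^sup>2 = L / (2 * real N)" using L by (simp add: t_def)
    hence "- 2 * real N * t\<^sup>2 = - L" using N by simp
    hence e: "exp (- 2 * real N * t\<^sup>2) = \<eta> / (2 * real nm ^ 3 * real d)"
      using arg by (simp add: exp_minus L_def)
    have "real (card (sketch_cells n d (p d))) \<le> real (d * nm ^ 3)"
      using card_sketch_cells[OF d nm nm1, where p = "p d"] by (intro of_nat_mono) auto
    hence "real (card (sketch_cells n d (p d))) * (2 * exp (- 2 * real N * t\<^sup>2))
        \<le> real (d * nm ^ 3) * (2 * exp (- 2 * real N * t\<^sup>2))" by (intro mult_right_mono) auto
    also have "\<dots> = \<eta>" unfolding e using nm1 d by simp
    finally show ?thesis .
  qed
  have "1 - \<eta> \<le> prob {\<omega> \<in> space M. \<forall>S\<in>sketch_cells n d (p d). \<bar>sum (?emp \<omega>) S - sum (p d) S\<bar> < t}"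
    by (rule empirical_uniform_deviation[OF assms(6,7,8) finite_grid sketch_cells_family N t count])
  also have "\<dots> \<le> prob {\<omega> \<in> space M. accurate (?emp \<omega>)}"
  proof (rule finite_measure_mono)
    show "{\<omega> \<in> space M. \<forall>S\<in>sketch_cells n d (p d). \<bar>sum (?emp \<omega>) S - sum (p d) S\<bar> < t}
      \<subseteq> {\<omega> \<in> space M. accurate (?emp \<omega>)}"
      unfolding accurate_def
    proof (intro subsetI CollectI conjI allI impI ballI)
      fix \<omega> A' G' k
      assume \<omega>: "\<omega> \<in> {\<omega> \<in> space M. \<forall>S\<in>sketch_cells n d (p d). \<bar>sum (?emp \<omega>) S - sum (p d) S\<bar> < t}"
        and tt': "tt_rs n d r (?emp \<omega>) A' G'" and k: "k \<in> {1..d}"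
      have dev: "fnorm (sketch n d (?emp \<omega>) l - sketch n d (p d) l) \<le> t * sqrt (real nm ^ 3)" if "l \<in> {1..d}" for l
        using \<omega> by (intro sketch_deviation[OF d that nm nm1 t]) auto
      have "core_dist n d r k (G' k) (G k) \<le> \<delta> * core_norm n d k (G k)"
      proof (rule tt_rs_stability[OF d p _ tt tt' assms(9,10) _ _ k])
        show "t * sqrt (real nm ^ 3) \<le> \<delta> / (4 * sqrt 2 * c_A d A * (1 + 1 / c_G n d G)
            * (1 + 1 / c_P n d r (p d)) * real (Max (n ` {1..d})))"
          using budget(2) unfolding nm_def .
      qed (rule rank dev; assumption)+
      thus "core_dist n d r k (G' k) (G k) / core_norm n d k (G k) \<le> \<delta>"
        using core_pos[OF k] by (simp add: divide_le_eq)
    qed auto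
    have rv: "Y i \<in> measurable M (count_space (grid n d))" if "i \<in> {1..N}" for i
      using assms(7) that unfolding indep_vars_def by blast
    show "{\<omega> \<in> space M. accurate (?emp \<omega>)} \<in> events"
    proof (rule sample_event_measurable[where I = "{1..N}" and \<Omega> = "grid n d" and
          P = "\<lambda>y. accurate (empirical N y)"])
      fix y y' :: "nat \<Rightarrow> nat \<Rightarrow> nat" assume eq: "\<And>i. i \<in> {1..N} \<Longrightarrow> y i = y' i"
      show "accurate (empirical N y) = accurate (empirical N y')"
        by (rule arg_cong[where f = accurate, OF empirical_cong[OF eq]])
    qed (use rv finite_grid in auto)
  qed
  finally show ?thesis unfolding accurate_def .
qed

end
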